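(* Let $\delta>0$ and let $t$ be any positive integer with $t\ll N^{\frac12-\delta}$. Then, as $N\to\infty$, $$Z_t(N)\sim c_t(N)\,p(N),$$ that is, $Z_t(N)=(1+o(1))\,c_t(N)\,p(N)$.
   Context: $p(N)$ is the number of partitions of $N$. A partition is a $t$-core if none of the hook lengths of its Young diagram is divisible by $t$; $c_t(N)$ is the number of $t$-core partitions of $N$. For partitions $\lambda,\mu$ of $N$, $\chi_\lambda(\mu)$ is the value of the irreducible character of the symmetric group $S_N$ labeled by $\lambda$ on the conjugacy class corresponding to $\mu$, and $Z_t(N):=\#\{(\lambda,\mu):\chi_\lambda(\mu)=0 \text{ with } \lambda \text{ a } t\text{-core}\}$, where $\lambda,\mu$ range over partitions of $N$. Here $t=t(N)$ may vary with $N$; $t\ll N^{1/2-\delta}$ means $t\le C N^{1/2-\delta}$ for some constant $C$. *)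

theory Defs
  imports
    Complex_Main
    "HOL-Library.Multiset"
    "HOL-Library.Function_Algebras"
    "HOL-Library.Landau_Symbols"
    "HOL-Combinatorics.Orbits"
begin

section \<open>Partitions, Young diagrams and hook lengths\<close>

definition partitions :: "nat \<Rightarrow> nat list set" where
  "partitions N = {la. sorted_wrt (\<ge>) la \<and> 0 \<notin> set la \<and> sum_list la = N}"

definition num_partitions :: "nat \<Rightarrow> nat" where
  "num_partitions N = card (partitions N)"

text \<open>Cells are pairs (row, column), both counted from 0.\<close>

definition diagram :: "nat list \<Rightarrow> (nat \<times> nat) set" where
  "diagram la = {(i, j). i < length la \<and> j < la ! i}"

definition hook :: "nat list \<Rightarrow> nat \<times> nat \<Rightarrow> (nat \<times> nat) set" where
  "hook la = (\<lambda>(i, j). {(a, b) \<in> diagram la. a = i \<and> j \<le> b \<or> i \<le> a \<and> b = j})"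

definition t_core :: "nat \<Rightarrow> nat list \<Rightarrow> bool" where
  "t_core t la \<longleftrightarrow> (\<forall>c \<in> diagram la. \<not> t dvd card (hook la c))"

definition num_cores :: "nat \<Rightarrow> nat \<Rightarrow> nat" where
  "num_cores t N = card {la \<in> partitions N. t_core t la}"

section \<open>The complex group algebra of the symmetric group\<close>

text \<open>
  The symmetric group on \<open>N\<close> letters consists of the permutations of \<open>{..<N}\<close>. An element of its
  group algebra is a complex-valued function vanishing on everything that is not such a permutation.
\<close>

definition sym_group :: "nat \<Rightarrow> (nat \<Rightarrow> nat) set" where
  "sym_group N = {p. p permutes {..<N}}"

definition group_algebra :: "nat \<Rightarrow> ((nat \<Rightarrow> nat) \<Rightarrow> complex) set" where
  "group_algebra N = {f. \<forall>p. p \<notin> sym_group N \<longrightarrow> f p = 0}"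

definition conv :: "nat \<Rightarrow> ((nat \<Rightarrow> nat) \<Rightarrow> complex) \<Rightarrow> ((nat \<Rightarrow> nat) \<Rightarrow> complex)
    \<Rightarrow> (nat \<Rightarrow> nat) \<Rightarrow> complex" where
  "conv N f g = (\<lambda>p. if p \<in> sym_group N then \<Sum>q\<in>sym_group N. f q * g (inv q \<circ> p) else 0)"

definition delta :: "(nat \<Rightarrow> nat) \<Rightarrow> (nat \<Rightarrow> nat) \<Rightarrow> complex" where
  "delta g = (\<lambda>p. if p = g then 1 else 0)"

section \<open>Trace of a linear map on a finite-dimensional subspace\<close>

definition fun_scale :: "complex \<Rightarrow> ('a \<Rightarrow> complex) \<Rightarrow> 'a \<Rightarrow> complex" where
  "fun_scale c f = (\<lambda>x. c * f x)"

global_interpretation fun_vs: vector_space fun_scale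
  by unfold_locales (auto simp: fun_scale_def fun_eq_iff algebra_simps)

text \<open>
  \<open>V\<close> is meant to be a finite-dimensional subspace that is mapped into itself by the linear map \<open>L\<close>;
  the value does not depend on the basis that is chosen.
\<close>

definition trace_on :: "('a \<Rightarrow> complex) set \<Rightarrow> (('a \<Rightarrow> complex) \<Rightarrow> 'a \<Rightarrow> complex) \<Rightarrow> complex" where
  "trace_on V L =
     (let B = (SOME B. fun_vs.independent B \<and> fun_vs.span B = V)
      in \<Sum>b\<in>B. fun_vs.representation B (L b) b)"

section \<open>Irreducible characters of the symmetric group\<close>

text \<open>
  The canonical tableau of shape \<open>la\<close> fills the cells with \<open>0, \<dots>, N - 1\<close> row by row.
\<close>

definition tableau :: "nat list \<Rightarrow> nat \<times> nat \<Rightarrow> nat" where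
  "tableau la = (\<lambda>(i, j). sum_list (take i la) + j)"

definition row_group :: "nat list \<Rightarrow> (nat \<Rightarrow> nat) set" where
  "row_group la = {p \<in> sym_group (sum_list la).
     \<forall>(i, j) \<in> diagram la. \<exists>j'. (i, j') \<in> diagram la \<and> p (tableau la (i, j)) = tableau la (i, j')}"

definition column_group :: "nat list \<Rightarrow> (nat \<Rightarrow> nat) set" where
  "column_group la = {p \<in> sym_group (sum_list la).
     \<forall>(i, j) \<in> diagram la. \<exists>i'. (i', j) \<in> diagram la \<and> p (tableau la (i, j)) = tableau la (i', j)}"

definition row_symmetrizer :: "nat list \<Rightarrow> (nat \<Rightarrow> nat) \<Rightarrow> complex" where
  "row_symmetrizer la = (\<lambda>p. if p \<in> row_group la then 1 else 0)"

definition column_antisymmetrizer :: "nat list \<Rightarrow> (nat \<Rightarrow> nat) \<Rightarrow> complex" where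
  "column_antisymmetrizer la = (\<lambda>p. if p \<in> column_group la then of_int (sign p) else 0)"

definition young_symmetrizer :: "nat list \<Rightarrow> (nat \<Rightarrow> nat) \<Rightarrow> complex" where
  "young_symmetrizer la = conv (sum_list la) (row_symmetrizer la) (column_antisymmetrizer la)"

text \<open>
  The irreducible representation labeled by \<open>la\<close> is the left ideal generated by the Young
  symmetrizer, with the group acting by left multiplication. With this convention the one-row
  partition labels the trivial representation and the one-column partition the sign.
\<close>

definition specht_module :: "nat list \<Rightarrow> ((nat \<Rightarrow> nat) \<Rightarrow> complex) set" where
  "specht_module la = (\<lambda>f. conv (sum_list la) f (young_symmetrizer la)) ` group_algebra (sum_list la)"

definition irr_character :: "nat list \<Rightarrow> (nat \<Rightarrow> nat) \<Rightarrow> complex" where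
  "irr_character la g = trace_on (specht_module la) (conv (sum_list la) (delta g))"

definition cycle_type :: "nat \<Rightarrow> (nat \<Rightarrow> nat) \<Rightarrow> nat multiset" where
  "cycle_type N g = image_mset card (mset_set (orbit g ` {..<N}))"

definition conj_class :: "nat list \<Rightarrow> (nat \<Rightarrow> nat) set" where
  "conj_class mu = {g \<in> sym_group (sum_list mu). cycle_type (sum_list mu) g = mset mu}"

text \<open>
  Characters are constant on conjugacy classes, so any representative may be used.
\<close>

definition chi :: "nat list \<Rightarrow> nat list \<Rightarrow> complex" where
  "chi la mu = irr_character la (SOME g. g \<in> conj_class mu)"

definition num_zeros :: "nat \<Rightarrow> nat \<Rightarrow> nat" where
  "num_zeros t N =
     card {(la, mu). la \<in> partitions N \<and> mu \<in> partitions N \<and> t_core t la \<and> chi la mu = 0}"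

end

theory Submission
  imports Defs "HOL-Real_Asymp.Real_Asymp"
begin

text \<open>
  If \<open>t\<close> divides \<open>m\<close>, a \<open>t\<close>-core has no hook of length \<open>m\<close>, so its character vanishes on every
  permutation with an \<open>m\<close>-cycle. Hence only partitions \<open>\<mu>\<close> without parts divisible by \<open>t\<close> can
  contribute nonzero values, and for \<open>t\<close> of order at most \<open>N^(1/2 - \<delta>)\<close> these are negligible:
  replacing a part \<open>s\<close> of such a \<open>\<mu>\<close> by parts \<open>t\<close> and \<open>1\<close> is at most \<open>t\<close>-to-one, while almost all
  partitions of \<open>N\<close> have at least \<open>N^(1/2 - \<epsilon>)\<close> distinct parts.

  For the vanishing, the irreducible character is shown to be proportional to the Frobenius coefficient
  \<open>g \<mapsto> [x\<^sup>\<beta>] \<Delta>(x) p\<^sub>g(x)\<close>, where \<open>\<Delta>\<close> is the Vandermonde product, \<open>p\<^sub>g\<close> the product of the power sums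
  of the cycle lengths of \<open>g\<close>, and \<open>\<beta>\<close> the sequence of \<open>\<beta>\<close>-numbers of the partition. Multiplication
  by the power sum of an \<open>m\<close>-cycle moves one \<open>\<beta>\<close>-number by \<open>m\<close>; without a hook of length \<open>m\<close> every such move
  produces a negative or a repeated entry, where an alternant has coefficient \<open>0\<close>.
\<close>

section \<open>Coefficients of alternants\<close>

text \<open>Only zeros matter, so proportionality with an unspecified nonzero factor is enough. The
  obstacle is that \<open>irr_character\<close> is a trace on a left ideal. For an idempotent
  generator \<open>e\<close> of the ideal the trace at \<open>g\<close> is the sum over
  \<open>x\<close> of \<open>e (inv x \<circ> inv g \<circ> x)\<close>, which weights each
  \<open>e h\<close> by the number of \<open>x\<close> conjugating \<open>h\<close> to
  \<open>inv g\<close>. Up to the factor \<open>fact L\<close> this number is the scalar product of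
  the Vandermonde multiples of the power sums of \<open>h\<close> and \<open>g\<close>, because both
  obey the same recursion on cycles. Expanding the scalar product over exponents
  \<open>\<beta>\<close> isolates the dependence on \<open>g\<close> in Frobenius coefficients;
  dominance decides which \<open>\<beta>\<close> survive. \<open>L\<close> is at least
  \<open>2 * N\<close> because both families of power sums have total degree \<open>N\<close> and
  the recursion needs room for the two together. On the counting side two errors are balanced by
  \<open>D\<close>, the number of distinct parts: \<open>t / D\<close>, and the proportion of
  partitions with at most \<open>D\<close> distinct parts.\<close>

text \<open>The coefficient of \<open>x\<^sup>\<beta>\<close> in the Vandermonde product of \<open>L\<close> variables times the power sums of
  degrees \<open>s k\<close> for \<open>k \<in> K\<close>. Exponents are integers so that they can be lowered without truncation;
  only \<open>\<beta> c\<close> for \<open>c < L\<close> matters.\<close>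

definition alternant_coeff :: "nat \<Rightarrow> ('k \<Rightarrow> nat) \<Rightarrow> 'k set \<Rightarrow> (nat \<Rightarrow> int) \<Rightarrow> int" where
  "alternant_coeff L s K \<beta> = (\<Sum>w | w permutes {..<L}. \<Sum>f\<in>K \<rightarrow>\<^sub>E {..<L}.
     if \<forall>c<L. \<beta> c = int (L - 1 - w c) + int (\<Sum>k | k \<in> K \<and> f k = c. s k) then sign w else 0)"

lemma alternant_coeff_cong:
  assumes "\<And>c. c < L \<Longrightarrow> \<beta> c = \<beta>' c"
  shows "alternant_coeff L s K \<beta> = alternant_coeff L s K \<beta>'"
  unfolding alternant_coeff_def using assms by (intro sum.cong refl) auto

lemma sum_PiE_insert:
  fixes F :: "('k \<Rightarrow> 'c) \<Rightarrow> 'b::comm_monoid_add"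
  assumes "finite K" "k \<notin> K" "finite C"
  shows "(\<Sum>f\<in>insert k K \<rightarrow>\<^sub>E C. F f) = (\<Sum>i\<in>C. \<Sum>f\<in>K \<rightarrow>\<^sub>E C. F (f(k := i)))"
proof -
  have "inj_on (\<lambda>(y, g). g(k := y)) (C \<times> (K \<rightarrow>\<^sub>E C))"
    using inj_combinator[OF assms(2), of "\<lambda>_. C"] .
  then have "(\<Sum>f\<in>insert k K \<rightarrow>\<^sub>E C. F f) = (\<Sum>(i, f)\<in>C \<times> (K \<rightarrow>\<^sub>E C). F (f(k := i)))"
    by (simp add: PiE_insert_eq sum.reindex case_prod_unfold)
  then show ?thesis
    by (simp add: sum.cartesian_product)
qed

text \<open>Expands one more power sum: choosing the variable \<open>i\<close> in it leaves the
  exponent at \<open>i\<close> lowered by \<open>s k\<close>, possibly below 0.\<close>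

lemma alternant_coeff_insert:
  assumes "finite K" "k \<notin> K"
  shows "alternant_coeff L s (insert k K) \<beta> = (\<Sum>i<L. alternant_coeff L s K (\<beta>(i := \<beta> i - int (s k))))"
proof -
  have *: "(\<Sum>l | l \<in> insert k K \<and> (f(k := i)) l = c. s l) =
      (\<Sum>l | l \<in> K \<and> f l = c. s l) + (if i = c then s k else 0)" for f i c
  proof -
    have "{l. l \<in> insert k K \<and> (f(k := i)) l = c} =
        (if i = c then insert k {l \<in> K. f l = c} else {l \<in> K. f l = c})"
      using assms(2) by auto
    then show ?thesis
      using assms by simp
  qed
  have "alternant_coeff L s (insert k K) \<beta> = (\<Sum>w | w permutes {..<L}. \<Sum>i<L. \<Sum>f\<in>K \<rightarrow>\<^sub>E {..<L}.
     if \<forall>c<L. (\<beta>(i := \<beta> i - int (s k))) c = int (L - 1 - w c) + int (\<Sum>k | k \<in> K \<and> f k = c. s k)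
     then sign w else 0)"
    unfolding alternant_coeff_def sum_PiE_insert[OF assms finite_lessThan] *
    by (intro sum.cong refl if_cong all_cong) (auto simp: algebra_simps)
  also have "\<dots> = (\<Sum>i<L. alternant_coeff L s K (\<beta>(i := \<beta> i - int (s k))))"
    unfolding alternant_coeff_def by (rule sum.swap)
  finally show ?thesis .
qed

text \<open>The Vandermonde product is antisymmetric and power sums are symmetric. The sign arises
  in the base case; the induction step merely permutes the chosen variable.\<close>

lemma alternant_coeff_permute:
  assumes "finite K" and \<sigma>: "\<sigma> permutes {..<L}"
  shows "alternant_coeff L s K (\<beta> \<circ> \<sigma>) = sign \<sigma> * alternant_coeff L s K \<beta>"
  using assms(1)
proof (induction K arbitrary: \<beta>)
  case empty
  have "alternant_coeff L s {} (\<beta> \<circ> \<sigma>) =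
      (\<Sum>w | w permutes {..<L}. if \<forall>c<L. \<beta> (\<sigma> c) = int (L - 1 - w c) then sign w else 0)"
    by (simp add: alternant_coeff_def)
  also have "\<dots> = (\<Sum>w | w permutes {..<L}.
      if \<forall>c<L. \<beta> (\<sigma> c) = int (L - 1 - (w \<circ> \<sigma>) c) then sign (w \<circ> \<sigma>) else 0)"
    by (rule sum_permutations_compose_right[OF \<sigma>])
  also have "\<dots> = (\<Sum>w | w permutes {..<L}. if \<forall>c<L. \<beta> c = int (L - 1 - w c) then sign w * sign \<sigma> else 0)"
  proof (intro sum.cong refl if_cong)
    fix w assume "w \<in> {w. w permutes {..<L}}"
    then show "sign (w \<circ> \<sigma>) = sign w * sign \<sigma>"
      using \<sigma> by (intro sign_compose) (auto simp: permutation_permutes)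
    show "(\<forall>c<L. \<beta> (\<sigma> c) = int (L - 1 - (w \<circ> \<sigma>) c)) \<longleftrightarrow> (\<forall>c<L. \<beta> c = int (L - 1 - w c))"
      using permutes_in_image[OF \<sigma>] permutes_surj[OF \<sigma>] by (simp add: surj_def) (metis lessThan_iff)
  qed
  also have "\<dots> = sign \<sigma> * alternant_coeff L s {} \<beta>"
    by (simp add: alternant_coeff_def sum_distrib_left if_distrib mult.commute cong: if_cong)
  finally show ?case .
next
  case (insert k K)
  have upd: "(\<beta> \<circ> \<sigma>)(i := (\<beta> \<circ> \<sigma>) i - x) = \<beta>(\<sigma> i := \<beta> (\<sigma> i) - x) \<circ> \<sigma>" for i x
    using permutes_inj[OF \<sigma>] by (auto simp: fun_eq_iff inj_eq)
  have "alternant_coeff L s (insert k K) (\<beta> \<circ> \<sigma>) =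
      (\<Sum>i<L. sign \<sigma> * alternant_coeff L s K (\<beta>(\<sigma> i := \<beta> (\<sigma> i) - int (s k))))"
    by (simp only: alternant_coeff_insert[OF insert.hyps] upd insert.IH)
  also have "\<dots> = (\<Sum>i<L. sign \<sigma> * alternant_coeff L s K (\<beta>(i := \<beta> i - int (s k))))"
    by (rule sum.permute[OF \<sigma>, symmetric, unfolded comp_def])
  finally show ?case
    by (simp only: alternant_coeff_insert[OF insert.hyps] sum_distrib_left)
qed

lemma alternant_coeff_swap:
  assumes "finite K" "a < L" "b < L" "a \<noteq> b"
  shows "alternant_coeff L s K (\<beta> \<circ> transpose a b) = - alternant_coeff L s K \<beta>"
proof -
  have "transpose a b permutes {..<L}"
    using assms by (intro permutes_swap_id) auto
  then show ?thesis
    using assms by (simp add: alternant_coeff_permute sign_swap_id)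
qed

text \<open>Antisymmetry forbids equal exponents; the other two facts express that the product is a
  polynomial and homogeneous.\<close>

lemma alternant_coeff_nonzeroD:
  assumes "finite K" and nz: "alternant_coeff L s K \<beta> \<noteq> 0"
  shows "inj_on \<beta> {..<L}" and "\<And>c. c < L \<Longrightarrow> 0 \<le> \<beta> c"
    and "(\<Sum>c<L. \<beta> c) = int (\<Sum>{..<L}) + int (\<Sum>k\<in>K. s k)"
proof -
  show "inj_on \<beta> {..<L}"
  proof (rule inj_onI, rule ccontr)
    fix a b assume ab: "a \<in> {..<L}" "b \<in> {..<L}" "\<beta> a = \<beta> b" "a \<noteq> b"
    have "\<beta> \<circ> transpose a b = \<beta>"
      using ab(3) by (auto simp: fun_eq_iff transpose_def)
    then show False
      using alternant_coeff_swap[of K a L b s \<beta>] ab assms by auto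
  qed
  define P where "P w f \<longleftrightarrow> (\<forall>c<L. \<beta> c = int (L - 1 - w c) + int (\<Sum>k | k \<in> K \<and> f k = c. s k))" for w f
  from nz have "(\<Sum>w | w permutes {..<L}. \<Sum>f\<in>K \<rightarrow>\<^sub>E {..<L}. if P w f then sign w else 0) \<noteq> 0"
    by (simp add: alternant_coeff_def P_def)
  then obtain w where "w \<in> {w. w permutes {..<L}}" and
    "(\<Sum>f\<in>K \<rightarrow>\<^sub>E {..<L}. if P w f then sign w else 0) \<noteq> 0"
    by (rule sum.not_neutral_contains_not_neutral)
  then have w: "w permutes {..<L}" and "(\<Sum>f\<in>K \<rightarrow>\<^sub>E {..<L}. if P w f then sign w else 0) \<noteq> 0"
    by simp_all
  from this(2) obtain f where f: "f \<in> K \<rightarrow>\<^sub>E {..<L}" and "(if P w f then sign w else 0) \<noteq> 0"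
    by (rule sum.not_neutral_contains_not_neutral)
  then have \<beta>: "\<forall>c<L. \<beta> c = int (L - 1 - w c) + int (\<Sum>k | k \<in> K \<and> f k = c. s k)"
    by (simp add: P_def split: if_splits)
  show "\<And>c. c < L \<Longrightarrow> 0 \<le> \<beta> c"
    using \<beta> by (simp add: sum_nonneg)
  have "(\<Sum>c<L. L - 1 - w c) = (\<Sum>c<L. L - Suc c)"
    using sum.permute[OF w, of "\<lambda>c. L - 1 - c"] by (simp add: comp_def)
  also have "\<dots> = \<Sum>{..<L}"
    by (rule sum.nat_diff_reindex)
  finally have "(\<Sum>c<L. L - 1 - w c) = \<Sum>{..<L}" .
  moreover have "(\<Sum>c<L. \<Sum>k | k \<in> K \<and> f k = c. s k) = (\<Sum>k\<in>K. s k)"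
    using f assms(1) by (intro sum.group) (auto simp: PiE_iff)
  ultimately have "(\<Sum>c<L. (L - 1 - w c) + (\<Sum>k | k \<in> K \<and> f k = c. s k)) = \<Sum>{..<L} + (\<Sum>k\<in>K. s k)"
    by (simp only: sum.distrib)
  moreover have "(\<Sum>c<L. \<beta> c) = int (\<Sum>c<L. (L - 1 - w c) + (\<Sum>k | k \<in> K \<and> f k = c. s k))"
    unfolding of_nat_sum by (intro sum.cong refl) (simp add: \<beta>)
  ultimately show "(\<Sum>c<L. \<beta> c) = int (\<Sum>{..<L}) + int (\<Sum>k\<in>K. s k)"
    by simp
qed

lemma sum_distinct_nats_ge:
  assumes "finite A"
  shows "\<Sum>{..<card A} \<le> \<Sum>(A :: nat set)"
  using assms
proof (induction "card A" arbitrary: A)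
  case (Suc n)
  then have "A \<noteq> {}" "finite A" by auto
  let ?m = "Max A"
  have m: "?m \<in> A" using \<open>A \<noteq> {}\<close> \<open>finite A\<close> by simp
  have "A \<subseteq> {..?m}" using \<open>finite A\<close> by auto
  then have "card A \<le> Suc ?m"
    by (metis card_atMost card_mono finite_atMost)
  then have "n \<le> ?m" using Suc.hyps(2) by simp
  moreover have "\<Sum>{..<card (A - {?m})} \<le> \<Sum>(A - {?m})"
    using Suc m by (intro Suc.hyps(1)) auto
  moreover have "card (A - {?m}) = n" using Suc m by simp
  moreover have "\<Sum>A = ?m + \<Sum>(A - {?m})"
    using m \<open>finite A\<close> by (rule sum.remove[rotated])
  ultimately show ?case
    unfolding Suc.hyps(2)[symmetric] lessThan_Suc by simp
qed auto

text \<open>If \<open>v\<close> were missing, \<open>v\<close> and the \<open>L\<close> exponents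
  would be \<open>L + 1\<close> distinct naturals, with a sum of at least
  \<open>\<Sum>{..L}\<close>, more than homogeneity allows.\<close>

lemma alternant_coeff_full:
  assumes "finite K" and nz: "alternant_coeff L s K \<beta> \<noteq> 0" and v: "0 \<le> v" "v + int (\<Sum>k\<in>K. s k) < int L"
  shows "\<exists>c<L. \<beta> c = v"
proof (rule ccontr)
  assume none: "\<not> (\<exists>c<L. \<beta> c = v)"
  note D = alternant_coeff_nonzeroD[OF assms(1) nz]
  define A where "A = (\<lambda>c. nat (\<beta> c)) ` {..<L}"
  have inj: "inj_on (\<lambda>c. nat (\<beta> c)) {..<L}"
    using D(1,2) by (intro inj_onI) (metis inj_onD lessThan_iff eq_nat_nat_iff)
  have "nat v \<notin> A"
    using none D(2) v by (auto simp: A_def) (metis eq_nat_nat_iff)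
  have "card A = L" "finite A"
    using inj by (auto simp: A_def card_image)
  then have "\<Sum>{..<Suc L} \<le> \<Sum>(insert (nat v) A)"
    using sum_distinct_nats_ge[of "insert (nat v) A"] \<open>nat v \<notin> A\<close> by simp
  then have "L + \<Sum>{..<L} \<le> nat v + \<Sum>A"
    using \<open>nat v \<notin> A\<close> \<open>finite A\<close> by (simp add: lessThan_Suc)
  moreover have "\<Sum>A = (\<Sum>c<L. nat (\<beta> c))"
    unfolding A_def using inj by (simp add: sum.reindex)
  moreover have "int (\<Sum>c<L. nat (\<beta> c)) = (\<Sum>c<L. \<beta> c)"
    unfolding of_nat_sum using D(2) by (intro sum.cong) auto
  ultimately show False
    using D(3) v by linarith
qed

text \<open>Only raising one of the two equal entries can separate them, and the two resulting terms
  differ by a transposition, so they cancel.\<close>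

lemma alternant_coeff_shift_not_inj:
  assumes "finite K" and ab: "a < L" "b < L" "a \<noteq> b" "\<beta> a = \<beta> b"
  shows "(\<Sum>i<L. alternant_coeff L s K (\<beta>(i := \<beta> i + d))) = 0"
proof -
  have zero: "alternant_coeff L s K (\<beta>(i := \<beta> i + d)) = 0" if "i \<noteq> a" "i \<noteq> b" for i
  proof (rule ccontr)
    assume "alternant_coeff L s K (\<beta>(i := \<beta> i + d)) \<noteq> 0"
    from alternant_coeff_nonzeroD(1)[OF assms(1) this] show False
      using ab that by (auto dest!: inj_onD[of _ _ a b])
  qed
  have "\<beta>(a := \<beta> a + d) \<circ> transpose a b = \<beta>(b := \<beta> b + d)"
    using ab by (auto simp: fun_eq_iff transpose_def)
  then have "alternant_coeff L s K (\<beta>(b := \<beta> b + d)) = - alternant_coeff L s K (\<beta>(a := \<beta> a + d))"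
    using alternant_coeff_swap[OF assms(1), of a L b s "\<beta>(a := \<beta> a + d)"] ab by simp
  moreover have "(\<Sum>i<L. alternant_coeff L s K (\<beta>(i := \<beta> i + d))) =
      (\<Sum>i\<in>{a, b}. alternant_coeff L s K (\<beta>(i := \<beta> i + d)))"
    using ab zero by (intro sum.mono_neutral_right) auto
  ultimately show ?thesis
    using ab by simp
qed

text \<open>The adjoint of multiplication by the power sum of degree \<open>m\<close> acts as a derivation on the power
  sums. The bound on \<open>L\<close> ensures that exponents near \<open>0\<close> are all occupied, so that no boundary terms
  appear.\<close>

lemma alternant_coeff_shift:
  assumes "finite K" and "\<And>c. c < L \<Longrightarrow> 0 \<le> \<beta> c" and "m + (\<Sum>k\<in>K. s k) \<le> L" and "m > 0"
  shows "(\<Sum>i<L. alternant_coeff L s K (\<beta>(i := \<beta> i + int m))) =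
    int m * (\<Sum>k | k \<in> K \<and> s k = m. alternant_coeff L s (K - {k}) \<beta>)"
  using assms(1-3)
proof (induction K arbitrary: \<beta>)
  case empty
  show ?case
  proof (cases "inj_on \<beta> {..<L}")
    case False
    then obtain a b where "a < L" "b < L" "a \<noteq> b" "\<beta> a = \<beta> b"
      by (auto simp: inj_on_def)
    then show ?thesis
      using alternant_coeff_shift_not_inj[of "{}" a L b \<beta> s "int m"] by (simp del: fun_upd_apply)
  next
    case True
    \<comment> \<open>Without power sums the exponents of a nonzero coefficient fill
      \<open>0..<L\<close> exactly. The unraised value \<open>\<beta> i\<close> is then taken by
      some other row, against injectivity of \<open>\<beta>\<close>.\<close>
    have "alternant_coeff L s {} (\<beta>(i := \<beta> i + int m)) = 0" if "i < L" for i
    proof (rule ccontr)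
      let ?\<beta> = "\<beta>(i := \<beta> i + int m)"
      assume nz: "alternant_coeff L s {} ?\<beta> \<noteq> 0"
      have full: "\<exists>c<L. ?\<beta> c = v" if "0 \<le> v" "v < int L" for v
        using alternant_coeff_full[OF _ nz, of v] that by simp
      have "inj_on ?\<beta> {..<L}"
        using alternant_coeff_nonzeroD(1)[OF _ nz] by blast
      then have card: "card {0..<int L} = card (?\<beta> ` {..<L})"
        by (subst card_image) simp_all
      have sub: "{0..<int L} \<subseteq> ?\<beta> ` {..<L}"
      proof
        fix v assume "v \<in> {0..<int L}"
        then obtain c where "c < L" "?\<beta> c = v"
          using full by (meson atLeastLessThan_iff)
        then show "v \<in> ?\<beta> ` {..<L}"
          by (metis imageI lessThan_iff)
      qed
      have "{0..<int L} = ?\<beta> ` {..<L}"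
        by (rule card_subset_eq[OF _ sub card]) simp
      moreover have "?\<beta> i \<in> ?\<beta> ` {..<L}"
        using \<open>i < L\<close> by (intro imageI) simp
      ultimately have "?\<beta> i < int L"
        by (metis atLeastLessThan_iff)
      then obtain c where c: "c < L" "?\<beta> c = \<beta> i"
        using full[of "\<beta> i"] empty.prems(1)[OF \<open>i < L\<close>] by auto
      then have "c \<noteq> i" using \<open>m > 0\<close> by auto
      then show False
        using c True \<open>i < L\<close> by (auto dest: inj_onD)
    qed
    then show ?thesis by (simp del: fun_upd_apply)
  qed
next
  case (insert k K)
  note fin = insert.hyps(1) and kK = insert.hyps(2)
  show ?case
  proof (cases "inj_on \<beta> {..<L}")
    case False
    then obtain a b where ab: "a < L" "b < L" "a \<noteq> b" "\<beta> a = \<beta> b"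
      by (auto simp: inj_on_def)
    have "alternant_coeff L s (insert k K - {l}) \<beta> = 0" for l
      using False alternant_coeff_nonzeroD(1)[of "insert k K - {l}" L s \<beta>] fin by auto
    then show ?thesis
      using alternant_coeff_shift_not_inj[OF _ ab, of "insert k K"] fin by (simp del: fun_upd_apply)
  next
    case True
    let ?W = "alternant_coeff L s"
    let ?\<gamma> = "\<lambda>l. \<beta>(l := \<beta> l - int (s k))"
    \<comment> \<open>On \<open>?big\<close> rows lowering by \<open>s k\<close> stays nonnegative
      and the induction hypothesis applies; the \<open>?small\<close> rows supply the extra term of
      the product rule.\<close>
    let ?big = "{l. l < L \<and> int (s k) \<le> \<beta> l}" and ?small = "{l. l < L \<and> \<beta> l < int (s k)}"
    have neg: "?W K' (?\<gamma> l) = 0" if "l \<in> ?small" "finite K'" for l K'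
      using alternant_coeff_nonzeroD(2)[OF that(2), of L s "?\<gamma> l" l] that(1) by auto
    have "s k + (\<Sum>k\<in>K. s k) \<le> L"
      using insert.prems(2) kK fin by simp
    then have kL: "int (s k) + int (\<Sum>k\<in>K. s k) \<le> int L"
      by (metis of_nat_add of_nat_le_iff)
    \<comment> \<open>Row \<open>l\<close> is negative after lowering, so only raising that same row
      can survive. A net change other than 0 leaves the low value \<open>\<beta> l\<close>
      unoccupied, which \<open>alternant_coeff_full\<close> excludes.\<close>
    have small: "(\<Sum>i<L. ?W K ((?\<gamma> l)(i := ?\<gamma> l i + int m))) = (if s k = m then ?W K \<beta> else 0)"
      if l: "l \<in> ?small" for l
    proof -
      have "?W K ((?\<gamma> l)(i := ?\<gamma> l i + int m)) = 0" if "i \<noteq> l" for i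
        using alternant_coeff_nonzeroD(2)[OF fin, of L s "(?\<gamma> l)(i := ?\<gamma> l i + int m)" l] l that by auto
      then have "(\<Sum>i<L. ?W K ((?\<gamma> l)(i := ?\<gamma> l i + int m))) =
          (\<Sum>i\<in>{l}. ?W K ((?\<gamma> l)(i := ?\<gamma> l i + int m)))"
        using l by (intro sum.mono_neutral_right) auto
      also have "\<dots> = ?W K (\<beta>(l := \<beta> l - int (s k) + int m))"
        by simp
      also have "\<dots> = (if s k = m then ?W K \<beta> else 0)"
      proof (cases "s k = m")
        case False
        have "?W K (\<beta>(l := \<beta> l - int (s k) + int m)) = 0"
        proof (rule ccontr)
          assume nz: "?W K (\<beta>(l := \<beta> l - int (s k) + int m)) \<noteq> 0"
          have "0 \<le> \<beta> l" "\<beta> l + int (\<Sum>k\<in>K. s k) < int L"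
            using insert.prems(1) l kL by auto
          from alternant_coeff_full[OF fin nz this] obtain c where
            c: "c < L" "(\<beta>(l := \<beta> l - int (s k) + int m)) c = \<beta> l" by blast
          then have "c \<noteq> l" using False by auto
          then show False
            using c True l by (auto dest: inj_onD)
        qed
        then show ?thesis using False by simp
      qed simp
      finally show ?thesis .
    qed
    have big: "(\<Sum>i<L. ?W K ((?\<gamma> l)(i := ?\<gamma> l i + int m))) =
        int m * (\<Sum>k' | k' \<in> K \<and> s k' = m. ?W (K - {k'}) (?\<gamma> l))" if "l \<in> ?big" for l
      using that insert.prems kK fin by (intro insert.IH) auto
    \<comment> \<open>If the coefficient is nonzero, each value in \<open>0..<s k\<close> occurs
      exactly once, so there are \<open>s k\<close> small rows. For \<open>s k = m\<close> this
      count is the factor \<open>m\<close> of the derivation.\<close>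
    have card_small: "int (card ?small) * ?W K \<beta> = int (s k) * ?W K \<beta>"
    proof (cases "?W K \<beta> = 0")
      case nz: False
      have "{0..<int (s k)} \<subseteq> \<beta> ` ?small"
      proof
        fix v assume "v \<in> {0..<int (s k)}"
        moreover from this have "0 \<le> v" "v + int (\<Sum>k\<in>K. s k) < int L"
          using kL by auto
        from alternant_coeff_full[OF fin nz this] obtain c where "c < L" "\<beta> c = v" by blast
        ultimately show "v \<in> \<beta> ` ?small" by auto
      qed
      moreover have "\<beta> ` ?small \<subseteq> {0..<int (s k)}"
        using insert.prems(1) by auto
      ultimately have "\<beta> ` ?small = {0..<int (s k)}" by blast
      moreover have "inj_on \<beta> ?small"
        using True by (rule inj_on_subset) auto
      ultimately have "card ?small = s k"
        using card_image[of \<beta> ?small] by simp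
      then show ?thesis by simp
    qed simp
    have split: "sum F {..<L} = sum F ?big + sum F ?small" for F :: "nat \<Rightarrow> int"
      by (subst sum.union_disjoint[symmetric]) (auto intro!: sum.cong)
    have "(\<Sum>i<L. ?W (insert k K) (\<beta>(i := \<beta> i + int m))) =
        (\<Sum>i<L. \<Sum>l<L. ?W K ((?\<gamma> l)(i := ?\<gamma> l i + int m)))"
    proof (intro sum.cong refl)
      fix i
      have "(\<beta>(i := \<beta> i + int m))(l := (\<beta>(i := \<beta> i + int m)) l - int (s k)) =
          (?\<gamma> l)(i := ?\<gamma> l i + int m)" for l
        by (auto simp: fun_eq_iff)
      then show "?W (insert k K) (\<beta>(i := \<beta> i + int m)) = (\<Sum>l<L. ?W K ((?\<gamma> l)(i := ?\<gamma> l i + int m)))"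
        by (simp only: alternant_coeff_insert[OF fin kK])
    qed
    also have "\<dots> = (\<Sum>l<L. \<Sum>i<L. ?W K ((?\<gamma> l)(i := ?\<gamma> l i + int m)))"
      by (rule sum.swap)
    also have "\<dots> = (\<Sum>l\<in>?big. int m * (\<Sum>k' | k' \<in> K \<and> s k' = m. ?W (K - {k'}) (?\<gamma> l))) +
        (\<Sum>l\<in>?small. if s k = m then ?W K \<beta> else 0)"
      by (subst split) (intro arg_cong2[of _ _ _ _ "(+)"] sum.cong refl big small)
    also have "(\<Sum>l\<in>?small. if s k = m then ?W K \<beta> else 0) = (if s k = m then int m * ?W K \<beta> else 0)"
      using card_small by auto
    also have "(\<Sum>l\<in>?big. int m * (\<Sum>k' | k' \<in> K \<and> s k' = m. ?W (K - {k'}) (?\<gamma> l))) =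
        (\<Sum>l<L. int m * (\<Sum>k' | k' \<in> K \<and> s k' = m. ?W (K - {k'}) (?\<gamma> l)))"
    proof (rule sum.mono_neutral_left)
      show "\<forall>l\<in>{..<L} - ?big. int m * (\<Sum>k' | k' \<in> K \<and> s k' = m. ?W (K - {k'}) (?\<gamma> l)) = 0"
      proof
        fix l assume "l \<in> {..<L} - ?big"
        then have "l \<in> ?small" by auto
        then have "(\<Sum>k' | k' \<in> K \<and> s k' = m. ?W (K - {k'}) (?\<gamma> l)) = 0"
          using neg fin by (intro sum.neutral) blast
        then show "int m * (\<Sum>k' | k' \<in> K \<and> s k' = m. ?W (K - {k'}) (?\<gamma> l)) = 0"
          by simp
      qed
    qed auto
    also have "\<dots> = int m * (\<Sum>k' | k' \<in> K \<and> s k' = m. \<Sum>l<L. ?W (K - {k'}) (?\<gamma> l))"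
      unfolding sum_distrib_left by (rule sum.swap)
    also have "\<dots> = int m * (\<Sum>k' | k' \<in> K \<and> s k' = m. ?W (insert k K - {k'}) \<beta>)"
    proof (intro arg_cong2[of _ _ _ _ "(*)"] sum.cong refl)
      fix k' assume "k' \<in> {k' \<in> K. s k' = m}"
      then have "insert k K - {k'} = insert k (K - {k'})" using kK by auto
      then show "(\<Sum>l<L. ?W (K - {k'}) (?\<gamma> l)) = ?W (insert k K - {k'}) \<beta>"
        using fin kK by (simp add: alternant_coeff_insert)
    qed
    also have "\<dots> + (if s k = m then int m * ?W K \<beta> else 0) =
        int m * (\<Sum>k' | k' \<in> insert k K \<and> s k' = m. ?W (insert k K - {k'}) \<beta>)"
    proof -
      have "{k'. k' \<in> insert k K \<and> s k' = m} =
          (if s k = m then insert k {k' \<in> K. s k' = m} else {k' \<in> K. s k' = m})" by auto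
      then show ?thesis
        using fin kK by (simp add: algebra_simps)
    qed
    finally show ?thesis .
  qed
qed

section \<open>Scalar products of Vandermonde multiples\<close>

lemma alternant_coeff_bound:
  assumes "finite K" "alternant_coeff L s K \<beta> \<noteq> 0" "c < L"
  shows "\<beta> c \<le> int (\<Sum>{..<L}) + int (\<Sum>k\<in>K. s k)"
proof -
  note D = alternant_coeff_nonzeroD[OF assms(1,2)]
  have "\<beta> c \<le> (\<Sum>c<L. \<beta> c)"
    using D(2) assms(3) by (intro member_le_sum) auto
  then show ?thesis using D(3) by simp
qed

text \<open>The scalar product with orthonormal monomials; for large \<open>L\<close> it is
  \<open>fact L\<close> times the Hall scalar product of the two power sum products. The box
  \<open>0..<B\<close> keeps the sum finite and loses nothing once \<open>B\<close> exceeds the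
  degree.\<close>

definition alternant_pairing ::
  "nat \<Rightarrow> int \<Rightarrow> ('k \<Rightarrow> nat) \<Rightarrow> 'k set \<Rightarrow> ('j \<Rightarrow> nat) \<Rightarrow> 'j set \<Rightarrow> int" where
  "alternant_pairing L B s K s' K' =
     (\<Sum>\<beta>\<in>{..<L} \<rightarrow>\<^sub>E {0..<B}. alternant_coeff L s K \<beta> * alternant_coeff L s' K' \<beta>)"

text \<open>Multiplication by the power sum of degree \<open>s k\<close> is moved to the other
  argument, where its adjoint strikes out one factor of the same degree at a time.\<close>

lemma alternant_pairing_insert:
  assumes K: "finite K" "k \<notin> K" and K': "finite K'" and pos: "s k > 0"
    and le: "s k + (\<Sum>k\<in>K'. s' k) \<le> L" and B: "int (\<Sum>{..<L}) + int (\<Sum>k\<in>K'. s' k) < B"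
  shows "alternant_pairing L B s (insert k K) s' K' =
    int (s k) * (\<Sum>k' | k' \<in> K' \<and> s' k' = s k. alternant_pairing L B s K s' (K' - {k'}))"
proof -
  let ?S = "{..<L} \<rightarrow>\<^sub>E {0..<B}" and ?W = "alternant_coeff L s K" and ?W' = "alternant_coeff L s' K'"
  let ?m = "int (s k)"
  \<comment> \<open>Substituting for \<open>\<beta> i\<close> shifts the box. The terms that fall
    outside vanish: below because exponents are nonnegative, above because \<open>B\<close> exceeds
    the degree.\<close>
  have move: "(\<Sum>\<beta>\<in>?S. ?W (\<beta>(i := \<beta> i - ?m)) * ?W' \<beta>) = (\<Sum>\<beta>\<in>?S. ?W \<beta> * ?W' (\<beta>(i := \<beta> i + ?m)))"
    if i: "i < L" for i
  proof -
    have "(\<Sum>\<beta>\<in>?S. ?W (\<beta>(i := \<beta> i - ?m)) * ?W' \<beta>) =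
        (\<Sum>\<beta> | \<beta> \<in> ?S \<and> ?m \<le> \<beta> i. ?W (\<beta>(i := \<beta> i - ?m)) * ?W' \<beta>)"
    proof (rule sum.mono_neutral_right)
      show "\<forall>\<beta>\<in>?S - {\<beta> \<in> ?S. ?m \<le> \<beta> i}. ?W (\<beta>(i := \<beta> i - ?m)) * ?W' \<beta> = 0"
        using alternant_coeff_nonzeroD(2)[OF K(1) _ i, of s] by fastforce
    qed (auto intro: finite_PiE)
    also have "\<dots> = (\<Sum>\<beta> | \<beta> \<in> ?S \<and> \<beta> i + ?m < B. ?W \<beta> * ?W' (\<beta>(i := \<beta> i + ?m)))"
      using i by (intro sum.reindex_bij_witness[of _ "\<lambda>\<beta>. \<beta>(i := \<beta> i + ?m)" "\<lambda>\<beta>. \<beta>(i := \<beta> i - ?m)"])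
        (auto simp: PiE_iff extensional_def intro: order.strict_trans1[rotated])
    also have "\<dots> = (\<Sum>\<beta>\<in>?S. ?W \<beta> * ?W' (\<beta>(i := \<beta> i + ?m)))"
    proof (rule sum.mono_neutral_left)
      show "\<forall>\<beta>\<in>?S - {\<beta> \<in> ?S. \<beta> i + ?m < B}. ?W \<beta> * ?W' (\<beta>(i := \<beta> i + ?m)) = 0"
        using alternant_coeff_bound[OF K' _ i, of s'] B by fastforce
    qed (auto intro: finite_PiE)
    finally show ?thesis .
  qed
  have "alternant_pairing L B s (insert k K) s' K' =
      (\<Sum>i<L. \<Sum>\<beta>\<in>?S. ?W (\<beta>(i := \<beta> i - ?m)) * ?W' \<beta>)"
    unfolding alternant_pairing_def alternant_coeff_insert[OF K] sum_distrib_right by (rule sum.swap)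
  also have "\<dots> = (\<Sum>i<L. \<Sum>\<beta>\<in>?S. ?W \<beta> * ?W' (\<beta>(i := \<beta> i + ?m)))"
    by (rule sum.cong[OF refl]) (rule move, simp)
  also have "\<dots> = (\<Sum>\<beta>\<in>?S. ?W \<beta> * (\<Sum>i<L. ?W' (\<beta>(i := \<beta> i + ?m))))"
    unfolding sum_distrib_left by (rule sum.swap)
  also have "\<dots> = (\<Sum>\<beta>\<in>?S. ?W \<beta> * (?m * (\<Sum>k' | k' \<in> K' \<and> s' k' = s k. alternant_coeff L s' (K' - {k'}) \<beta>)))"
  proof (intro sum.cong refl arg_cong2[of _ _ _ _ "(*)"])
    fix \<beta> assume "\<beta> \<in> ?S"
    then show "(\<Sum>i<L. ?W' (\<beta>(i := \<beta> i + ?m))) =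
        ?m * (\<Sum>k' | k' \<in> K' \<and> s' k' = s k. alternant_coeff L s' (K' - {k'}) \<beta>)"
      using K' le pos by (intro alternant_coeff_shift) (auto simp: PiE_iff)
  qed
  also have "\<dots> = ?m * (\<Sum>\<beta>\<in>?S. \<Sum>k' | k' \<in> K' \<and> s' k' = s k. ?W \<beta> * alternant_coeff L s' (K' - {k'}) \<beta>)"
    by (simp add: sum_distrib_left mult.left_commute)
  also have "\<dots> = ?m * (\<Sum>k' | k' \<in> K' \<and> s' k' = s k. alternant_pairing L B s K s' (K' - {k'}))"
    unfolding alternant_pairing_def by (subst sum.swap) (rule refl)
  finally show ?thesis .
qed

lemma alternant_coeff_empty_staircase:
  "alternant_coeff L s {} (\<lambda>c. int (L - 1 - c)) = 1"
proof -
  have "w = id" if w: "w permutes {..<L}" and eq: "\<forall>c<L. L - 1 - c = L - 1 - w c" for w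
  proof
    fix c
    show "w c = id c"
    proof (cases "c < L")
      case True
      then have "w c < L" using permutes_in_image[OF w, of c] by simp
      with True eq[rule_format, OF True] show ?thesis by simp
    next
      case False
      then show ?thesis using w by (simp add: permutes_not_in)
    qed
  qed
  then have "{w. w permutes {..<L} \<and> (\<forall>c<L. L - 1 - c = L - 1 - w c)} = {id}"
    by (auto simp: permutes_id)
  moreover have "alternant_coeff L s {} (\<lambda>c. int (L - 1 - c)) =
      (\<Sum>w\<in>{w \<in> {w. w permutes {..<L}}. \<forall>c<L. L - 1 - c = L - 1 - w c}. sign w)"
    unfolding alternant_coeff_def
    by (subst sum.inter_filter) (simp_all add: finite_permutations del: of_nat_diff)
  ultimately show ?thesis by simp
qed

text \<open>The Vandermonde product has \<open>fact L\<close> monomials, each with coefficient 1 or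
  -1, and each contributes its square.\<close>

lemma alternant_pairing_empty:
  assumes B: "int L \<le> B"
  shows "alternant_pairing L B s {} s' {} = fact L"
proof -
  let ?S = "{..<L} \<rightarrow>\<^sub>E {0..<B}" and ?W = "alternant_coeff L s {}"
  let ?\<rho> = "\<lambda>c. int (L - 1 - c)"
  have [simp]: "alternant_coeff L s' {} = ?W"
    by (simp add: alternant_coeff_def fun_eq_iff)
  have "alternant_pairing L B s {} s' {} =
      (\<Sum>\<beta>\<in>?S. \<Sum>w | w permutes {..<L}. (if \<forall>c<L. \<beta> c = ?\<rho> (w c) then sign w else 0) * ?W \<beta>)"
    by (simp add: alternant_pairing_def alternant_coeff_def[of L s "{}"] sum_distrib_right cong: if_cong)
  also have "\<dots> = (\<Sum>w | w permutes {..<L}. \<Sum>\<beta>\<in>?S. (if \<forall>c<L. \<beta> c = ?\<rho> (w c) then sign w else 0) * ?W \<beta>)"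
    by (rule sum.swap)
  also have "\<dots> = (\<Sum>w | w permutes {..<L}. 1)"
  proof (intro sum.cong refl)
    fix w assume "w \<in> {w. w permutes {..<L}}"
    then have w: "w permutes {..<L}" by simp
    let ?r = "restrict (\<lambda>c. ?\<rho> (w c)) {..<L}"
    have iff: "(\<forall>c<L. \<beta> c = ?\<rho> (w c)) \<longleftrightarrow> \<beta> = ?r" if "\<beta> \<in> ?S" for \<beta>
      using that by (auto simp: fun_eq_iff restrict_def PiE_iff extensional_def)
    have "?r \<in> ?S" using B by auto
    have "(\<Sum>\<beta>\<in>?S. (if \<forall>c<L. \<beta> c = ?\<rho> (w c) then sign w else 0) * ?W \<beta>) =
        (\<Sum>\<beta>\<in>?S. if \<beta> = ?r then sign w * ?W ?r else 0)"
    proof (intro sum.cong refl)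
      fix \<beta> assume \<beta>: "\<beta> \<in> ?S"
      show "(if \<forall>c<L. \<beta> c = ?\<rho> (w c) then sign w else 0) * ?W \<beta> =
          (if \<beta> = ?r then sign w * ?W ?r else 0)"
      proof (cases "\<beta> = ?r")
        case True
        show ?thesis
          unfolding if_P[OF True] if_P[OF iff[OF \<beta>, THEN iffD2, OF True]] unfolding True by (rule refl)
      next
        case False
        then have "\<not> (\<forall>c<L. \<beta> c = ?\<rho> (w c))" using iff[OF \<beta>] by blast
        then show ?thesis
          unfolding if_not_P[OF False] by (simp only: if_False mult_zero_left)
      qed
    qed
    also have "\<dots> = sign w * ?W ?r"
      using \<open>?r \<in> ?S\<close> by (simp add: finite_PiE)
    also have "?W ?r = ?W (?\<rho> \<circ> w)"
      by (rule alternant_coeff_cong) simp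
    also have "\<dots> = sign w"
      using alternant_coeff_permute[OF _ w, of "{}" s ?\<rho>] by (simp only: alternant_coeff_empty_staircase mult_1_right finite.emptyI)
    finally show "(\<Sum>\<beta>\<in>?S. (if \<forall>c<L. \<beta> c = ?\<rho> (w c) then sign w else 0) * ?W \<beta>) = 1"
      by simp
  qed
  also have "\<dots> = fact L"
    by (simp add: card_permutations)
  finally show ?thesis .
qed

lemma alternant_pairing_size_mismatch:
  assumes "finite K" "finite K'" "(\<Sum>k\<in>K. s k) \<noteq> (\<Sum>k\<in>K'. s' k)"
  shows "alternant_pairing L B s K s' K' = 0"
  unfolding alternant_pairing_def
proof (rule sum.neutral, rule ballI)
  fix \<beta> :: "nat \<Rightarrow> int"
  show "alternant_coeff L s K \<beta> * alternant_coeff L s' K' \<beta> = 0"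
    using alternant_coeff_nonzeroD(3)[OF assms(1), of L s \<beta>]
      alternant_coeff_nonzeroD(3)[OF assms(2), of L s' \<beta>] assms(3) by fastforce
qed

section \<open>Counting conjugators and invariant colourings\<close>

lemma orbit_period:
  assumes "permutation f"
  shows "(f ^^ card (orbit f x)) x = x"
    and "bij_betw (\<lambda>n. (f ^^ n) x) {..<card (orbit f x)} (orbit f x)"
proof -
  let ?d = "funpow_dist1 f x x"
  have self: "x \<in> orbit f x" using assms by (rule permutation_self_in_orbit)
  have bij: "bij_betw (\<lambda>n. (f ^^ n) x) {..<?d} (orbit f x)"
    using inj_on_funpow_dist1[OF self] orbit_conv_funpow_dist1[OF self]
    by (simp add: bij_betw_def lessThan_atLeast0)
  then have d: "card (orbit f x) = ?d"
    using bij_betw_same_card by fastforce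
  show "(f ^^ card (orbit f x)) x = x"
    unfolding d by (rule funpow_dist1_prop[OF self])
  show "bij_betw (\<lambda>n. (f ^^ n) x) {..<card (orbit f x)} (orbit f x)"
    unfolding d by (rule bij)
qed

lemma cyclic_on_cases:
  assumes "cyclic_on f A" "cyclic_on f B"
  shows "A = B \<or> A \<inter> B = {}"
  using assms by (metis disjoint_iff orbit_cyclic_eq3)

lemma cyclic_on_finite:
  assumes "permutation f" "cyclic_on f A"
  shows "finite A" "A \<noteq> {}"
  using assms by (auto simp: cyclic_on_def intro: finite_orbit permutation_self_in_orbit)

text \<open>Parametrised by sets of cycles so that conjugators can be counted one cycle at a time;
  extensionality keeps the set finite.\<close>

definition intertwiners :: "('a \<Rightarrow> 'a) \<Rightarrow> 'a set set \<Rightarrow> ('b \<Rightarrow> 'b) \<Rightarrow> 'b set set \<Rightarrow> ('a \<Rightarrow> 'b) set" where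
  "intertwiners g K h K' =
     {x \<in> \<Union>K \<rightarrow>\<^sub>E \<Union>K'. bij_betw x (\<Union>K) (\<Union>K') \<and> (\<forall>i\<in>\<Union>K. x (g i) = h (x i))}"

text \<open>On the cycle \<open>k\<close> an intertwiner is determined by the image of one base
  point, which may be any point of a cycle of the same length: \<open>card k\<close> choices for
  each such cycle. With \<open>s = card\<close> this is the recursion of
  \<open>alternant_pairing_insert\<close>.\<close>

lemma card_intertwiners_insert:
  assumes g: "permutation g" and h: "permutation h"
    and K: "finite K" "k \<notin> K" "\<And>l. l \<in> insert k K \<Longrightarrow> cyclic_on g l"
    and K': "finite K'" "\<And>l. l \<in> K' \<Longrightarrow> cyclic_on h l"
  shows "card (intertwiners g (insert k K) h K') =
    card k * (\<Sum>k' | k' \<in> K' \<and> card k' = card k. card (intertwiners g K h (K' - {k'})))"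
proof -
  obtain o\<^sub>0 where o: "o\<^sub>0 \<in> k" and k: "k = orbit g o\<^sub>0"
    using K(3)[of k] by (auto simp: cyclic_on_def)
  define m where "m = card k"
  define A where "A = \<Union>K"
  have kA: "k \<inter> A = {}"
    unfolding A_def using K(2,3) cyclic_on_cases[of g k] by blast
  have UK: "\<Union>(insert k K) = k \<union> A" by (simp add: A_def)
  have finA: "finite (\<Union>K)" "finite (\<Union>K')"
    using cyclic_on_finite[OF g] cyclic_on_finite[OF h] K K' by auto
  have orbK': "orbit h e \<in> K'" if "e \<in> \<Union>K'" for e
    using that K'(2) orbit_cyclic_eq3 by (metis UnionE)
  have diff: "\<Union>(K' - {orbit h e}) = \<Union>K' - orbit h e" if "e \<in> \<Union>K'" for e
  proof -
    have "l = orbit h e \<or> l \<inter> orbit h e = {}" if "l \<in> K'" for l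
      using that K'(2) orbK'[OF \<open>e \<in> \<Union>K'\<close>] cyclic_on_cases by blast
    then show ?thesis by blast
  qed
  let ?E = "{e \<in> \<Union>K'. card (orbit h e) = m}"
  let ?I = "\<lambda>e. intertwiners g K h (K' - {orbit h e})"
  let ?\<Phi> = "\<lambda>x. (x o\<^sub>0, restrict x A)"
  have gk: "g i \<in> k" if "i \<in> k" for i
    using cyclic_on_inI[OF K(3)[OF insertI1] that] .
  have gA: "g i \<in> A" if "i \<in> A" for i
    using that K(3) cyclic_on_inI[of g] unfolding A_def by blast
  have pow: "x ((g ^^ n) o\<^sub>0) = (h ^^ n) (x o\<^sub>0) \<and> (g ^^ n) o\<^sub>0 \<in> k"
    if "x \<in> intertwiners g (insert k K) h K'" for x n
  proof (induction n)
    case (Suc n)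
    have "x (g i) = h (x i)" if "i \<in> k" for i
      using \<open>x \<in> _\<close> that unfolding intertwiners_def by blast
    with Suc gk show ?case by simp
  qed (use o in simp)
  have orb_g: "\<exists>n<m. i = (g ^^ n) o\<^sub>0" if "i \<in> k" for i
  proof -
    have "i \<in> (\<lambda>n. (g ^^ n) o\<^sub>0) ` {..<m}"
      using bij_betw_imp_surj_on[OF orbit_period(2)[OF g, of o\<^sub>0]] that
      unfolding m_def k by (rule ssubst)
    then show ?thesis by blast
  qed
  have "bij_betw ?\<Phi> (intertwiners g (insert k K) h K') (Sigma ?E ?I)"
  proof (rule bij_betw_imageI)
    show "inj_on ?\<Phi> (intertwiners g (insert k K) h K')"
    proof (rule inj_onI)
      fix x y assume xy: "x \<in> intertwiners g (insert k K) h K'" "y \<in> intertwiners g (insert k K) h K'"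
        and eq: "?\<Phi> x = ?\<Phi> y"
      have "x i = y i" if i: "i \<in> k \<union> A" for i
      proof (cases "i \<in> A")
        case True
        then show ?thesis using eq by (metis prod.inject restrict_apply')
      next
        case False
        then obtain n where "i = (g ^^ n) o\<^sub>0" using i orb_g by blast
        then show ?thesis using pow[OF xy(1)] pow[OF xy(2)] eq by simp
      qed
      then show "x = y"
        using xy unfolding intertwiners_def UK by (auto intro: PiE_ext)
    qed
    show "?\<Phi> ` intertwiners g (insert k K) h K' = Sigma ?E ?I"
    proof (intro equalityI subsetI)
      fix p assume "p \<in> ?\<Phi> ` intertwiners g (insert k K) h K'"
      then obtain x where x: "x \<in> intertwiners g (insert k K) h K'" and p: "p = ?\<Phi> x" by blast
      have bij: "bij_betw x (k \<union> A) (\<Union>K')" and comm: "\<And>i. i \<in> k \<union> A \<Longrightarrow> x (g i) = h (x i)"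
        using x unfolding intertwiners_def UK by auto
      have e: "x o\<^sub>0 \<in> \<Union>K'"
        using bij o bij_betwE by blast
      have img: "x ` k = orbit h (x o\<^sub>0)"
        unfolding k
      proof (rule orbit_inverse)
        show "o\<^sub>0 \<in> orbit g o\<^sub>0" using o unfolding k[symmetric] .
        fix i assume "i \<in> orbit g o\<^sub>0"
        then have "i \<in> k \<union> A" unfolding k[symmetric] by (rule UnI1)
        then show "h (x i) = x (g i)" by (rule comm[symmetric])
      qed
      have inj: "inj_on x (k \<union> A)" using bij by (rule bij_betw_imp_inj_on)
      then have "card (orbit h (x o\<^sub>0)) = m"
        unfolding img[symmetric] m_def by (intro card_image) (auto intro: inj_on_subset)
      moreover have "bij_betw x A (\<Union>K' - orbit h (x o\<^sub>0))"
      proof -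
        have "x ` A = x ` (k \<union> A) - x ` k"
          using inj kA by (auto simp: inj_on_def)
        then show ?thesis
          using bij inj img by (auto simp: bij_betw_def intro: inj_on_subset)
      qed
      then have "restrict x A \<in> ?I (x o\<^sub>0)"
        using comm gA unfolding intertwiners_def diff[OF e] A_def[symmetric]
        by (auto simp: bij_betw_def inj_on_def)
      ultimately show "p \<in> Sigma ?E ?I"
        using e p by simp
    next
      fix p assume "p \<in> Sigma ?E ?I"
      then obtain e y where p: "p = (e, y)" and e: "e \<in> \<Union>K'" "card (orbit h e) = m" and y: "y \<in> ?I e"
        by blast
      have bijy: "bij_betw y A (\<Union>K' - orbit h e)" and commy: "\<And>i. i \<in> A \<Longrightarrow> y (g i) = h (y i)"
        and exty: "y \<in> extensional A"
        using y unfolding intertwiners_def diff[OF e(1)] A_def[symmetric] by (auto simp: PiE_iff)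
      \<comment> \<open>\<open>r\<close> is the position of a point on \<open>k\<close> counted from
        \<open>o\<^sub>0\<close>; the extension \<open>x\<close> follows the powers of
        \<open>h\<close> from \<open>e\<close> accordingly.\<close>
      define r where "r = the_inv_into {..<m} (\<lambda>n. (g ^^ n) o\<^sub>0)"
      have bg: "bij_betw (\<lambda>n. (g ^^ n) o\<^sub>0) {..<m} k" and bh: "bij_betw (\<lambda>n. (h ^^ n) e) {..<m} (orbit h e)"
        and pg: "(g ^^ m) o\<^sub>0 = o\<^sub>0" and ph: "(h ^^ m) e = e"
        using orbit_period[OF g, of o\<^sub>0, folded k, folded m_def] orbit_period[OF h, of e, unfolded e(2)]
        by blast+
      have r: "r ((g ^^ n) o\<^sub>0) = n" if "n < m" for n
        unfolding r_def using bg that by (intro the_inv_into_f_f) (auto simp: bij_betw_def)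
      define x where "x i = (if i \<in> A then y i else if i \<in> k then (h ^^ r i) e else undefined)" for i
      have "m > 0" using orb_g[OF o] by auto
      have xpow: "x ((g ^^ n) o\<^sub>0) = (h ^^ n) e" if "n < m" for n
        using that r bg kA by (auto simp: x_def bij_betw_def)
      have bijk: "bij_betw x k (orbit h e)"
      proof -
        have "bij_betw r k {..<m}"
          unfolding r_def using bg by (rule bij_betw_the_inv_into)
        then have "bij_betw ((\<lambda>n. (h ^^ n) e) \<circ> r) k (orbit h e)"
          using bh by (rule bij_betw_trans)
        moreover have "x i = ((\<lambda>n. (h ^^ n) e) \<circ> r) i" if "i \<in> k" for i
        proof -
          have "i \<notin> A" using that kA by blast
          then show ?thesis using that unfolding x_def by simp
        qed
        ultimately show ?thesis
          by (subst bij_betw_cong)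
      qed
      have bijA: "bij_betw x A (\<Union>K' - orbit h e)"
        using bijy bij_betw_cong[of A x y] by (simp add: x_def)
      have "orbit h e \<union> (\<Union>K' - orbit h e) = \<Union>K'"
        using orbK'[OF e(1)] by auto
      then have bij: "bij_betw x (k \<union> A) (\<Union>K')"
        using bij_betw_combine[OF bijk bijA] by auto
      moreover have "x (g i) = h (x i)" if i: "i \<in> k \<union> A" for i
      proof (cases "i \<in> A")
        case True
        then show ?thesis using gA commy by (simp add: x_def)
      next
        case False
        then obtain n where n: "n < m" "i = (g ^^ n) o\<^sub>0" using i orb_g by blast
        show ?thesis
        proof (cases "Suc n < m")
          case True
          then show ?thesis using n xpow[of n] xpow[of "Suc n"] by simp
        next
          \<comment> \<open>At the last position both cycles wrap around to their base points, since
            their lengths agree.\<close>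
          case False
          then have "m = Suc n" using n by simp
          have "g i = (g ^^ Suc n) o\<^sub>0" unfolding n(2) by simp
          then have "g i = (g ^^ 0) o\<^sub>0" unfolding \<open>m = Suc n\<close>[symmetric] pg by simp
          then have "x (g i) = e" using xpow[OF \<open>m > 0\<close>] by simp
          moreover have "h (x i) = (h ^^ Suc n) e" unfolding n(2) xpow[OF n(1)] by simp
          then have "h (x i) = e" unfolding \<open>m = Suc n\<close>[symmetric] ph .
          ultimately show ?thesis by simp
        qed
      qed
      moreover have "x \<in> extensional (k \<union> A)"
        unfolding extensional_def x_def by simp
      ultimately have "x \<in> intertwiners g (insert k K) h K'"
        unfolding intertwiners_def UK by (auto simp: PiE_iff bij_betw_def)
      moreover have "?\<Phi> x = p"
        using xpow[OF \<open>m > 0\<close>] exty unfolding p by (auto simp: x_def fun_eq_iff restrict_def extensional_def)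
      ultimately show "p \<in> ?\<Phi> ` intertwiners g (insert k K) h K'" by blast
    qed
  qed
  then have "card (intertwiners g (insert k K) h K') = card (Sigma ?E ?I)"
    by (rule bij_betw_same_card)
  also have "\<dots> = (\<Sum>e\<in>?E. card (?I e))"
  proof (rule card_SigmaI)
    show "finite ?E" using finA(2) by (rule rev_finite_subset) auto
    show "\<forall>e\<in>?E. finite (?I e)"
    proof
      fix e
      have "finite (\<Union>(K' - {orbit h e}))"
        using finA(2) by (rule rev_finite_subset) blast
      with finA(1) have "finite (\<Union>K \<rightarrow>\<^sub>E \<Union>(K' - {orbit h e}))"
        by (intro finite_PiE)
      then show "finite (?I e)"
        unfolding intertwiners_def by simp
    qed
  qed
  also have "\<dots> = (\<Sum>e\<in>\<Union>{k' \<in> K'. card k' = m}. card (?I e))"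
  proof (rule sum.cong)
    show "?E = \<Union>{k' \<in> K'. card k' = m}"
    proof (intro equalityI subsetI)
      fix e assume "e \<in> ?E"
      then have "e \<in> orbit h e" "orbit h e \<in> {k' \<in> K'. card k' = m}"
        using orbK' permutation_self_in_orbit[OF h] by auto
      then show "e \<in> \<Union>{k' \<in> K'. card k' = m}" by (rule UnionI[rotated])
    next
      fix e assume "e \<in> \<Union>{k' \<in> K'. card k' = m}"
      then obtain k' where "k' \<in> K'" "card k' = m" "e \<in> k'" by blast
      then show "e \<in> ?E"
        using orbit_cyclic_eq3[OF K'(2)] by auto
    qed
  qed simp
  also have "\<dots> = (\<Sum>k' | k' \<in> K' \<and> card k' = m. \<Sum>e\<in>k'. card (?I e))"
  proof (rule sum.Union_disjoint[unfolded comp_def])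
    show "\<forall>B\<in>{k' \<in> K'. card k' = m}. finite B"
      using K'(2) cyclic_on_finite(1)[OF h] by blast
    show "\<forall>A\<in>{k' \<in> K'. card k' = m}. \<forall>B\<in>{k' \<in> K'. card k' = m}. A \<noteq> B \<longrightarrow> A \<inter> B = {}"
      using K'(2) cyclic_on_cases[of h] by blast
  qed
  also have "\<dots> = (\<Sum>k' | k' \<in> K' \<and> card k' = m. \<Sum>e\<in>k'. card (intertwiners g K h (K' - {k'})))"
    using K'(2) orbit_cyclic_eq3[of h] by (intro sum.cong refl) auto
  finally show ?thesis
    by (simp add: m_def sum_distrib_left)
qed

text \<open>Orthogonality of power sums, with centralizer orders read as counts of intertwiners.
  Both sides obey the same recursion on \<open>K\<close>. For empty \<open>K\<close>, a nonempty
  \<open>K'\<close> gives different degrees on one side and no bijection on the other.\<close>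

lemma alternant_pairing_eq_card_intertwiners:
  assumes g: "permutation g" and h: "permutation h"
    and "finite K" "\<And>l. l \<in> K \<Longrightarrow> cyclic_on g l"
    and "finite K'" "\<And>l. l \<in> K' \<Longrightarrow> cyclic_on h l"
    and "(\<Sum>k\<in>K. card k) + (\<Sum>k\<in>K'. card k) \<le> L"
    and "int (\<Sum>{..<L}) + int (\<Sum>k\<in>K'. card k) < B" "int L \<le> B"
  shows "alternant_pairing L B card K card K' = fact L * int (card (intertwiners g K h K'))"
  using assms(3-8)
proof (induction K arbitrary: K')
  case empty
  show ?case
  proof (cases "K' = {}")
    case True
    then have "intertwiners g {} h K' = {\<lambda>_. undefined}"
      by (auto simp: intertwiners_def bij_betw_def)
    then show ?thesis
      using True assms(9) by (simp add: alternant_pairing_empty)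
  next
    case False
    then obtain k where "k \<in> K'" by blast
    then have "card k > 0"
      using empty.prems cyclic_on_finite[OF h] by (simp add: card_gt_0_iff)
    then have "(\<Sum>k\<in>K'. card k) \<noteq> 0"
      using \<open>k \<in> K'\<close> empty.prems(2) by auto
    moreover have "\<Union>K' \<noteq> {}"
      using \<open>k \<in> K'\<close> \<open>card k > 0\<close> by fastforce
    then have "intertwiners g {} h K' = {}"
      by (auto simp: intertwiners_def bij_betw_def)
    ultimately show ?thesis
      using empty.prems(2) by (simp add: alternant_pairing_size_mismatch)
  qed
next
  case (insert k K)
  have k: "card k > 0"
    using insert.prems(1)[of k] cyclic_on_finite[OF g] by (simp add: card_gt_0_iff)
  have le: "card k + (\<Sum>k\<in>K. card k) + (\<Sum>k\<in>K'. card k) \<le> L"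
    using insert.prems(4) insert.hyps by simp
  have "alternant_pairing L B card (insert k K) card K' =
      int (card k) * (\<Sum>k' | k' \<in> K' \<and> card k' = card k. alternant_pairing L B card K card (K' - {k'}))"
    using insert.prems k le by (intro alternant_pairing_insert insert.hyps) auto
  also have "\<dots> = int (card k) * (\<Sum>k' | k' \<in> K' \<and> card k' = card k.
      fact L * int (card (intertwiners g K h (K' - {k'}))))"
  proof (intro arg_cong2[of _ _ _ _ "(*)"] sum.cong refl)
    fix k' assume "k' \<in> {k' \<in> K'. card k' = card k}"
    have le': "(\<Sum>k\<in>K' - {k'}. card k) \<le> (\<Sum>k\<in>K'. card k)"
      using insert.prems by (intro sum_mono2) auto
    then have "int (\<Sum>k\<in>K' - {k'}. card k) \<le> int (\<Sum>k\<in>K'. card k)"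
      by (rule of_nat_mono)
    with insert.prems(5) have "int (\<Sum>{..<L}) + int (\<Sum>k\<in>K' - {k'}. card k) < B"
      by linarith
    with \<open>k' \<in> _\<close> show "alternant_pairing L B card K card (K' - {k'}) =
        fact L * int (card (intertwiners g K h (K' - {k'})))"
      using insert.prems(1-3) le le' by (intro insert.IH) auto
  qed
  also have "\<dots> = fact L * int (card (intertwiners g (insert k K) h K'))"
  proof -
    have "card (intertwiners g (insert k K) h K') =
        card k * (\<Sum>k' | k' \<in> K' \<and> card k' = card k. card (intertwiners g K h (K' - {k'})))"
      using insert.prems by (intro card_intertwiners_insert g h insert.hyps)
    then show ?thesis
      by (simp add: sum_distrib_left mult_ac)
  qed
  finally show ?case .
qed

section \<open>Cycles of a permutation and colourings constant on them\<close>

definition cycles_of :: "nat \<Rightarrow> (nat \<Rightarrow> nat) \<Rightarrow> nat set set" where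
  "cycles_of N g = orbit g ` {..<N}"

lemma finite_cycles_of [simp]: "finite (cycles_of N g)"
  by (simp add: cycles_of_def)

lemma permutation_sym_group: "g \<in> sym_group N \<Longrightarrow> permutation g"
  by (auto simp: sym_group_def permutation_permutes)

lemma cyclic_on_cycles_of:
  "g \<in> sym_group N \<Longrightarrow> k \<in> cycles_of N g \<Longrightarrow> cyclic_on g k"
  by (auto simp: cycles_of_def intro: cyclic_on_orbit' permutation_sym_group)

lemma Union_cycles_of:
  assumes "g \<in> sym_group N"
  shows "\<Union>(cycles_of N g) = {..<N}"
  using permutation_self_in_orbit[OF permutation_sym_group[OF assms]]
    permutes_orbit_subset[of g "{..<N}"] assms
  by (fastforce simp: cycles_of_def sym_group_def)

lemma sum_card_cycles_of:
  assumes "g \<in> sym_group N"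
  shows "(\<Sum>k\<in>cycles_of N g. card k) = N"
proof -
  have "(\<Sum>k\<in>cycles_of N g. card k) = card (\<Union>(cycles_of N g))"
  proof (rule card_Union_disjoint[symmetric])
    show "disjoint (cycles_of N g)"
      using cyclic_on_cycles_of[OF assms] cyclic_on_cases[of g] by (auto simp: disjoint_def)
    show "\<And>A. A \<in> cycles_of N g \<Longrightarrow> finite A"
      using cyclic_on_cycles_of[OF assms] cyclic_on_finite(1)[OF permutation_sym_group[OF assms]] by blast
  qed
  then show ?thesis by (simp add: Union_cycles_of[OF assms])
qed

lemma card_conjugators:
  assumes g: "g \<in> sym_group N" and h: "h \<in> sym_group N"
  shows "card {x \<in> sym_group N. x \<circ> g = h \<circ> x} =
    card (intertwiners g (cycles_of N g) h (cycles_of N h))"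
proof (rule bij_betw_same_card[of "\<lambda>x. restrict x {..<N}"])
  let ?ext = "\<lambda>y i. if i < N then y i else (i :: nat)"
  have gN: "g i < N \<longleftrightarrow> i < N" and hN: "h i < N \<longleftrightarrow> i < N" for i
    using g h permutes_in_image[of _ "{..<N}" i] by (auto simp: sym_group_def)
  have fix_out: "x i = i" if "x \<in> sym_group N" "\<not> i < N" for x i
    using that by (simp add: sym_group_def permutes_not_in)
  show "bij_betw (\<lambda>x. restrict x {..<N}) {x \<in> sym_group N. x \<circ> g = h \<circ> x}
      (intertwiners g (cycles_of N g) h (cycles_of N h))"
    unfolding intertwiners_def Union_cycles_of[OF g] Union_cycles_of[OF h]
  proof (rule bij_betw_byWitness[of _ ?ext])
    show "\<forall>x\<in>{x \<in> sym_group N. x \<circ> g = h \<circ> x}. ?ext (restrict x {..<N}) = x"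
      using fix_out by (auto simp: fun_eq_iff eq_commute[of "_ :: nat"])
    show "\<forall>y\<in>{x \<in> {..<N} \<rightarrow>\<^sub>E {..<N}. bij_betw x {..<N} {..<N} \<and> (\<forall>i\<in>{..<N}. x (g i) = h (x i))}.
        restrict (?ext y) {..<N} = y"
      by (auto simp: fun_eq_iff PiE_iff extensional_def)
    show "(\<lambda>x. restrict x {..<N}) ` {x \<in> sym_group N. x \<circ> g = h \<circ> x} \<subseteq>
        {x \<in> {..<N} \<rightarrow>\<^sub>E {..<N}. bij_betw x {..<N} {..<N} \<and> (\<forall>i\<in>{..<N}. x (g i) = h (x i))}"
    proof clarify
      fix x assume x: "x \<in> sym_group N" "x \<circ> g = h \<circ> x"
      then have "bij_betw x {..<N} {..<N}"
        by (simp add: sym_group_def permutes_imp_bij)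
      then have "bij_betw (restrict x {..<N}) {..<N} {..<N}"
        by (simp add: bij_betw_restrict_eq)
      moreover have "x (g i) = h (x i)" for i
        using x(2) by (metis comp_apply)
      ultimately show "restrict x {..<N} \<in> {..<N} \<rightarrow>\<^sub>E {..<N} \<and> bij_betw (restrict x {..<N}) {..<N} {..<N} \<and>
          (\<forall>i\<in>{..<N}. restrict x {..<N} (g i) = h (restrict x {..<N} i))"
        using gN by (auto dest: bij_betwE)
    qed
    show "?ext ` {x \<in> {..<N} \<rightarrow>\<^sub>E {..<N}. bij_betw x {..<N} {..<N} \<and> (\<forall>i\<in>{..<N}. x (g i) = h (x i))} \<subseteq>
        {x \<in> sym_group N. x \<circ> g = h \<circ> x}"
    proof clarify
      fix y assume y: "bij_betw y {..<N} {..<N}" "\<forall>i\<in>{..<N}. y (g i) = h (y i)"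
      have "bij_betw (?ext y) {..<N} {..<N}"
        using y(1) bij_betw_cong[of "{..<N}" "?ext y" y] by simp
      then have "?ext y permutes {..<N}"
        by (rule bij_imp_permutes) simp
      moreover have "?ext y \<circ> g = h \<circ> ?ext y"
        using y(2) gN fix_out[OF g] fix_out[OF h] by (auto simp: fun_eq_iff)
      ultimately show "?ext y \<in> sym_group N \<and> ?ext y \<circ> g = h \<circ> ?ext y"
        by (simp add: sym_group_def)
    qed
  qed
qed

definition invariant_colourings :: "nat \<Rightarrow> nat \<Rightarrow> (nat \<Rightarrow> nat) \<Rightarrow> (nat \<Rightarrow> nat) set" where
  "invariant_colourings L N g = {F \<in> {..<N} \<rightarrow>\<^sub>E {..<L}. \<forall>i<N. F (g i) = F i}"

text \<open>Choosing a variable for each cycle amounts to colouring points constantly along cycles.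
  In this form \<open>g\<close> enters only through the invariance of \<open>F\<close>, so that sums
  over \<open>g\<close> can be taken with \<open>F\<close> fixed.\<close>

lemma alternant_coeff_cycles_of:
  assumes g: "g \<in> sym_group N"
  shows "alternant_coeff L card (cycles_of N g) \<beta> =
    (\<Sum>w | w permutes {..<L}. \<Sum>F\<in>invariant_colourings L N g.
      if \<forall>c<L. \<beta> c = int (L - 1 - w c) + int (card {i. i < N \<and> F i = c}) then sign w else 0)"
proof -
  let ?K = "cycles_of N g"
  let ?\<Phi> = "\<lambda>f. restrict (\<lambda>i. f (orbit g i)) {..<N}"
  have perm: "permutation g" and gN: "g i < N \<longleftrightarrow> i < N" for i
    using g permutation_sym_group permutes_in_image[of g "{..<N}" i] by (auto simp: sym_group_def)
  have self: "i \<in> orbit g i" for i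
    by (rule permutation_self_in_orbit[OF perm])
  have orb: "orbit g i \<in> ?K" if "i < N" for i
    using that by (simp add: cycles_of_def)
  have bij: "bij_betw ?\<Phi> (?K \<rightarrow>\<^sub>E {..<L}) (invariant_colourings L N g)"
  proof (rule bij_betw_imageI)
    show "inj_on ?\<Phi> (?K \<rightarrow>\<^sub>E {..<L})"
    proof (rule inj_onI)
      fix f f' assume f: "f \<in> ?K \<rightarrow>\<^sub>E {..<L}" "f' \<in> ?K \<rightarrow>\<^sub>E {..<L}" and eq: "?\<Phi> f = ?\<Phi> f'"
      have "f k = f' k" if k: "k \<in> ?K" for k
      proof -
        obtain i where i: "i < N" "k = orbit g i" using k by (auto simp: cycles_of_def)
        have "?\<Phi> f i = ?\<Phi> f' i" using eq by (rule fun_cong)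
        then show ?thesis using i by simp
      qed
      then show "f = f'" using f by (auto intro: PiE_ext)
    qed
    show "?\<Phi> ` (?K \<rightarrow>\<^sub>E {..<L}) = invariant_colourings L N g"
    proof (intro equalityI subsetI)
      fix F assume "F \<in> ?\<Phi> ` (?K \<rightarrow>\<^sub>E {..<L})"
      then obtain f where f: "f \<in> ?K \<rightarrow>\<^sub>E {..<L}" and F: "F = ?\<Phi> f" by blast
      have "F (g i) = F i" if "i < N" for i
        using that gN permutation_orbit_step[OF perm, of i] by (simp add: F)
      moreover have "F \<in> {..<N} \<rightarrow>\<^sub>E {..<L}"
        unfolding F using PiE_mem[OF f] orb by auto
      ultimately show "F \<in> invariant_colourings L N g"
        by (simp add: invariant_colourings_def)
    next
      fix F assume "F \<in> invariant_colourings L N g"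
      then have F: "F \<in> {..<N} \<rightarrow>\<^sub>E {..<L}" and inv: "\<And>i. i < N \<Longrightarrow> F (g i) = F i"
        by (auto simp: invariant_colourings_def)
      have const: "j < N \<and> F j = F i" if "j \<in> orbit g i" "i < N" for i j
        using that by (induction rule: orbit.induct) (auto simp: gN inv)
      define f where "f = restrict (\<lambda>k. F (SOME i. i \<in> k)) ?K"
      have some: "(SOME j. j \<in> orbit g i) \<in> orbit g i" for i
        using self[of i] by (rule someI)
      have f_orb: "f (orbit g i) = F i" if "i < N" for i
        using const[OF some that] orb[OF that] by (simp add: f_def)
      have "f \<in> ?K \<rightarrow>\<^sub>E {..<L}"
        using f_orb PiE_mem[OF F] by (auto simp: cycles_of_def f_def)
      moreover have "?\<Phi> f = F"
        using f_orb F by (auto simp: fun_eq_iff PiE_iff extensional_def)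
      ultimately show "F \<in> ?\<Phi> ` (?K \<rightarrow>\<^sub>E {..<L})" by blast
    qed
  qed
  have content: "(\<Sum>k | k \<in> ?K \<and> f k = c. card k) = card {i. i < N \<and> ?\<Phi> f i = c}" for f c
  proof -
    have "(\<Sum>k | k \<in> ?K \<and> f k = c. card k) = card (\<Union>{k \<in> ?K. f k = c})"
    proof (rule card_Union_disjoint[symmetric])
      show "disjoint {k \<in> ?K. f k = c}"
        using cyclic_on_cycles_of[OF g] cyclic_on_cases[of g] by (auto simp: disjoint_def)
      show "\<And>A. A \<in> {k \<in> ?K. f k = c} \<Longrightarrow> finite A"
        using cyclic_on_cycles_of[OF g] cyclic_on_finite(1)[OF perm] by blast
    qed
    also have "\<Union>{k \<in> ?K. f k = c} = {i. i < N \<and> ?\<Phi> f i = c}"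
    proof (intro equalityI subsetI)
      fix i assume "i \<in> \<Union>{k \<in> ?K. f k = c}"
      then obtain k where k: "k \<in> ?K" "f k = c" "i \<in> k" by blast
      then have "orbit g i = k"
        using orbit_cyclic_eq3[OF cyclic_on_cycles_of[OF g]] by blast
      moreover have "i < N" using k Union_cycles_of[OF g] by blast
      ultimately show "i \<in> {i. i < N \<and> ?\<Phi> f i = c}" using k by simp
    next
      fix i assume "i \<in> {i. i < N \<and> ?\<Phi> f i = c}"
      then have "orbit g i \<in> {k \<in> ?K. f k = c}" using orb by (auto split: if_splits)
      then show "i \<in> \<Union>{k \<in> ?K. f k = c}" using self by blast
    qed
    finally show ?thesis .
  qed
  have "(\<Sum>f\<in>?K \<rightarrow>\<^sub>E {..<L}.
       if \<forall>c<L. \<beta> c = int (L - 1 - w c) + int (\<Sum>k | k \<in> ?K \<and> f k = c. card k) then sign w else 0) =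
     (\<Sum>F\<in>invariant_colourings L N g.
       if \<forall>c<L. \<beta> c = int (L - 1 - w c) + int (card {i. i < N \<and> F i = c}) then sign w else 0)" for w
    unfolding content by (rule sum.reindex_bij_betw[OF bij])
  then show ?thesis
    unfolding alternant_coeff_def by simp
qed

section \<open>Left ideals of the group algebra\<close>

lemma sum_fun_apply: "(\<Sum>i\<in>I. F i) x = (\<Sum>i\<in>I. F i x)"
  by (induction I rule: infinite_finite_induct) auto

lemma finite_sym_group [simp]: "finite (sym_group N)"
  by (simp add: sym_group_def finite_permutations)

lemma id_sym_group [simp]: "id \<in> sym_group N"
  by (simp add: sym_group_def permutes_id)

lemma comp_sym_group [simp]: "p \<in> sym_group N \<Longrightarrow> q \<in> sym_group N \<Longrightarrow> p \<circ> q \<in> sym_group N"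
  by (simp add: sym_group_def permutes_compose)

lemma inv_sym_group [simp]: "p \<in> sym_group N \<Longrightarrow> inv p \<in> sym_group N"
  by (simp add: sym_group_def permutes_inv)

lemma sym_group_inv_o [simp]:
  assumes "p \<in> sym_group N"
  shows "p \<circ> inv p = id" "inv p \<circ> p = id" "p \<circ> (inv p \<circ> q) = q" "inv p \<circ> (p \<circ> q) = q" "inv (inv p) = p"
proof -
  have p: "p permutes {..<N}" using assms by (simp add: sym_group_def)
  show "p \<circ> inv p = id" "inv p \<circ> p = id" using permutes_inv_o[OF p] by auto
  then show "p \<circ> (inv p \<circ> q) = q" "inv p \<circ> (p \<circ> q) = q" by (auto simp flip: comp_assoc)
  show "inv (inv p) = p" using permutes_inv_inv[OF p] .
qed

lemma inv_comp_sym_group: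
  "p \<in> sym_group N \<Longrightarrow> q \<in> sym_group N \<Longrightarrow> inv (p \<circ> q) = inv q \<circ> inv p"
  by (intro o_inv_distrib) (auto simp: sym_group_def permutes_bij)

lemma sum_sym_group_left:
  assumes "r \<in> sym_group N"
  shows "(\<Sum>p\<in>sym_group N. F (r \<circ> p)) = (\<Sum>p\<in>sym_group N. F p)"
  using assms
  by (intro sum.reindex_bij_witness[of _ "\<lambda>p. inv r \<circ> p" "\<lambda>p. r \<circ> p"]) auto

lemma sum_sym_group_right:
  assumes "r \<in> sym_group N"
  shows "(\<Sum>p\<in>sym_group N. F (p \<circ> r)) = (\<Sum>p\<in>sym_group N. F p)"
  using assms
  by (intro sum.reindex_bij_witness[of _ "\<lambda>p. p \<circ> inv r" "\<lambda>p. p \<circ> r"]) (auto simp: comp_assoc)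

lemma conv_in_group_algebra: "conv N f g \<in> group_algebra N"
  by (simp add: conv_def group_algebra_def)

lemma delta_in_group_algebra: "g \<in> sym_group N \<Longrightarrow> delta g \<in> group_algebra N"
  by (auto simp: delta_def group_algebra_def)

lemma conv_apply:
  "p \<in> sym_group N \<Longrightarrow> conv N f g p = (\<Sum>q\<in>sym_group N. f q * g (inv q \<circ> p))"
  by (simp add: conv_def)

lemma conv_delta:
  assumes "g \<in> sym_group N"
  shows "conv N (delta g) f = (\<lambda>p. if p \<in> sym_group N then f (inv g \<circ> p) else 0)"
proof -
  have "(\<Sum>q\<in>sym_group N. delta g q * f (inv q \<circ> p)) =
      (\<Sum>q\<in>sym_group N. if q = g then f (inv q \<circ> p) else 0)" for p
    by (intro sum.cong) (auto simp: delta_def)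
  then show ?thesis
    using assms unfolding conv_def by (intro ext) simp
qed

lemma conv_assoc: "conv N (conv N f g) h = conv N f (conv N g h)"
proof
  fix p
  show "conv N (conv N f g) h p = conv N f (conv N g h) p"
  proof (cases "p \<in> sym_group N")
    case True
    have "(\<Sum>q\<in>sym_group N. conv N f g q * h (inv q \<circ> p)) =
        (\<Sum>q\<in>sym_group N. \<Sum>r\<in>sym_group N. f r * (g (inv r \<circ> q) * h (inv q \<circ> p)))"
      by (simp add: conv_def sum_distrib_right mult.assoc)
    also have "\<dots> = (\<Sum>r\<in>sym_group N. \<Sum>q\<in>sym_group N. f r * (g (inv r \<circ> q) * h (inv q \<circ> p)))"
      by (rule sum.swap)
    also have "\<dots> = (\<Sum>r\<in>sym_group N. f r * conv N g h (inv r \<circ> p))"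
    proof (intro sum.cong refl)
      fix r assume r: "r \<in> sym_group N"
      have "(\<Sum>q\<in>sym_group N. f r * (g (inv r \<circ> q) * h (inv q \<circ> p))) =
          (\<Sum>q\<in>sym_group N. f r * (g q * h (inv q \<circ> (inv r \<circ> p))))"
        by (subst sum_sym_group_left[OF r, symmetric])
          (intro sum.cong refl, simp only: sym_group_inv_o[OF r] inv_comp_sym_group[OF r] comp_assoc)
      also have "\<dots> = f r * conv N g h (inv r \<circ> p)"
        using True r by (simp add: conv_def sum_distrib_left)
      finally show "(\<Sum>q\<in>sym_group N. f r * (g (inv r \<circ> q) * h (inv q \<circ> p))) =
          f r * conv N g h (inv r \<circ> p)" .
    qed
    finally show ?thesis
      unfolding conv_apply[OF True] .
  qed (simp add: conv_def)
qed

lemma conv_add_left: "conv N (f + f') g = conv N f g + conv N f' g"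
  by (auto simp: conv_def fun_eq_iff algebra_simps sum.distrib)

lemma conv_scale_left: "conv N (fun_scale c f) g = fun_scale c (conv N f g)"
  by (auto simp: conv_def fun_eq_iff fun_scale_def sum_distrib_left mult_ac)

lemma conv_sum_right: "conv N f (\<Sum>i\<in>I. F i) = (\<Sum>i\<in>I. conv N f (F i))"
proof
  fix p
  have "(\<Sum>q\<in>sym_group N. \<Sum>i\<in>I. f q * F i (inv q \<circ> p)) = (\<Sum>i\<in>I. \<Sum>q\<in>sym_group N. f q * F i (inv q \<circ> p))"
    by (rule sum.swap)
  then show "conv N f (\<Sum>i\<in>I. F i) p = (\<Sum>i\<in>I. conv N f (F i)) p"
    by (simp add: conv_def sum_fun_apply sum_distrib_left)
qed

lemma conv_scale_right: "conv N f (fun_scale c g) = fun_scale c (conv N f g)"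
  by (auto simp: conv_def fun_eq_iff fun_scale_def sum_distrib_left mult_ac)

lemma conv_eq_sum_delta:
  "conv N f g = (\<Sum>x\<in>sym_group N. fun_scale (f x) (conv N (delta x) g))"
proof
  fix p
  have "(\<Sum>x\<in>sym_group N. f x * conv N (delta x) g p) =
      (\<Sum>x\<in>sym_group N. f x * (if p \<in> sym_group N then g (inv x \<circ> p) else 0))"
    by (intro sum.cong refl) (simp add: conv_delta)
  then show "conv N f g p = (\<Sum>x\<in>sym_group N. fun_scale (f x) (conv N (delta x) g)) p"
    by (simp add: sum_fun_apply fun_scale_def conv_def)
qed

lemma group_algebra_eq_sum_delta:
  assumes "f \<in> group_algebra N"
  shows "f = (\<Sum>x\<in>sym_group N. fun_scale (f x) (delta x))"
proof
  fix p
  have "(\<Sum>x\<in>sym_group N. f x * delta x p) = (\<Sum>x\<in>sym_group N. if x = p then f x else 0)"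
    by (intro sum.cong) (auto simp: delta_def)
  then show "f p = (\<Sum>x\<in>sym_group N. fun_scale (f x) (delta x)) p"
    using assms by (simp add: sum_fun_apply fun_scale_def group_algebra_def)
qed

section \<open>Idempotent generators and traces of left ideals\<close>

definition left_ideal :: "nat \<Rightarrow> ((nat \<Rightarrow> nat) \<Rightarrow> complex) set \<Rightarrow> bool" where
  "left_ideal N V \<longleftrightarrow> fun_vs.subspace V \<and> V \<subseteq> group_algebra N \<and> (\<forall>g\<in>sym_group N. \<forall>f\<in>V. conv N (delta g) f \<in> V)"

text \<open>Maschke: averaging a linear projection onto \<open>V\<close> over the group makes it right multiplication by
  an idempotent.\<close>

lemma left_ideal_right_identity:
  assumes V: "left_ideal N V"
  shows "\<exists>e\<in>V. \<forall>f\<in>V. conv N f e = f"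
proof -
  interpret pair: vector_space_pair fun_scale "fun_scale :: complex \<Rightarrow> ((nat \<Rightarrow> nat) \<Rightarrow> complex) \<Rightarrow> _"
    by unfold_locales
  have sub: "fun_vs.subspace V" and alg: "V \<subseteq> group_algebra N"
    and mult: "\<And>g f. g \<in> sym_group N \<Longrightarrow> f \<in> V \<Longrightarrow> conv N (delta g) f \<in> V"
    using V by (auto simp: left_ideal_def)
  obtain B where B: "B \<subseteq> V" "fun_vs.independent B" "V \<subseteq> fun_vs.span B"
    by (rule fun_vs.maximal_independent_subset)
  then have span: "fun_vs.span B = V"
    using sub by (metis fun_vs.span_subspace)
  obtain P where P: "Vector_Spaces.linear fun_scale fun_scale P" and PB: "\<forall>x\<in>B. P x = x"
    and rangeP: "range P = fun_vs.span ((\<lambda>x. x) ` B)"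
    using pair.linear_independent_extend_subspace[OF B(2), of "\<lambda>x. x"] by blast
  have PV: "P f \<in> V" for f
    using rangeP span by auto
  have Pid: "P f = f" if "f \<in> V" for f
  proof -
    have "Vector_Spaces.linear fun_scale fun_scale (\<lambda>f :: (nat \<Rightarrow> nat) \<Rightarrow> complex. f)"
      using fun_vs.linear_ident .
    then show ?thesis
      using pair.linear_eq_on[OF P, of "\<lambda>f. f" f B] that PB span by auto
  qed
  let ?G = "sym_group N"
  \<comment> \<open>The value at \<open>delta id\<close> of the averaged projection. The average
    commutes with left multiplication, hence is right multiplication by this value.\<close>
  define e where "e = fun_scale (1 / of_nat (card ?G)) (\<Sum>x\<in>?G. conv N (delta (inv x)) (P (delta x)))"
  have G0: "card ?G \<noteq> 0"
    by (metis card_0_eq emptyE finite_sym_group id_sym_group)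
  have e: "e u = (\<Sum>x\<in>?G. P (delta x) (x \<circ> u)) / of_nat (card ?G)" if "u \<in> ?G" for u
  proof -
    have "(\<Sum>x\<in>?G. conv N (delta (inv x)) (P (delta x)) u) = (\<Sum>x\<in>?G. P (delta x) (x \<circ> u))"
      using that by (intro sum.cong refl) (simp add: conv_delta)
    then show ?thesis by (simp add: e_def fun_scale_def sum_fun_apply)
  qed
  have "e \<in> V"
    unfolding e_def using mult PV by (intro fun_vs.subspace_scale[OF sub] fun_vs.subspace_sum[OF sub]) auto
  moreover have "conv N f e = f" if f: "f \<in> V" for f
  proof
    fix p
    show "conv N f e p = f p"
    proof (cases "p \<in> ?G")
      case False
      then show ?thesis using f alg by (auto simp: conv_def group_algebra_def)
    next
      case p: True
      have "conv N f e p = (\<Sum>u\<in>?G. f u * (\<Sum>x\<in>?G. P (delta x) (x \<circ> (inv u \<circ> p)) / of_nat (card ?G)))"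
        using p by (simp add: conv_def e sum_divide_distrib)
      also have "\<dots> = (\<Sum>u\<in>?G. \<Sum>y\<in>?G. f u * P (delta (y \<circ> u)) (y \<circ> p) / of_nat (card ?G))"
      proof (intro sum.cong refl)
        fix u assume u: "u \<in> ?G"
        have "(\<Sum>x\<in>?G. P (delta x) (x \<circ> (inv u \<circ> p)) / of_nat (card ?G)) =
            (\<Sum>y\<in>?G. P (delta (y \<circ> u)) (y \<circ> p) / of_nat (card ?G))"
          by (subst sum_sym_group_right[OF u, symmetric]) (simp only: sym_group_inv_o[OF u] comp_assoc)
        then show "f u * (\<Sum>x\<in>?G. P (delta x) (x \<circ> (inv u \<circ> p)) / of_nat (card ?G)) =
            (\<Sum>y\<in>?G. f u * P (delta (y \<circ> u)) (y \<circ> p) / of_nat (card ?G))"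
          by (simp add: sum_distrib_left)
      qed
      also have "\<dots> = (\<Sum>y\<in>?G. \<Sum>u\<in>?G. f u * P (delta (y \<circ> u)) (y \<circ> p) / of_nat (card ?G))"
        by (rule sum.swap)
      also have "\<dots> = (\<Sum>y\<in>?G. f p / of_nat (card ?G))"
      proof (intro sum.cong refl)
        fix y assume y: "y \<in> ?G"
        have "conv N (delta y) f = (\<Sum>u\<in>?G. fun_scale (f u) (delta (y \<circ> u)))"
        proof -
          have "conv N (delta y) f = (\<Sum>v\<in>?G. fun_scale (f (inv y \<circ> v)) (delta v))"
            using group_algebra_eq_sum_delta[OF conv_in_group_algebra, of N "delta y" f]
            by (simp add: conv_delta[OF y])
          also have "\<dots> = (\<Sum>u\<in>?G. fun_scale (f u) (delta (y \<circ> u)))"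
            by (subst sum_sym_group_left[OF y, symmetric]) (simp only: sym_group_inv_o[OF y])
          finally show ?thesis .
        qed
        then have "P (conv N (delta y) f) = (\<Sum>u\<in>?G. fun_scale (f u) (P (delta (y \<circ> u))))"
          by (simp add: pair.linear_sum[OF P] pair.linear_scale[OF P])
        then have "(\<Sum>u\<in>?G. f u * P (delta (y \<circ> u)) (y \<circ> p)) = conv N (delta y) f (y \<circ> p)"
          using Pid[OF mult[OF y f]] by (simp add: sum_fun_apply fun_scale_def)
        also have "\<dots> = f p"
          using y p by (simp add: conv_delta)
        finally show "(\<Sum>u\<in>?G. f u * P (delta (y \<circ> u)) (y \<circ> p) / of_nat (card ?G)) = f p / of_nat (card ?G)"
          by (simp flip: sum_divide_distrib)
      qed
      also have "\<dots> = f p" using G0 by simp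
      finally show ?thesis .
    qed
  qed
  ultimately show ?thesis by blast
qed

text \<open>Right multiplication by \<open>e\<close> projects the group algebra onto
  \<open>V\<close>, so the trace of \<open>g\<close> on \<open>V\<close> is the trace on the group
  algebra of the map sending \<open>f\<close> to \<open>g f e\<close>, read off in the basis of the
  \<open>delta x\<close>. At the identity the trace is the dimension of \<open>V\<close>.\<close>

lemma trace_on_left_ideal:
  assumes V: "left_ideal N V" and e: "e \<in> V" "\<And>f. f \<in> V \<Longrightarrow> conv N f e = f"
  shows "g \<in> sym_group N \<Longrightarrow>
      trace_on V (conv N (delta g)) = (\<Sum>x\<in>sym_group N. e (inv x \<circ> inv g \<circ> x))"
    and "V \<noteq> {0} \<Longrightarrow> trace_on V (conv N (delta id)) \<noteq> 0"
proof -
  let ?G = "sym_group N"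
  have sub: "fun_vs.subspace V" and alg: "V \<subseteq> group_algebra N"
    and mult: "\<And>g f. g \<in> sym_group N \<Longrightarrow> f \<in> V \<Longrightarrow> conv N (delta g) f \<in> V"
    using V by (auto simp: left_ideal_def)
  define B where "B = (SOME B. fun_vs.independent B \<and> fun_vs.span B = V)"
  have "\<exists>B. fun_vs.independent B \<and> fun_vs.span B = V"
    using fun_vs.maximal_independent_subset[of V] sub by (metis fun_vs.span_subspace)
  then have "fun_vs.independent B \<and> fun_vs.span B = V"
    unfolding B_def by (rule someI_ex)
  then have B: "fun_vs.independent B" "fun_vs.span B = V" by auto
  have BV: "b \<in> V" if "b \<in> B" for b
    using that B(2) fun_vs.span_base by blast
  have "B \<subseteq> fun_vs.span (delta ` ?G)"
  proof
    fix b assume "b \<in> B"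
    then have "b = (\<Sum>x\<in>?G. fun_scale (b x) (delta x))"
      using BV alg by (intro group_algebra_eq_sum_delta) auto
    also have "\<dots> \<in> fun_vs.span (delta ` ?G)"
      by (intro fun_vs.span_sum fun_vs.span_scale fun_vs.span_base) auto
    finally show "b \<in> fun_vs.span (delta ` ?G)" .
  qed
  then have finB: "finite B"
    using fun_vs.independent_span_bound[OF _ B(1), of "delta ` ?G"] by simp
  let ?R = "fun_vs.representation B"
  have trace: "trace_on V L = (\<Sum>b\<in>B. ?R (L b) b)" for L
    by (simp only: trace_on_def B_def Let_def)
  show "trace_on V (conv N (delta g)) = (\<Sum>x\<in>?G. e (inv x \<circ> inv g \<circ> x))" if g: "g \<in> ?G" for g
  proof -
    let ?E = "\<lambda>x. conv N (delta x) e" and ?L = "conv N (delta g)"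
    have EV: "?E x \<in> V" if "x \<in> ?G" for x
      using mult[OF that e(1)] .
    \<comment> \<open>The left side is the coefficient at \<open>x\<close> of \<open>g x e\<close>;
      the right side computes it by expanding \<open>x e\<close> in the basis
      \<open>B\<close>.\<close>
    have "e (inv x \<circ> inv g \<circ> x) = (\<Sum>b\<in>B. ?R (?E x) b * ?L b x)" if x: "x \<in> ?G" for x
    proof -
      have "?E x = (\<Sum>b\<in>B. fun_scale (?R (?E x) b) b)"
        using fun_vs.sum_representation_eq[OF B(1) _ finB, of "?E x"] EV[OF x] B(2) by auto
      then have "?L (?E x) = (\<Sum>b\<in>B. fun_scale (?R (?E x) b) (?L b))"
        by (metis (no_types, lifting) conv_scale_right conv_sum_right sum.cong)
      then have "?L (?E x) x = (\<Sum>b\<in>B. ?R (?E x) b * ?L b x)"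
        by (simp add: sum_fun_apply fun_scale_def)
      moreover have "?L (?E x) x = e (inv x \<circ> inv g \<circ> x)"
        using g x by (simp add: conv_delta comp_assoc)
      ultimately show ?thesis by simp
    qed
    then have "(\<Sum>x\<in>?G. e (inv x \<circ> inv g \<circ> x)) = (\<Sum>x\<in>?G. \<Sum>b\<in>B. ?R (?E x) b * ?L b x)"
      by simp
    also have "\<dots> = (\<Sum>b\<in>B. \<Sum>x\<in>?G. ?R (?E x) b * ?L b x)"
      by (rule sum.swap)
    \<comment> \<open>Since \<open>?L b\<close> is fixed by right multiplication by
      \<open>e\<close>, it is the combination of the \<open>?E x\<close> with coefficients
      \<open>?L b x\<close>. This collapses the sum over the group to the diagonal entry at
      \<open>b\<close>.\<close>
    also have "\<dots> = (\<Sum>b\<in>B. ?R (?L b) b)"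
    proof (intro sum.cong refl)
      fix b assume "b \<in> B"
      then have LV: "?L b \<in> V" using BV mult g by blast
      have "?R (?L b) = ?R (\<Sum>x\<in>?G. fun_scale (?L b x) (?E x))"
        using e(2)[OF LV] conv_eq_sum_delta[of N "?L b" e] by simp
      also have "\<dots> = (\<lambda>b'. \<Sum>x\<in>?G. ?L b x * ?R (?E x) b')"
      proof -
        have "?R (\<Sum>x\<in>?G. fun_scale (?L b x) (?E x)) = (\<lambda>b'. \<Sum>x\<in>?G. ?R (fun_scale (?L b x) (?E x)) b')"
          using EV B(2) by (intro fun_vs.representation_sum B(1) fun_vs.span_scale) simp
        also have "\<dots> = (\<lambda>b'. \<Sum>x\<in>?G. ?L b x * ?R (?E x) b')"
          using EV B(2) by (intro ext sum.cong refl) (simp add: fun_vs.representation_scale[OF B(1)])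
        finally show ?thesis .
      qed
      finally show "(\<Sum>x\<in>?G. ?R (?E x) b * ?L b x) = ?R (?L b) b"
        by (simp add: mult.commute)
    qed
    finally show ?thesis by (simp add: trace)
  qed
  show "trace_on V (conv N (delta id)) \<noteq> 0" if "V \<noteq> {0}"
  proof -
    have "conv N (delta id) f = f" if "f \<in> V" for f
      using that alg by (auto simp: conv_delta fun_eq_iff group_algebra_def)
    then have "trace_on V (conv N (delta id)) = (\<Sum>b\<in>B. 1)"
      unfolding trace using BV B(1) by (intro sum.cong) (auto simp: fun_vs.representation_basis)
    moreover have "B \<noteq> {}" using \<open>V \<noteq> {0}\<close> B(2) by auto
    ultimately show ?thesis using finB by simp
  qed
qed

section \<open>Tableaux\<close>

lemma diagram_Sigma: "diagram la = Sigma {..<length la} (\<lambda>i. {..<la ! i})"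
  by (auto simp: diagram_def)

lemma finite_diagram [simp]: "finite (diagram la)"
  by (simp add: diagram_Sigma)

lemma card_diagram: "card (diagram la) = sum_list la"
  by (simp add: diagram_Sigma sum_list_sum_nth lessThan_atLeast0)

lemma sum_list_take_mono: "i \<le> j \<Longrightarrow> sum_list (take i la) \<le> sum_list (take j (la :: nat list))"
  by (metis le_add1 le_add_diff_inverse sum_list_append take_add)

lemma tableau_less:
  assumes "(i, j) \<in> diagram la"
  shows "tableau la (i, j) < sum_list (take (Suc i) la)"
  using assms by (simp add: diagram_def tableau_def take_Suc_conv_app_nth)

lemma bij_betw_tableau: "bij_betw (tableau la) (diagram la) {..<sum_list la}"
proof -
  have strict: "tableau la (i, j) < tableau la (i', j')" if "(i, j) \<in> diagram la" "i < i'" for i j i' j'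
    using tableau_less[OF that(1)] sum_list_take_mono[of "Suc i" i' la] that(2) by (simp add: tableau_def)
  have inj: "inj_on (tableau la) (diagram la)"
  proof (rule inj_onI, clarify)
    fix i j i' j'
    assume ij: "(i, j) \<in> diagram la" "(i', j') \<in> diagram la" and eq: "tableau la (i, j) = tableau la (i', j')"
    have "i = i'"
      using strict[OF ij(1), of i' j'] strict[OF ij(2), of i j] eq by (metis less_irrefl linorder_neqE_nat)
    then show "i = i' \<and> j = j'" using eq by (simp add: tableau_def)
  qed
  have "tableau la ` diagram la \<subseteq> {..<sum_list la}"
  proof (rule image_subsetI, clarify)
    fix i j assume "(i, j) \<in> diagram la"
    from tableau_less[OF this] show "tableau la (i, j) < sum_list la"
      using sum_list_take_mono[of "Suc i" "max (Suc i) (length la)" la] by simp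
  qed
  then have "tableau la ` diagram la = {..<sum_list la}"
    by (rule card_subset_eq[rotated]) (simp_all add: card_image[OF inj] card_diagram)
  with inj show ?thesis by (simp add: bij_betw_def)
qed

definition cell :: "nat list \<Rightarrow> nat \<Rightarrow> nat \<times> nat" where
  "cell la n = inv_into (diagram la) (tableau la) n"

definition row_of :: "nat list \<Rightarrow> nat \<Rightarrow> nat" where
  "row_of la n = fst (cell la n)"

definition col_of :: "nat list \<Rightarrow> nat \<Rightarrow> nat" where
  "col_of la n = snd (cell la n)"

lemma bij_betw_cell: "bij_betw (cell la) {..<sum_list la} (diagram la)"
  unfolding cell_def[abs_def] by (rule bij_betw_inv_into[OF bij_betw_tableau])

lemma cell_tableau: "c \<in> diagram la \<Longrightarrow> cell la (tableau la c) = c"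
  unfolding cell_def by (rule inv_into_f_f[OF bij_betw_imp_inj_on[OF bij_betw_tableau]])

lemma tableau_cell: "n < sum_list la \<Longrightarrow> tableau la (cell la n) = n"
  unfolding cell_def using bij_betw_tableau[of la] by (simp add: bij_betw_def f_inv_into_f)

lemma row_col_in_diagram: "n < sum_list la \<Longrightarrow> (row_of la n, col_of la n) \<in> diagram la"
  using bij_betwE[OF bij_betw_cell, of la] by (simp add: row_of_def col_of_def)

lemma tableau_row_col: "n < sum_list la \<Longrightarrow> tableau la (row_of la n, col_of la n) = n"
  by (simp add: row_of_def col_of_def tableau_cell)

lemma row_col_inj:
  assumes "m < sum_list la" "n < sum_list la" "row_of la m = row_of la n" "col_of la m = col_of la n"
  shows "m = n"
  by (metis assms tableau_row_col)

lemma row_col_tableau: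
  "(i, j) \<in> diagram la \<Longrightarrow> row_of la (tableau la (i, j)) = i"
  "(i, j) \<in> diagram la \<Longrightarrow> col_of la (tableau la (i, j)) = j"
  by (simp_all add: row_of_def col_of_def cell_tableau)

lemma all_cells_iff:
  "(\<forall>c\<in>diagram la. P (tableau la c) c) \<longleftrightarrow> (\<forall>n<sum_list la. P n (row_of la n, col_of la n))"
proof -
  have "(\<forall>c\<in>diagram la. P (tableau la c) c) \<longleftrightarrow> (\<forall>c\<in>cell la ` {..<sum_list la}. P (tableau la c) c)"
    using bij_betw_cell[of la] by (simp add: bij_betw_def)
  then show ?thesis
    by (auto simp: tableau_cell row_of_def col_of_def)
qed

text \<open>Turns the tableau condition into invariance of \<open>row_of\<close>, for which closure
  under composition and inverses is immediate.\<close>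

lemma mem_row_group:
  "p \<in> row_group la \<longleftrightarrow> p \<in> sym_group (sum_list la) \<and> (\<forall>n<sum_list la. row_of la (p n) = row_of la n)"
proof (cases "p \<in> sym_group (sum_list la)")
  case True
  have pn: "p n < sum_list la" if "n < sum_list la" for n
    using True that permutes_in_image[of p "{..<sum_list la}" n] by (simp add: sym_group_def)
  have "(\<exists>j'. (i, j') \<in> diagram la \<and> m = tableau la (i, j')) \<longleftrightarrow> row_of la m = i" if "m < sum_list la" for i m
    using row_col_tableau(1) row_col_in_diagram[OF that] tableau_row_col[OF that] by metis
  note key = this
  have "p \<in> row_group la \<longleftrightarrow> (\<forall>n<sum_list la. \<exists>j'. (row_of la n, j') \<in> diagram la \<and> p n = tableau la (row_of la n, j'))"
    using True all_cells_iff[of la "\<lambda>n (i, j). \<exists>j'. (i, j') \<in> diagram la \<and> p n = tableau la (i, j')"]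
    by (simp add: row_group_def case_prod_unfold)
  also have "\<dots> \<longleftrightarrow> (\<forall>n<sum_list la. row_of la (p n) = row_of la n)"
    using key pn by simp
  finally show ?thesis using True by simp
qed (simp add: row_group_def)

lemma mem_column_group:
  "p \<in> column_group la \<longleftrightarrow> p \<in> sym_group (sum_list la) \<and> (\<forall>n<sum_list la. col_of la (p n) = col_of la n)"
proof (cases "p \<in> sym_group (sum_list la)")
  case True
  have pn: "p n < sum_list la" if "n < sum_list la" for n
    using True that permutes_in_image[of p "{..<sum_list la}" n] by (simp add: sym_group_def)
  have "(\<exists>i'. (i', j) \<in> diagram la \<and> m = tableau la (i', j)) \<longleftrightarrow> col_of la m = j" if "m < sum_list la" for j m
    using row_col_tableau(2) row_col_in_diagram[OF that] tableau_row_col[OF that] by metis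
  note key = this
  have "p \<in> column_group la \<longleftrightarrow> (\<forall>n<sum_list la. \<exists>i'. (i', col_of la n) \<in> diagram la \<and> p n = tableau la (i', col_of la n))"
    using True all_cells_iff[of la "\<lambda>n (i, j). \<exists>i'. (i', j) \<in> diagram la \<and> p n = tableau la (i', j)"]
    by (simp add: column_group_def case_prod_unfold)
  also have "\<dots> \<longleftrightarrow> (\<forall>n<sum_list la. col_of la (p n) = col_of la n)"
    using key pn by simp
  finally show ?thesis using True by simp
qed (simp add: column_group_def)

lemma transpose_sym_group: "a < N \<Longrightarrow> b < N \<Longrightarrow> transpose a b \<in> sym_group N"
  by (simp add: sym_group_def permutes_swap_id)

lemma transpose_row_group:
  "a < sum_list la \<Longrightarrow> b < sum_list la \<Longrightarrow> row_of la a = row_of la b \<Longrightarrow> transpose a b \<in> row_group la"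
  by (simp add: mem_row_group transpose_sym_group transpose_def)

lemma transpose_column_group:
  "a < sum_list la \<Longrightarrow> b < sum_list la \<Longrightarrow> col_of la a = col_of la b \<Longrightarrow> transpose a b \<in> column_group la"
  by (simp add: mem_column_group transpose_sym_group transpose_def)

lemma row_group_subset: "row_group la \<subseteq> sym_group (sum_list la)"
  and column_group_subset: "column_group la \<subseteq> sym_group (sum_list la)"
  by (auto simp: row_group_def column_group_def)

lemma row_group_comp: "p \<in> row_group la \<Longrightarrow> q \<in> row_group la \<Longrightarrow> p \<circ> q \<in> row_group la"
  and column_group_comp: "p \<in> column_group la \<Longrightarrow> q \<in> column_group la \<Longrightarrow> p \<circ> q \<in> column_group la"
proof -
  have less: "q n < sum_list la" if "q \<in> sym_group (sum_list la)" "n < sum_list la" for n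
    using that permutes_in_image[of q "{..<sum_list la}" n] by (simp add: sym_group_def)
  show "p \<circ> q \<in> row_group la" if "p \<in> row_group la" "q \<in> row_group la"
    using that less unfolding mem_row_group by simp
  show "p \<circ> q \<in> column_group la" if "p \<in> column_group la" "q \<in> column_group la"
    using that less unfolding mem_column_group by simp
qed

lemma row_group_inv: "p \<in> row_group la \<Longrightarrow> inv p \<in> row_group la"
  and column_group_inv: "p \<in> column_group la \<Longrightarrow> inv p \<in> column_group la"
proof -
  have inv_lt: "inv p n < sum_list la \<and> p (inv p n) = n" if "p \<in> sym_group (sum_list la)" "n < sum_list la" for n
    using that permutes_in_image[OF permutes_inv, of p "{..<sum_list la}" n] permutes_inverses(1)
    by (auto simp: sym_group_def)
  show "inv p \<in> row_group la" if "p \<in> row_group la"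
    using that inv_lt by (simp add: mem_row_group) metis
  show "inv p \<in> column_group la" if "p \<in> column_group la"
    using that inv_lt by (simp add: mem_column_group) metis
qed

lemma row_column_group_trivial:
  assumes "p \<in> row_group la" "p \<in> column_group la"
  shows "p = id"
proof
  fix n
  have p: "p permutes {..<sum_list la}"
    using assms by (simp add: mem_row_group sym_group_def)
  show "p n = id n"
  proof (cases "n < sum_list la")
    case True
    then have "p n < sum_list la" using permutes_in_image[OF p, of n] by simp
    with True show ?thesis
      using assms row_col_inj[of "p n" la n] by (simp add: mem_row_group mem_column_group)
  qed (simp add: permutes_not_in[OF p])
qed

text \<open>Row and column group meet trivially, so only \<open>q = id\<close> contributes. This
  coefficient shows that the Specht module is nonzero.\<close>

lemma young_symmetrizer_id: "young_symmetrizer la id = 1"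
proof -
  have "young_symmetrizer la id = (\<Sum>q\<in>sym_group (sum_list la). if q = id then 1 else 0)"
    unfolding young_symmetrizer_def conv_apply[OF id_sym_group] comp_id
  proof (intro sum.cong refl)
    fix q assume q: "q \<in> sym_group (sum_list la)"
    have "q \<in> column_group la" if "inv q \<in> column_group la"
      using column_group_inv[OF that] sym_group_inv_o(5)[OF q] by simp
    moreover have "id \<in> row_group la" "id \<in> column_group la"
      by (simp_all add: mem_row_group mem_column_group)
    ultimately show "row_symmetrizer la q * column_antisymmetrizer la (inv q) = (if q = id then 1 else 0)"
      using row_column_group_trivial[of q la]
      by (auto simp: row_symmetrizer_def column_antisymmetrizer_def simp del: id_apply)
  qed
  then show ?thesis by simp
qed

lemma diagram_downward:
  assumes "sorted_wrt (\<ge>) la" "(i, j) \<in> diagram la" "i' \<le> i"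
  shows "(i', j) \<in> diagram la"
proof (cases "i' = i")
  case False
  then have "la ! i \<le> la ! i'"
    using assms by (intro sorted_wrt_nth_less[OF assms(1)]) (auto simp: diagram_def)
  then show ?thesis using assms by (auto simp: diagram_def)
qed (use assms in simp)

lemma card_row_less: "card {n. n < sum_list la \<and> row_of la n < k} = sum_list (take k la)"
proof -
  have "cell la ` {n. n < sum_list la \<and> row_of la n < k} = {c \<in> cell la ` {..<sum_list la}. fst c < k}"
    by (auto simp: row_of_def)
  also have "\<dots> = diagram (take k la)"
    using bij_betw_imp_surj_on[OF bij_betw_cell, of la] by (auto simp: diagram_def)
  finally have "cell la ` {n. n < sum_list la \<and> row_of la n < k} = diagram (take k la)" .
  moreover have "inj_on (cell la) {n. n < sum_list la \<and> row_of la n < k}"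
    using bij_betw_imp_inj_on[OF bij_betw_cell] by (rule inj_on_subset) auto
  ultimately show ?thesis
    using card_image[of "cell la" "{n. n < sum_list la \<and> row_of la n < k}"] by (simp add: card_diagram)
qed

text \<open>A column of height \<open>h\<close> has at most \<open>min k h\<close> cells of colour
  below \<open>k\<close>, and these minima add up to the size of the first \<open>k\<close> rows.
  Every dominance relation below comes from this count.\<close>

lemma card_column_injective_colouring:
  fixes f :: "nat \<Rightarrow> nat"
  assumes la: "sorted_wrt (\<ge>) la"
    and f: "\<And>m n. m < sum_list la \<Longrightarrow> n < sum_list la \<Longrightarrow> m \<noteq> n \<Longrightarrow> col_of la m = col_of la n \<Longrightarrow> f m \<noteq> f n"
  shows "card {n. n < sum_list la \<and> f n < k} \<le> sum_list (take k la)"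
proof -
  let ?N = "sum_list la"
  define J where "J = col_of la ` {..<?N}"
  have split: "card {n. n < ?N \<and> P n} = (\<Sum>j\<in>J. card {n. n < ?N \<and> P n \<and> col_of la n = j})" for P
  proof -
    have "card {n. n < ?N \<and> P n} = card (\<Union>j\<in>J. {n. n < ?N \<and> P n \<and> col_of la n = j})"
      by (intro arg_cong[of _ _ card]) (auto simp: J_def)
    also have "\<dots> = (\<Sum>j\<in>J. card {n. n < ?N \<and> P n \<and> col_of la n = j})"
      by (rule card_UN_disjoint) (auto simp: J_def)
    finally show ?thesis .
  qed
  have "card {n. n < ?N \<and> f n < k \<and> col_of la n = j} \<le> card {n. n < ?N \<and> row_of la n < k \<and> col_of la n = j}" for j
  proof (cases "\<exists>n<?N. col_of la n = j \<and> k \<le> row_of la n")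
    case False
    then show ?thesis by (intro card_mono) auto
  next
    case True
    then obtain n where n: "n < ?N" "col_of la n = j" "k \<le> row_of la n" by blast
    have cells: "(i, j) \<in> diagram la" if "i < k" for i
      using diagram_downward[OF la row_col_in_diagram[OF n(1)]] n that by simp
    have "card {n. n < ?N \<and> f n < k \<and> col_of la n = j} \<le> card {..<k}"
    proof (rule card_inj_on_le[of f])
      show "inj_on f {n. n < ?N \<and> f n < k \<and> col_of la n = j}"
      proof (rule inj_onI, rule ccontr)
        fix x y assume "x \<in> {n. n < ?N \<and> f n < k \<and> col_of la n = j}"
          "y \<in> {n. n < ?N \<and> f n < k \<and> col_of la n = j}" "f x = f y" "x \<noteq> y"
        then show False using f[of x y] by simp
      qed
    qed auto
    also have "\<dots> \<le> card {n. n < ?N \<and> row_of la n < k \<and> col_of la n = j}"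
    proof (rule card_inj_on_le[of "\<lambda>i. tableau la (i, j)"])
      show "inj_on (\<lambda>i. tableau la (i, j)) {..<k}"
        by (rule inj_on_inverseI[of _ "row_of la"]) (simp add: row_col_tableau(1) cells)
      show "(\<lambda>i. tableau la (i, j)) ` {..<k} \<subseteq> {n. n < ?N \<and> row_of la n < k \<and> col_of la n = j}"
      proof (rule image_subsetI)
        fix i assume "i \<in> {..<k}"
        then have c: "(i, j) \<in> diagram la" "i < k" using cells by auto
        then have "tableau la (i, j) \<in> {..<?N}"
          using bij_betwE[OF bij_betw_tableau] by blast
        with c show "tableau la (i, j) \<in> {n. n < ?N \<and> row_of la n < k \<and> col_of la n = j}"
          by (simp add: row_col_tableau)
      qed
    qed simp
    finally show ?thesis .
  qed
  then have "card {n. n < ?N \<and> f n < k} \<le> card {n. n < ?N \<and> row_of la n < k}"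
    unfolding split[of "\<lambda>n. f n < k"] split[of "\<lambda>n. row_of la n < k"] by (rule sum_mono)
  then show ?thesis by (simp add: card_row_less)
qed

section \<open>Dominance order\<close>

definition dominated :: "nat list \<Rightarrow> nat list \<Rightarrow> bool" where
  "dominated la ka \<longleftrightarrow> (\<forall>k. sum_list (take k la) \<le> sum_list (take k ka))"

lemma nat_list_eqI_take_sums:
  fixes la ka :: "nat list"
  assumes "0 \<notin> set la" "0 \<notin> set ka" "\<And>k. sum_list (take k la) = sum_list (take k ka)"
  shows "la = ka"
proof (rule nth_equalityI)
  have *: "length la \<le> length ka"
    if "0 \<notin> set la" "\<And>k. sum_list (take k la) = sum_list (take k ka)" for la ka :: "nat list"
  proof (rule ccontr)
    assume less: "\<not> length la \<le> length ka"
    then have "sum_list (take (Suc (length ka)) la) = sum_list (take (length ka) la) + la ! length ka"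
      by (simp add: take_Suc_conv_app_nth)
    moreover have "sum_list (take (Suc (length ka)) la) = sum_list (take (length ka) la)"
      using that(2) by simp
    ultimately show False
      using that(1) less nth_mem[of "length ka" la] by simp
  qed
  show len: "length la = length ka"
    using *[of la ka] *[of ka la] assms by simp
  fix i assume "i < length la"
  then show "la ! i = ka ! i"
    using assms(3)[of i] assms(3)[of "Suc i"] len by (simp add: take_Suc_conv_app_nth)
qed

lemma dominated_antisym:
  assumes "la \<in> partitions N" "ka \<in> partitions N" "dominated la ka" "dominated ka la"
  shows "la = ka"
proof (rule nat_list_eqI_take_sums)
  show "0 \<notin> set la" "0 \<notin> set ka"
    using assms by (auto simp: partitions_def)
  show "sum_list (take k la) = sum_list (take k ka)" for k
    using assms(3,4) unfolding dominated_def by (metis le_antisym)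
qed

lemma length_le_partition: "la \<in> partitions N \<Longrightarrow> length la \<le> N"
proof -
  have "0 \<notin> set xs \<Longrightarrow> length xs \<le> sum_list xs" for xs :: "nat list"
    by (induction xs) auto
  then show "la \<in> partitions N \<Longrightarrow> length la \<le> N" by (auto simp: partitions_def)
qed

text \<open>Supplies the measure for induction along dominance. Partial sums beyond \<open>N\<close>
  rows are all \<open>N\<close>, so a strict inequality shows up at some
  \<open>k \<le> N\<close>.\<close>

lemma dominated_measure:
  assumes "la \<in> partitions N" "ka \<in> partitions N" "dominated la ka" "la \<noteq> ka"
  shows "(\<Sum>k\<le>N. sum_list (take k la)) < (\<Sum>k\<le>N. sum_list (take k ka))"
proof -
  have "\<exists>k. sum_list (take k la) < sum_list (take k ka)"
    using assms dominated_antisym[OF assms(1,2,3)] unfolding dominated_def by (metis not_le)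
  then obtain k where k: "sum_list (take k la) < sum_list (take k ka)" by blast
  have "sum_list la = N" "sum_list ka = N"
    using assms by (auto simp: partitions_def)
  then have "k \<le> N"
    using k length_le_partition[OF assms(1)] length_le_partition[OF assms(2)] by (cases "k \<le> N") auto
  then show ?thesis
    using k assms(3) by (intro sum_strict_mono_ex1) (auto simp: dominated_def)
qed

section \<open>Specht modules\<close>

lemma specht_module_left_ideal: "left_ideal (sum_list la) (specht_module la)"
proof -
  let ?N = "sum_list la" and ?c = "young_symmetrizer la"
  have alg: "0 \<in> group_algebra ?N" "f \<in> group_algebra ?N \<Longrightarrow> f' \<in> group_algebra ?N \<Longrightarrow> f + f' \<in> group_algebra ?N"
    "f \<in> group_algebra ?N \<Longrightarrow> fun_scale c f \<in> group_algebra ?N" for f f' c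
    by (simp_all add: group_algebra_def fun_scale_def)
  have "fun_vs.subspace (specht_module la)"
    unfolding fun_vs.subspace_def
  proof (intro conjI ballI allI)
    have "conv ?N 0 ?c = 0" by (simp add: conv_def fun_eq_iff)
    then show "0 \<in> specht_module la"
      using alg(1) unfolding specht_module_def by (metis imageI)
    show "x + y \<in> specht_module la" if "x \<in> specht_module la" "y \<in> specht_module la" for x y
      using that alg(2) by (auto simp: specht_module_def simp flip: conv_add_left)
    show "fun_scale c x \<in> specht_module la" if "x \<in> specht_module la" for c x
      using that alg(3) by (auto simp: specht_module_def simp flip: conv_scale_left)
  qed
  moreover have "specht_module la \<subseteq> group_algebra ?N"
    by (auto simp: specht_module_def conv_in_group_algebra)
  moreover have "conv ?N (delta g) f \<in> specht_module la" if "f \<in> specht_module la" for g f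
    using that by (auto simp: specht_module_def conv_in_group_algebra simp flip: conv_assoc)
  ultimately show ?thesis by (auto simp: left_ideal_def)
qed

lemma specht_module_nonzero: "specht_module la \<noteq> {0}"
proof
  assume eq: "specht_module la = {0}"
  have "conv (sum_list la) (delta id) (young_symmetrizer la) \<in> specht_module la"
    unfolding specht_module_def by (intro imageI delta_in_group_algebra id_sym_group)
  then have "conv (sum_list la) (delta id) (young_symmetrizer la) id = 0"
    unfolding eq by (auto simp: fun_eq_iff)
  then show False
    by (simp only: conv_delta[OF id_sym_group] id_sym_group if_True inv_id comp_id young_symmetrizer_id one_neq_zero)
qed

lemma row_symmetrizer_right:
  assumes "u \<in> sym_group (sum_list la)" "p \<in> row_group la"
  shows "row_symmetrizer la (u \<circ> p) = row_symmetrizer la u"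
proof -
  have "u \<circ> p \<in> row_group la \<longleftrightarrow> u \<in> row_group la"
    using row_group_comp[of "u \<circ> p" la "inv p"] row_group_comp[of u la p] assms row_group_inv[of p la]
      row_group_subset[of la] sym_group_inv_o(1)[of p "sum_list la"]
    by (auto simp: comp_assoc)
  then show ?thesis by (simp add: row_symmetrizer_def)
qed

lemma column_antisymmetrizer_right:
  assumes "u \<in> sym_group (sum_list la)" "q \<in> column_group la"
  shows "column_antisymmetrizer la (u \<circ> q) = of_int (sign q) * column_antisymmetrizer la u"
proof -
  have "u \<circ> q \<in> column_group la \<longleftrightarrow> u \<in> column_group la"
    using column_group_comp[of "u \<circ> q" la "inv q"] column_group_comp[of u la q] assms column_group_inv[of q la]
      column_group_subset[of la] sym_group_inv_o(1)[of q "sum_list la"]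
    by (auto simp: comp_assoc)
  moreover have "sign (u \<circ> q) = sign u * sign q"
    using assms column_group_subset[of la]
    by (intro sign_compose) (auto simp: sym_group_def permutation_permutes)
  ultimately show ?thesis by (simp add: column_antisymmetrizer_def)
qed

text \<open>Every element of the module has the column antisymmetrizer as its last right factor,
  which absorbs \<open>q\<close> up to sign.\<close>

lemma specht_module_right_antisym:
  assumes v: "v \<in> specht_module la" and h: "h \<in> sym_group (sum_list la)" and q: "q \<in> column_group la"
  shows "v (h \<circ> q) = of_int (sign q) * v h"
proof -
  let ?N = "sum_list la"
  obtain z where z: "v = conv ?N z (column_antisymmetrizer la)"
    using v by (auto simp: specht_module_def young_symmetrizer_def simp flip: conv_assoc)
  have hq: "h \<circ> q \<in> sym_group ?N"
    using h q column_group_subset by (intro comp_sym_group) auto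
  have "(\<Sum>u\<in>sym_group ?N. z u * column_antisymmetrizer la (inv u \<circ> (h \<circ> q))) =
      (\<Sum>u\<in>sym_group ?N. z u * (of_int (sign q) * column_antisymmetrizer la (inv u \<circ> h)))"
    using h q by (intro sum.cong refl) (simp add: column_antisymmetrizer_right flip: comp_assoc)
  then show ?thesis
    unfolding z conv_apply[OF hq] conv_apply[OF h] by (simp add: sum_distrib_left mult_ac)
qed

text \<open>Splits off the column antisymmetrizer; the remaining factor \<open>z\<close> ends in the
  row symmetrizer and is therefore right invariant under the row group.\<close>

lemma specht_module_expand:
  assumes v: "v \<in> specht_module la"
  obtains z where "\<And>h p. h \<in> sym_group (sum_list la) \<Longrightarrow> p \<in> row_group la \<Longrightarrow> z (h \<circ> p) = z h"
    and "\<And>h. h \<in> sym_group (sum_list la) \<Longrightarrow>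
      v h = (\<Sum>q\<in>column_group la. of_int (sign q) * z (h \<circ> inv q))"
proof -
  let ?N = "sum_list la"
  obtain y where y: "v = conv ?N (conv ?N y (row_symmetrizer la)) (column_antisymmetrizer la)"
    using v by (auto simp: specht_module_def young_symmetrizer_def simp flip: conv_assoc)
  define z where "z = conv ?N y (row_symmetrizer la)"
  show ?thesis
  proof
    fix h assume h: "h \<in> sym_group ?N"
    show "z (h \<circ> p) = z h" if p: "p \<in> row_group la" for p
    proof -
      have "h \<circ> p \<in> sym_group ?N"
        using h p row_group_subset by (intro comp_sym_group) auto
      moreover have "(\<Sum>u\<in>sym_group ?N. y u * row_symmetrizer la (inv u \<circ> (h \<circ> p))) =
          (\<Sum>u\<in>sym_group ?N. y u * row_symmetrizer la (inv u \<circ> h))"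
        using h p by (intro sum.cong refl) (simp add: row_symmetrizer_right flip: comp_assoc)
      ultimately show ?thesis
        using h by (simp add: z_def conv_apply)
    qed
    have "v h = (\<Sum>u\<in>sym_group ?N. z u * column_antisymmetrizer la (inv u \<circ> h))"
      using h by (simp add: y z_def conv_apply)
    also have "\<dots> = (\<Sum>q\<in>sym_group ?N. z (h \<circ> inv q) * column_antisymmetrizer la q)"
    proof (rule sum.reindex_bij_witness[of _ "\<lambda>q. h \<circ> inv q" "\<lambda>u. inv u \<circ> h"])
      fix u assume u: "u \<in> sym_group ?N"
      show "h \<circ> inv (inv u \<circ> h) = u" "inv (h \<circ> inv u) \<circ> h = u"
        using inv_comp_sym_group[OF inv_sym_group[OF u] h] inv_comp_sym_group[OF h inv_sym_group[OF u]] u h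
        by (simp_all add: comp_assoc)
      then show "z (h \<circ> inv (inv u \<circ> h)) * column_antisymmetrizer la (inv u \<circ> h) =
          z u * column_antisymmetrizer la (inv u \<circ> h)" by simp
    qed (use h in auto)
    also have "\<dots> = (\<Sum>q\<in>column_group la. z (h \<circ> inv q) * column_antisymmetrizer la q)"
      by (rule sum.mono_neutral_right)
        (use column_group_subset[of la] in \<open>auto simp: column_antisymmetrizer_def\<close>)
    also have "\<dots> = (\<Sum>q\<in>column_group la. of_int (sign q) * z (h \<circ> inv q))"
      by (intro sum.cong refl) (simp add: column_antisymmetrizer_def mult.commute)
    finally show "v h = (\<Sum>q\<in>column_group la. of_int (sign q) * z (h \<circ> inv q))" .
  qed
qed

lemma transpose_comp_inj:
  assumes "inj y"
  shows "transpose (y m) (y n) \<circ> y = y \<circ> transpose m n"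
  using assms by (auto simp: fun_eq_iff transpose_def inj_eq)

text \<open>Without dominance, two entries share a column of \<open>la\<close> while their images
  under \<open>y\<close> share a row of \<open>ka\<close>. The transposition of these images
  permutes the summands, and moved past \<open>y\<close> it flips the sign of
  \<open>e\<close>.\<close>

lemma sum_row_group_specht_eq_0:
  assumes ka: "ka \<in> partitions N" and la: "la \<in> partitions N" and not_dom: "\<not> dominated ka la"
    and e: "e \<in> specht_module la" and v: "v \<in> sym_group N" and y: "y \<in> sym_group N"
  shows "(\<Sum>p\<in>row_group ka. e (v \<circ> (inv p \<circ> y))) = 0"
proof -
  have N: "sum_list la = N" "sum_list ka = N" and sorted: "sorted_wrt (\<ge>) la"
    using ka la by (auto simp: partitions_def)
  have yperm: "y permutes {..<N}" using y by (simp add: sym_group_def)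
  have "\<exists>m n. m < N \<and> n < N \<and> m \<noteq> n \<and> col_of la m = col_of la n \<and> row_of ka (y m) = row_of ka (y n)"
  proof (rule ccontr)
    assume none: "\<not> ?thesis"
    have inj: "row_of ka (y m) \<noteq> row_of ka (y n)"
      if "m < sum_list la" "n < sum_list la" "m \<noteq> n" "col_of la m = col_of la n" for m n
      using that none N(1) by auto
    have "card {n. n < N \<and> row_of ka (y n) < k} \<le> sum_list (take k la)" for k
      unfolding N(1)[symmetric] by (rule card_column_injective_colouring[OF sorted]) (rule inj)
    moreover have "card {n. n < N \<and> row_of ka (y n) < k} = sum_list (take k ka)" for k
    proof -
      have "y ` {n. n < N \<and> row_of ka (y n) < k} = {n. n \<in> y ` {..<N} \<and> row_of ka n < k}"
        by auto
      also have "\<dots> = {n. n < N \<and> row_of ka n < k}"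
        unfolding permutes_image[OF yperm] by simp
      finally have "y ` {n. n < N \<and> row_of ka (y n) < k} = {n. n < N \<and> row_of ka n < k}" .
      then show ?thesis
        using card_image[OF permutes_inj_on[OF yperm], of "{n. n < N \<and> row_of ka (y n) < k}"]
          card_row_less[of ka k] N by simp
    qed
    ultimately show False using not_dom by (simp add: dominated_def)
  qed
  then obtain m n where mn: "m < N" "n < N" "m \<noteq> n" "col_of la m = col_of la n"
      "row_of ka (y m) = row_of ka (y n)"
    by blast
  let ?\<tau> = "transpose (y m) (y n)" and ?R = "row_group ka"
  have yN: "y i < N" if "i < N" for i
    using permutes_in_image[OF yperm, of i] that by simp
  have \<tau>R: "?\<tau> \<in> ?R"
    using mn yN N by (intro transpose_row_group) auto
  have \<tau>G: "?\<tau> \<in> sym_group N" using mn yN by (intro transpose_sym_group) auto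
  have RG: "p \<in> sym_group N" if "p \<in> ?R" for p
    using that row_group_subset[of ka] N(2) by auto
  have sgn: "sign (transpose m n) = - 1"
    using mn by (simp add: sign_swap_id)
  have "(\<Sum>p\<in>?R. e (v \<circ> (inv p \<circ> y))) = (\<Sum>p\<in>?R. e (v \<circ> (inv (?\<tau> \<circ> p) \<circ> y)))"
    by (rule sum.reindex_bij_witness[of _ "\<lambda>p. ?\<tau> \<circ> p" "\<lambda>p. ?\<tau> \<circ> p"])
      (auto simp: \<tau>R row_group_comp simp flip: comp_assoc)
  also have "\<dots> = (\<Sum>p\<in>?R. - e (v \<circ> (inv p \<circ> y)))"
  proof (intro sum.cong refl)
    fix p assume p: "p \<in> ?R"
    have "inv (?\<tau> \<circ> p) \<circ> y = inv p \<circ> (?\<tau> \<circ> y)"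
      using inv_comp_sym_group[OF \<tau>G RG[OF p]] by (simp add: comp_assoc inv_swap_id)
    also have "\<dots> = inv p \<circ> y \<circ> transpose m n"
      using transpose_comp_inj[OF permutes_inj[OF yperm]] by (simp add: comp_assoc)
    finally have "v \<circ> (inv (?\<tau> \<circ> p) \<circ> y) = (v \<circ> (inv p \<circ> y)) \<circ> transpose m n"
      by (simp add: comp_assoc)
    moreover have "v \<circ> (inv p \<circ> y) \<in> sym_group N"
      using v y RG[OF p] by simp
    moreover have "transpose m n \<in> column_group la"
      using mn N by (intro transpose_column_group) auto
    ultimately show "e (v \<circ> (inv (?\<tau> \<circ> p) \<circ> y)) = - e (v \<circ> (inv p \<circ> y))"
      using specht_module_right_antisym[OF e, of "v \<circ> (inv p \<circ> y)" "transpose m n"] N sgn by simp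
  qed
  finally show ?thesis
    by (simp add: sum_negf eq_neg_iff_add_eq_0)
qed

text \<open>For suitable \<open>e'\<close> the inner sum is the character of \<open>la\<close> at
  \<open>h\<close>. Replacing \<open>e\<close> by its row-invariant factor allows averaging over the
  row group of \<open>ka\<close>, where \<open>sum_row_group_specht_eq_0\<close> applies.\<close>

lemma specht_module_orthogonal:
  assumes ka: "ka \<in> partitions N" and la: "la \<in> partitions N" and not_dom: "\<not> dominated ka la"
    and e: "e \<in> specht_module ka" and e': "e' \<in> specht_module la"
  shows "(\<Sum>h\<in>sym_group N. e h * (\<Sum>x\<in>sym_group N. e' (inv x \<circ> inv h \<circ> x))) = 0"
proof -
  have N: "sum_list la = N" "sum_list ka = N"
    using ka la by (auto simp: partitions_def)
  let ?G = "sym_group N" and ?R = "row_group ka" and ?C = "column_group ka"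
  obtain z where z: "\<And>h p. h \<in> ?G \<Longrightarrow> p \<in> ?R \<Longrightarrow> z (h \<circ> p) = z h"
    and ez: "\<And>h. h \<in> ?G \<Longrightarrow> e h = (\<Sum>q\<in>?C. of_int (sign q) * z (h \<circ> inv q))"
    using specht_module_expand[OF e] N by metis
  have RG: "?R \<subseteq> ?G" and CG: "?C \<subseteq> ?G"
    using row_group_subset[of ka] column_group_subset[of ka] N by auto
  have "id \<in> ?R" by (simp add: mem_row_group)
  then have R0: "card ?R \<noteq> 0"
    using RG finite_subset[OF RG] by auto
  have zero: "(\<Sum>h\<in>?G. z h * e' (v \<circ> (inv h \<circ> x))) = 0" if v: "v \<in> ?G" and x: "x \<in> ?G" for v x
  proof -
    have "of_nat (card ?R) * (\<Sum>h\<in>?G. z h * e' (v \<circ> (inv h \<circ> x))) =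
        (\<Sum>p\<in>?R. \<Sum>h\<in>?G. z h * e' (v \<circ> (inv h \<circ> x)))"
      by simp
    also have "\<dots> = (\<Sum>p\<in>?R. \<Sum>h\<in>?G. z h * e' (v \<circ> (inv p \<circ> (inv h \<circ> x))))"
    proof (rule sum.cong[OF refl])
      fix p assume p: "p \<in> ?R"
      then have pG: "p \<in> ?G" using RG by blast
      have "(\<Sum>h\<in>?G. z h * e' (v \<circ> (inv h \<circ> x))) =
          (\<Sum>h\<in>?G. z (h \<circ> p) * e' (v \<circ> (inv (h \<circ> p) \<circ> x)))"
        using sum_sym_group_right[OF pG, of "\<lambda>h. z h * e' (v \<circ> (inv h \<circ> x))"] by simp
      also have "\<dots> = (\<Sum>h\<in>?G. z h * e' (v \<circ> (inv p \<circ> (inv h \<circ> x))))"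
      proof (intro sum.cong refl)
        fix h assume h: "h \<in> ?G"
        show "z (h \<circ> p) * e' (v \<circ> (inv (h \<circ> p) \<circ> x)) = z h * e' (v \<circ> (inv p \<circ> (inv h \<circ> x)))"
          by (simp only: z[OF h p] inv_comp_sym_group[OF h pG] comp_assoc)
      qed
      finally show "(\<Sum>h\<in>?G. z h * e' (v \<circ> (inv h \<circ> x))) =
          (\<Sum>h\<in>?G. z h * e' (v \<circ> (inv p \<circ> (inv h \<circ> x))))" .
    qed
    also have "\<dots> = (\<Sum>h\<in>?G. z h * (\<Sum>p\<in>?R. e' (v \<circ> (inv p \<circ> (inv h \<circ> x)))))"
      by (subst sum.swap) (simp add: sum_distrib_left)
    also have "\<dots> = 0"
      using sum_row_group_specht_eq_0[OF ka la not_dom e' v] x by (intro sum.neutral) simp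
    finally show ?thesis using R0 by simp
  qed
  have "(\<Sum>h\<in>?G. e h * (\<Sum>x\<in>?G. e' (inv x \<circ> inv h \<circ> x))) =
      (\<Sum>h\<in>?G. \<Sum>x\<in>?G. \<Sum>q\<in>?C. of_int (sign q) * (z (h \<circ> inv q) * e' (inv x \<circ> inv h \<circ> x)))"
    by (intro sum.cong refl) (simp add: ez sum_distrib_left sum_distrib_right mult.assoc)
  also have "\<dots> = (\<Sum>x\<in>?G. \<Sum>q\<in>?C. \<Sum>h\<in>?G. of_int (sign q) * (z (h \<circ> inv q) * e' (inv x \<circ> inv h \<circ> x)))"
    by (subst sum.swap) (intro sum.cong refl sum.swap)
  also have "\<dots> = (\<Sum>x\<in>?G. \<Sum>q\<in>?C. 0)"
  proof (intro sum.cong refl)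
    fix x q assume x: "x \<in> ?G" and "q \<in> ?C"
    then have q: "q \<in> ?G" using CG by blast
    have "(\<Sum>h\<in>?G. z (h \<circ> inv q) * e' (inv x \<circ> inv h \<circ> x)) =
        (\<Sum>h\<in>?G. z (h \<circ> q \<circ> inv q) * e' (inv x \<circ> inv (h \<circ> q) \<circ> x))"
      using sum_sym_group_right[OF q, of "\<lambda>h. z (h \<circ> inv q) * e' (inv x \<circ> inv h \<circ> x)"] by simp
    also have "\<dots> = (\<Sum>h\<in>?G. z h * e' ((inv x \<circ> inv q) \<circ> (inv h \<circ> x)))"
    proof (intro sum.cong refl)
      fix h assume h: "h \<in> ?G"
      show "z (h \<circ> q \<circ> inv q) * e' (inv x \<circ> inv (h \<circ> q) \<circ> x) = z h * e' ((inv x \<circ> inv q) \<circ> (inv h \<circ> x))"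
        by (simp only: inv_comp_sym_group[OF h q] comp_assoc sym_group_inv_o(1)[OF q] comp_id)
    qed
    also have "\<dots> = 0"
      using x q by (intro zero comp_sym_group inv_sym_group)
    finally show "(\<Sum>h\<in>?G. of_int (sign q) * (z (h \<circ> inv q) * e' (inv x \<circ> inv h \<circ> x))) = 0"
      by (simp flip: sum_distrib_left)
  qed
  finally show ?thesis by simp
qed

text \<open>Maschke's idempotent replaces the trace in a chosen basis by a sum of values of
  \<open>e\<close> at the conjugates of \<open>inv g\<close>.\<close>

lemma irr_character_eq:
  assumes la: "la \<in> partitions N"
  obtains e where "e \<in> specht_module la"
    and "\<And>g. g \<in> sym_group N \<Longrightarrow> irr_character la g = (\<Sum>x\<in>sym_group N. e (inv x \<circ> inv g \<circ> x))"
    and "irr_character la id \<noteq> 0"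
proof -
  have N: "sum_list la = N" using la by (auto simp: partitions_def)
  note ideal = specht_module_left_ideal[of la, unfolded N]
  obtain e where e: "e \<in> specht_module la" "\<forall>f\<in>specht_module la. conv N f e = f"
    using left_ideal_right_identity[OF ideal] by blast
  then show ?thesis
    using that[OF e(1)] trace_on_left_ideal[OF ideal e(1)] specht_module_nonzero[of la]
    by (simp add: irr_character_def N)
qed

section \<open>Beta numbers and dominance\<close>

definition beta_numbers :: "nat \<Rightarrow> nat list \<Rightarrow> nat \<Rightarrow> int" where
  "beta_numbers L la c = int (if c < length la then la ! c else 0) + int (L - 1 - c)"

lemma sum_parts_eq_sum_list_take:
  "(\<Sum>c<k. if c < length la then la ! c else 0) = sum_list (take k (la :: nat list))"
proof (induction k)
  case (Suc k)
  then show ?case by (cases "k < length la") (simp_all add: take_Suc_conv_app_nth)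
qed simp

text \<open>A fixed colouring \<open>F\<close> contributes the sum of \<open>e h\<close> over the
  \<open>h\<close> that preserve it. If two cells of a column of \<open>ka\<close> share a colour,
  right multiplication by their transposition keeps this condition and negates \<open>e\<close>, so
  the sum vanishes. A surviving \<open>F\<close> is injective on columns.\<close>

lemma colouring_of_alternant_sum:
  assumes sorted: "sorted_wrt (\<ge>) ka" and N: "sum_list ka = N" and e: "e \<in> specht_module ka"
    and nz: "(\<Sum>h\<in>sym_group N. e h * of_int (alternant_coeff L card (cycles_of N h) \<beta>)) \<noteq> 0"
  obtains w F where "w permutes {..<L}" "F \<in> {..<N} \<rightarrow>\<^sub>E {..<L}"
    and "\<And>c. c < L \<Longrightarrow> \<beta> c = int (L - 1 - w c) + int (card {i. i < N \<and> F i = c})"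
    and "\<And>k. card {i. i < N \<and> F i < k} \<le> sum_list (take k ka)"
proof -
  let ?G = "sym_group N" and ?W = "{w. w permutes {..<L}}" and ?F = "{..<N} \<rightarrow>\<^sub>E {..<L}"
  define Q where "Q w F \<longleftrightarrow> (\<forall>c<L. \<beta> c = int (L - 1 - w c) + int (card {i. i < N \<and> F i = c}))" for w F
  define s where "s w F = (if Q w F then of_int (sign w) else 0 :: complex)" for w F
  have "(\<Sum>h\<in>?G. e h * of_int (alternant_coeff L card (cycles_of N h) \<beta>)) =
      (\<Sum>h\<in>?G. \<Sum>w\<in>?W. \<Sum>F\<in>?F. s w F * (if F \<in> invariant_colourings L N h then e h else 0))"
  proof (intro sum.cong refl)
    fix h assume h: "h \<in> ?G"
    have "(\<Sum>F\<in>?F. s w F * (if F \<in> invariant_colourings L N h then e h else 0)) =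
        (\<Sum>F\<in>invariant_colourings L N h. s w F * e h)" for w
    proof -
      have "(\<Sum>F\<in>?F. s w F * (if F \<in> invariant_colourings L N h then e h else 0)) =
          (\<Sum>F\<in>?F. if F \<in> invariant_colourings L N h then s w F * e h else 0)"
        by (intro sum.cong) auto
      also have "\<dots> = (\<Sum>F\<in>?F \<inter> invariant_colourings L N h. s w F * e h)"
        by (simp add: sum.inter_restrict finite_PiE)
      also have "?F \<inter> invariant_colourings L N h = invariant_colourings L N h"
        by (auto simp: invariant_colourings_def)
      finally show ?thesis .
    qed
    then show "e h * of_int (alternant_coeff L card (cycles_of N h) \<beta>) =
        (\<Sum>w\<in>?W. \<Sum>F\<in>?F. s w F * (if F \<in> invariant_colourings L N h then e h else 0))"
      unfolding alternant_coeff_cycles_of[OF h] Q_def[symmetric]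
      by (simp add: sum_distrib_left) (intro sum.cong refl, simp add: s_def)
  qed
  also have "\<dots> = (\<Sum>w\<in>?W. \<Sum>F\<in>?F. \<Sum>h\<in>?G. s w F * (if F \<in> invariant_colourings L N h then e h else 0))"
    by (subst sum.swap) (intro sum.cong refl sum.swap)
  also have "\<dots> = (\<Sum>w\<in>?W. \<Sum>F\<in>?F. s w F * (\<Sum>h\<in>?G. if F \<in> invariant_colourings L N h then e h else 0))"
    by (simp only: sum_distrib_left)
  finally have "(\<Sum>w\<in>?W. \<Sum>F\<in>?F. s w F * (\<Sum>h\<in>?G. if F \<in> invariant_colourings L N h then e h else 0)) \<noteq> 0"
    using nz by simp
  then obtain w where w: "w \<in> ?W"
    and "(\<Sum>F\<in>?F. s w F * (\<Sum>h\<in>?G. if F \<in> invariant_colourings L N h then e h else 0)) \<noteq> 0"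
    by (rule sum.not_neutral_contains_not_neutral)
  from this(2) obtain F where F: "F \<in> ?F"
    and "s w F * (\<Sum>h\<in>?G. if F \<in> invariant_colourings L N h then e h else 0) \<noteq> 0"
    by (rule sum.not_neutral_contains_not_neutral)
  then have Q: "Q w F" and nz': "(\<Sum>h\<in>?G. if F \<in> invariant_colourings L N h then e h else 0) \<noteq> 0"
    by (auto simp: s_def split: if_splits)
  have "F a \<noteq> F b" if ab: "a < sum_list ka" "b < sum_list ka" "a \<noteq> b" "col_of ka a = col_of ka b" for a b
  proof
    assume eq: "F a = F b"
    let ?\<tau> = "transpose a b" and ?f = "\<lambda>h. if F \<in> invariant_colourings L N h then e h else 0"
    have \<tau>: "?\<tau> \<in> column_group ka" "?\<tau> \<in> ?G"
      using ab N by (auto intro: transpose_column_group transpose_sym_group)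
    have \<tau>F: "F (?\<tau> i) = F i" "?\<tau> i < N \<longleftrightarrow> i < N" for i
      using eq ab N by (auto simp: transpose_def)
    have inv: "F \<in> invariant_colourings L N (h \<circ> ?\<tau>) \<longleftrightarrow> F \<in> invariant_colourings L N h" for h
    proof -
      have "(\<forall>i<N. F (h (?\<tau> i)) = F i) \<longleftrightarrow> (\<forall>i<N. F (h i) = F i)"
        using \<tau>F transpose_involutory[of a b] by metis
      then show ?thesis by (simp add: invariant_colourings_def)
    qed
    have "(\<Sum>h\<in>?G. ?f h) = (\<Sum>h\<in>?G. ?f (h \<circ> ?\<tau>))"
      by (rule sum_sym_group_right[OF \<tau>(2), symmetric])
    also have "\<dots> = (\<Sum>h\<in>?G. - ?f h)"
    proof (intro sum.cong refl)
      fix h assume "h \<in> ?G"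
      then have "e (h \<circ> ?\<tau>) = - e h"
        using specht_module_right_antisym[OF e _ \<tau>(1), of h] N ab by (simp add: sign_swap_id)
      then show "?f (h \<circ> ?\<tau>) = - ?f h"
        unfolding inv by simp
    qed
    finally show False
      using nz' by (simp add: sum_negf eq_neg_iff_add_eq_0)
  qed
  then have "card {n. n < sum_list ka \<and> F n < k} \<le> sum_list (take k ka)" for k
    by (rule card_column_injective_colouring[OF sorted])
  then show ?thesis
    using that[of w F] w F Q N by (auto simp: Q_def)
qed

text \<open>Add up the first \<open>k\<close> exponents. The \<open>w c\<close> are distinct, so
  their sum is at least that of \<open>0..<k\<close>; hence the first \<open>k\<close> parts of
  \<open>la\<close> are covered by cells of colour below \<open>k\<close>, which the rows of
  \<open>ka\<close> bound.\<close>

lemma dominated_if_alternant_sum_nonzero: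
  assumes ka: "ka \<in> partitions N" and la: "la \<in> partitions N" and L: "N \<le> L"
    and e: "e \<in> specht_module ka"
    and nz: "(\<Sum>h\<in>sym_group N. e h * of_int (alternant_coeff L card (cycles_of N h) (beta_numbers L la))) \<noteq> 0"
  shows "dominated la ka"
  unfolding dominated_def
proof
  fix k
  have sorted: "sorted_wrt (\<ge>) ka" and N: "sum_list ka = N" "sum_list la = N"
    using ka la by (auto simp: partitions_def)
  obtain w F where w: "w permutes {..<L}" and F: "F \<in> {..<N} \<rightarrow>\<^sub>E {..<L}"
    and \<beta>: "\<And>c. c < L \<Longrightarrow> beta_numbers L la c = int (L - 1 - w c) + int (card {i. i < N \<and> F i = c})"
    and bound: "\<And>k. card {i. i < N \<and> F i < k} \<le> sum_list (take k ka)"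
    using colouring_of_alternant_sum[OF sorted N(1) e nz] by blast
  show "sum_list (take k la) \<le> sum_list (take k ka)"
  proof (cases "k \<le> L")
    case True
    have wL: "w c < L" if "c < k" for c
      using permutes_in_image[OF w, of c] that True by simp
    have "(\<Sum>c<k. if c < length la then la ! c else 0) + (\<Sum>c<k. L - 1 - c) =
        (\<Sum>c<k. L - 1 - w c) + (\<Sum>c<k. card {i. i < N \<and> F i = c})"
    proof -
      have "(if c < length la then la ! c else 0) + (L - 1 - c) =
          (L - 1 - w c) + card {i. i < N \<and> F i = c}" if "c < k" for c
        using \<beta>[of c] that True unfolding beta_numbers_def by linarith
      then show ?thesis
        unfolding sum.distrib[symmetric] by (intro sum.cong) auto
    qed
    moreover have "(\<Sum>c<k. L - 1 - w c) \<le> (\<Sum>c<k. L - 1 - c)"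
    proof -
      have "inj_on w {..<k}" using permutes_inj_on[OF w] .
      then have "\<Sum>{..<k} \<le> (\<Sum>c<k. w c)"
        using sum_distinct_nats_ge[of "w ` {..<k}"] by (simp add: card_image sum.reindex)
      moreover have "(\<Sum>c<k. L - 1 - w c) + (\<Sum>c<k. w c) = (\<Sum>c<k. L - 1)"
        using wL unfolding sum.distrib[symmetric] by (intro sum.cong refl) fastforce
      moreover have "(\<Sum>c<k. L - 1 - c) + \<Sum>{..<k} = (\<Sum>c<k. L - 1)"
        using True unfolding sum.distrib[symmetric] by (intro sum.cong refl) fastforce
      ultimately show ?thesis by linarith
    qed
    moreover have "(\<Sum>c<k. card {i. i < N \<and> F i = c}) = card {i. i < N \<and> F i < k}"
    proof -
      have "card {i. i < N \<and> F i < k} = card (\<Union>c\<in>{..<k}. {i. i < N \<and> F i = c})"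
        by (intro arg_cong[of _ _ card]) auto
      also have "\<dots> = (\<Sum>c<k. card {i. i < N \<and> F i = c})"
        by (rule card_UN_disjoint) auto
      finally show ?thesis by simp
    qed
    ultimately have "sum_list (take k la) \<le> card {i. i < N \<and> F i < k}"
      unfolding sum_parts_eq_sum_list_take by linarith
    then show ?thesis using bound[of k] by simp
  next
    case False
    then show ?thesis
      using length_le_partition[OF ka] length_le_partition[OF la] L N by simp
  qed
qed

text \<open>Distinct naturals sorted decreasingly lie above the staircase, and subtracting it leaves
  a weakly decreasing sequence. Together with antisymmetry this reduces arbitrary exponents to those
  of partitions.\<close>

lemma sort_to_beta_numbers:
  assumes inj: "inj_on \<beta> {..<L}" and nonneg: "\<And>c. c < L \<Longrightarrow> 0 \<le> \<beta> c"
    and sum: "(\<Sum>c<L. \<beta> c) = int (\<Sum>{..<L}) + int N"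
  obtains \<sigma> la where "\<sigma> permutes {..<L}" "la \<in> partitions N" "\<And>c. c < L \<Longrightarrow> \<beta> c = beta_numbers L la (\<sigma> c)"
proof -
  define S where "S = (\<lambda>c. nat (\<beta> c)) ` {..<L}"
  define xs where "xs = rev (sorted_list_of_set S)"
  have injn: "inj_on (\<lambda>c. nat (\<beta> c)) {..<L}"
    using inj nonneg by (intro inj_onI) (metis inj_onD lessThan_iff eq_nat_nat_iff)
  have finS: "finite S" and cardS: "card S = L"
    using injn by (auto simp: S_def card_image)
  have len: "length xs = L" and set: "set xs = S" and dist: "distinct xs"
    using finS cardS by (auto simp: xs_def)
  have dec: "xs ! j < xs ! i" if "i < j" "j < L" for i j
  proof -
    have "sorted_wrt (>) xs"
      unfolding xs_def sorted_wrt_rev using strict_sorted_list_of_set[of S] by simp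
    from sorted_wrt_nth_less[OF this] show ?thesis using that len by simp
  qed
  have bijx: "bij_betw ((!) xs) {..<L} S"
    using dist len set by (intro bij_betw_nth) auto
  define r where "r = the_inv_into {..<L} ((!) xs)"
  have bijr: "bij_betw r S {..<L}"
    unfolding r_def by (rule bij_betw_the_inv_into[OF bijx])
  have xr: "xs ! r v = v" if "v \<in> S" for v
    unfolding r_def using f_the_inv_into_f_bij_betw[OF bijx] that by blast
  define \<sigma> where "\<sigma> c = (if c < L then r (nat (\<beta> c)) else c)" for c
  have "bij_betw (r \<circ> (\<lambda>c. nat (\<beta> c))) {..<L} {..<L}"
    using bijr injn by (intro bij_betw_trans[of _ _ S]) (auto simp: bij_betw_def S_def)
  then have "bij_betw \<sigma> {..<L} {..<L}"
    by (rule bij_betw_cong[THEN iffD1, rotated]) (simp add: \<sigma>_def)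
  then have \<sigma>: "\<sigma> permutes {..<L}"
    by (rule bij_imp_permutes) (simp add: \<sigma>_def)
  have \<beta>: "\<beta> c = int (xs ! \<sigma> c)" if "c < L" for c
    using that nonneg xr[of "nat (\<beta> c)"] by (simp add: \<sigma>_def S_def)
  have step: "xs ! j + (j - i) \<le> xs ! i" if "i \<le> j" "j < L" for i j
    using that
  proof (induction j)
    case (Suc j)
    show ?case
    proof (cases "i = Suc j")
      case False
      then show ?thesis using Suc dec[of j "Suc j"] by fastforce
    qed simp
  qed simp
  have ge: "L - 1 - i \<le> xs ! i" if "i < L" for i
    using step[of i "L - 1"] that by linarith
  define p where "p i = xs ! i - (L - 1 - i)" for i
  have p: "xs ! i = p i + (L - 1 - i)" if "i < L" for i
    using ge[OF that] by (simp add: p_def)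
  have anti: "p j \<le> p i" if "i \<le> j" "j < L" for i j
    using step[OF that] p[of i] p[of j] that by linarith
  \<comment> \<open>The zero entries form a tail, which is cut off because \<open>partitions\<close>
    admits no part 0.\<close>
  define m where "m = card {i. i < L \<and> 0 < p i}"
  have pos: "0 < p i \<longleftrightarrow> i < m" if "i < L" for i
  proof -
    have down: "{i. i < L \<and> 0 < p i} = {..<m}"
    proof (cases "\<forall>i<L. 0 < p i")
      case True
      then have "{i. i < L \<and> 0 < p i} = {..<L}" by auto
      then show ?thesis by (simp add: m_def)
    next
      case False
      then obtain i\<^sub>0 where i\<^sub>0: "i\<^sub>0 < L \<and> p i\<^sub>0 = 0" by auto
      define l where "l = (LEAST i. i < L \<and> p i = 0)"
      have l: "l < L" "p l = 0"
        using LeastI[of "\<lambda>i. i < L \<and> p i = 0", OF i\<^sub>0] unfolding l_def by blast+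
      have below: "0 < p i" if "i < l" "i < L" for i
        using not_less_Least[of i "\<lambda>i. i < L \<and> p i = 0"] that unfolding l_def by auto
      have "p i = 0" if "l \<le> i" "i < L" for i
        using anti[OF that] l(2) by simp
      then have "0 < p i \<longleftrightarrow> i < l" if "i < L" for i
        using below[of i] that by (cases "i < l") (simp_all add: not_less)
      then have "{i. i < L \<and> 0 < p i} = {..<l}"
        using l(1) by auto
      then show ?thesis by (simp add: m_def)
    qed
    have "i \<in> {i. i < L \<and> 0 < p i} \<longleftrightarrow> i \<in> {..<m}" unfolding down ..
    then show ?thesis using that by simp
  qed
  have mL: "m \<le> L"
  proof -
    have "m \<le> card {..<L}" unfolding m_def by (rule card_mono) auto
    then show ?thesis by simp
  qed
  define la where "la = map p [0..<m]"
  have part: "(if i < length la then la ! i else 0) = p i" if "i < L" for i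
    using pos[OF that] by (auto simp: la_def)
  have "sum_list la = (\<Sum>i<L. p i)"
  proof -
    have "(\<Sum>i<L. p i) = (\<Sum>i<L. if i < length la then la ! i else 0)"
      using part by (intro sum.cong) auto
    then show ?thesis
      unfolding sum_parts_eq_sum_list_take using mL by (simp add: la_def)
  qed
  also have "\<dots> = N"
  proof -
    have "(\<Sum>c<L. \<beta> c) = (\<Sum>c<L. int (xs ! c))"
      using sum.permute[OF \<sigma>, of "\<lambda>c. int (xs ! c)"] \<beta> by (simp add: comp_def)
    also have "\<dots> = int (\<Sum>c<L. p c) + int (\<Sum>c<L. L - Suc c)"
      unfolding of_nat_add[symmetric] sum.distrib[symmetric] of_nat_sum using p by (intro sum.cong) auto
    also have "(\<Sum>c<L. L - Suc c) = \<Sum>{..<L}"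
      by (rule sum.nat_diff_reindex)
    finally show ?thesis using sum by linarith
  qed
  finally have "sum_list la = N" .
  moreover have "sorted_wrt (\<ge>) la"
    using anti mL by (simp add: la_def sorted_wrt_iff_nth_less)
  moreover have "0 \<notin> set la"
  proof
    assume "0 \<in> set la"
    then obtain i where "i < m" "p i = 0" by (auto simp: la_def)
    then show False using pos[of i] mL by simp
  qed
  ultimately have "la \<in> partitions N"
    by (simp add: partitions_def)
  moreover have "\<beta> c = beta_numbers L la (\<sigma> c)" if "c < L" for c
  proof -
    have "\<sigma> c < L" using permutes_in_image[OF \<sigma>, of c] that by simp
    then show ?thesis
      using \<beta>[OF that] p part[of "\<sigma> c"] by (simp add: beta_numbers_def)
  qed
  ultimately show ?thesis using that \<sigma> by blast
qed

section \<open>Characters as alternant coefficients\<close>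

lemma cycles_of_inv: "g \<in> sym_group N \<Longrightarrow> cycles_of N (inv g) = cycles_of N g"
  by (simp add: cycles_of_def orbit_inv_eq[OF permutation_sym_group])

text \<open>The left side weights \<open>e h\<close> by the number of \<open>x\<close> with
  \<open>x \<circ> h = inv g \<circ> x\<close>, which is a pairing up to \<open>fact L\<close>;
  \<open>inv g\<close> and \<open>g\<close> have the same cycles. Expanding the pairing separates
  \<open>g\<close> from \<open>e\<close>.\<close>

lemma fact_mult_sum_conjugates:
  fixes e :: "(nat \<Rightarrow> nat) \<Rightarrow> complex"
  assumes g: "g \<in> sym_group N" and L: "2 * N \<le> L" and B: "int (\<Sum>{..<L}) + int N < B" "int L \<le> B"
  shows "fact L * (\<Sum>x\<in>sym_group N. e (inv x \<circ> inv g \<circ> x)) =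
    (\<Sum>\<beta>\<in>{..<L} \<rightarrow>\<^sub>E {0..<B}. of_int (alternant_coeff L card (cycles_of N g) \<beta>) *
      (\<Sum>h\<in>sym_group N. e h * of_int (alternant_coeff L card (cycles_of N h) \<beta>)))"
proof -
  let ?G = "sym_group N" and ?W = "\<lambda>h. alternant_coeff L card (cycles_of N h)"
  have pairing: "of_int (alternant_pairing L B card (cycles_of N h) card (cycles_of N g)) =
      (fact L * of_nat (card {x \<in> ?G. x \<circ> h = inv g \<circ> x}) :: complex)" if h: "h \<in> ?G" for h
  proof -
    have "alternant_pairing L B card (cycles_of N h) card (cycles_of N (inv g)) =
        fact L * int (card (intertwiners h (cycles_of N h) (inv g) (cycles_of N (inv g))))"
      using g h L B sum_card_cycles_of[of h N] sum_card_cycles_of[of "inv g" N]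
      by (intro alternant_pairing_eq_card_intertwiners permutation_sym_group[of _ N] finite_cycles_of
          cyclic_on_cycles_of[of _ N]) auto
    then have "alternant_pairing L B card (cycles_of N h) card (cycles_of N g) =
        fact L * int (card {x \<in> ?G. x \<circ> h = inv g \<circ> x})"
      by (simp only: card_conjugators[OF h inv_sym_group[OF g]] cycles_of_inv[OF g])
    then show ?thesis by simp
  qed
  have "(\<Sum>x\<in>?G. e (inv x \<circ> inv g \<circ> x)) = (\<Sum>x\<in>?G. \<Sum>h\<in>?G. if x \<circ> h = inv g \<circ> x then e h else 0)"
  proof (rule sum.cong[OF refl])
    fix x assume x: "x \<in> ?G"
    have "(\<Sum>h\<in>?G. if x \<circ> h = inv g \<circ> x then e h else 0) =
        (\<Sum>h\<in>?G. if h = inv x \<circ> inv g \<circ> x then e h else 0)"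
    proof (intro sum.cong refl if_cong)
      fix h assume h: "h \<in> ?G"
      show "x \<circ> h = inv g \<circ> x \<longleftrightarrow> h = inv x \<circ> inv g \<circ> x"
        using sym_group_inv_o(3,4)[OF x] by (metis comp_assoc)
    qed
    also have "\<dots> = e (inv x \<circ> inv g \<circ> x)"
      using x g by simp
    finally show "e (inv x \<circ> inv g \<circ> x) = (\<Sum>h\<in>?G. if x \<circ> h = inv g \<circ> x then e h else 0)" ..
  qed
  also have "\<dots> = (\<Sum>h\<in>?G. \<Sum>x\<in>?G. if x \<circ> h = inv g \<circ> x then e h else 0)"
    by (rule sum.swap)
  also have "\<dots> = (\<Sum>h\<in>?G. e h * of_nat (card {x \<in> ?G. x \<circ> h = inv g \<circ> x}))"
    by (intro sum.cong refl) (simp add: sum.inter_filter[symmetric] mult.commute)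
  finally have "fact L * (\<Sum>x\<in>?G. e (inv x \<circ> inv g \<circ> x)) =
      (\<Sum>h\<in>?G. e h * (fact L * of_nat (card {x \<in> ?G. x \<circ> h = inv g \<circ> x})))"
    by (simp add: sum_distrib_left mult_ac)
  also have "\<dots> = (\<Sum>h\<in>?G. e h * of_int (alternant_pairing L B card (cycles_of N h) card (cycles_of N g)))"
    by (intro sum.cong refl) (simp only: pairing)
  also have "\<dots> = (\<Sum>h\<in>?G. \<Sum>\<beta>\<in>{..<L} \<rightarrow>\<^sub>E {0..<B}. of_int (?W g \<beta>) * (e h * of_int (?W h \<beta>)))"
    by (simp add: alternant_pairing_def sum_distrib_left mult_ac)
  also have "\<dots> = (\<Sum>\<beta>\<in>{..<L} \<rightarrow>\<^sub>E {0..<B}. \<Sum>h\<in>?G. of_int (?W g \<beta>) * (e h * of_int (?W h \<beta>)))"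
    by (rule sum.swap)
  finally show ?thesis by (simp add: sum_distrib_left)
qed

text \<open>By the expansion above the character is a combination of the alternant coefficients at the
  \<open>\<beta>\<close>-numbers of partitions dominated by \<open>ka\<close>; orthogonality to the characters of the smaller ones,
  which are known by induction, kills all but one.\<close>

lemma irr_character_alternant:
  assumes L: "2 * N \<le> L" and "ka \<in> partitions N"
  shows "\<exists>s. s \<noteq> 0 \<and> (\<forall>g\<in>sym_group N.
    irr_character ka g = s * of_int (alternant_coeff L card (cycles_of N g) (beta_numbers L ka)))"
  using assms(2)
proof (induction ka rule: measure_induct_rule[of "\<lambda>ka. \<Sum>k\<le>N. sum_list (take k ka)"])
  case (less ka)
  note ka = less.prems
  let ?G = "sym_group N" and ?W = "\<lambda>h. alternant_coeff L card (cycles_of N h)"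
  \<comment> \<open>Large enough for both demands of the pairing formula: above the total degree and
    at least \<open>L\<close>.\<close>
  define B where "B = int (\<Sum>{..<L}) + int N + int L + 1"
  obtain e where e: "e \<in> specht_module ka"
    and chi: "\<And>g. g \<in> ?G \<Longrightarrow> irr_character ka g = (\<Sum>x\<in>?G. e (inv x \<circ> inv g \<circ> x))"
    and chi_id: "irr_character ka id \<noteq> 0"
    using irr_character_eq[OF ka] by blast
  define A where "A \<beta> = (\<Sum>h\<in>?G. e h * of_int (?W h \<beta>))" for \<beta>
  have A_permute: "A (\<beta> \<circ> \<sigma>) = of_int (sign \<sigma>) * A \<beta>" if "\<sigma> permutes {..<L}" for \<beta> \<sigma>
    using that by (simp add: A_def alternant_coeff_permute sum_distrib_left mult_ac)
  have A_cong: "A \<beta> = A \<beta>'" if "\<And>c. c < L \<Longrightarrow> \<beta> c = \<beta>' c" for \<beta> \<beta>'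
    unfolding A_def
    by (intro sum.cong refl arg_cong2[of _ _ _ _ "(*)"] arg_cong[of _ _ of_int] alternant_coeff_cong that)
  \<comment> \<open>A nonzero sum forces \<open>la\<close> below \<open>ka\<close>. If they differ,
    the induction hypothesis makes the sum, up to a nonzero factor, the pairing of \<open>e\<close>
    with the character of \<open>la\<close>, which is 0 by orthogonality.\<close>
  have only_ka: "la = ka" if la: "la \<in> partitions N" and nz: "A (beta_numbers L la) \<noteq> 0" for la
  proof (rule ccontr)
    assume neq: "la \<noteq> ka"
    have "dominated la ka"
      using dominated_if_alternant_sum_nonzero[OF ka la _ e, of L] nz L by (simp add: A_def)
    moreover from this have not_dom: "\<not> dominated ka la"
      using dominated_antisym[OF la ka] neq by blast
    ultimately obtain s where s: "s \<noteq> 0"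
      and IH: "\<And>h. h \<in> ?G \<Longrightarrow> irr_character la h = s * of_int (?W h (beta_numbers L la))"
      using less.IH[OF dominated_measure[OF la ka _ neq] la] by blast
    obtain e' where e': "e' \<in> specht_module la"
      and chi': "\<And>g. g \<in> ?G \<Longrightarrow> irr_character la g = (\<Sum>x\<in>?G. e' (inv x \<circ> inv g \<circ> x))"
      using irr_character_eq[OF la] by blast
    have "s * A (beta_numbers L la) = (\<Sum>h\<in>?G. e h * irr_character la h)"
      using IH by (simp add: A_def sum_distrib_left mult_ac)
    also have "\<dots> = 0"
      using specht_module_orthogonal[OF ka la not_dom e e'] chi' by simp
    finally show False using s nz by simp
  qed
  \<comment> \<open>Sorting \<open>\<beta>\<close> costs only a sign and must lead to
    \<open>ka\<close>, so every surviving term is a multiple of the same coefficient.\<close>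
  have scalar: "\<exists>u. \<forall>g. of_int (?W g \<beta>) * A \<beta> = u * of_int (?W g (beta_numbers L ka))" for \<beta>
  proof (cases "A \<beta> = 0")
    case True
    then show ?thesis by (intro exI[of _ 0]) simp
  next
    case nz: False
    then obtain h where h: "h \<in> ?G" "?W h \<beta> \<noteq> 0"
      unfolding A_def by (auto elim!: sum.not_neutral_contains_not_neutral)
    note D = alternant_coeff_nonzeroD[OF finite_cycles_of h(2)]
    obtain \<sigma> la where \<sigma>: "\<sigma> permutes {..<L}" and la: "la \<in> partitions N"
      and \<beta>: "\<And>c. c < L \<Longrightarrow> \<beta> c = beta_numbers L la (\<sigma> c)"
      using sort_to_beta_numbers[OF D(1,2), of N] D(3) sum_card_cycles_of[OF h(1)] by auto
    have "A \<beta> = of_int (sign \<sigma>) * A (beta_numbers L la)"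
      using A_cong[of \<beta> "beta_numbers L la \<circ> \<sigma>"] \<beta> A_permute[OF \<sigma>] by simp
    then have "la = ka"
      using nz only_ka[OF la] by auto
    have "?W g \<beta> = sign \<sigma> * ?W g (beta_numbers L ka)" for g
      using alternant_coeff_cong[of L \<beta> "beta_numbers L la \<circ> \<sigma>" card "cycles_of N g"] \<beta>
        alternant_coeff_permute[OF finite_cycles_of \<sigma>, of card N g "beta_numbers L la"] \<open>la = ka\<close> by simp
    then show ?thesis
      by (intro exI[of _ "of_int (sign \<sigma>) * A \<beta>"]) (simp add: mult_ac)
  qed
  then obtain u where u: "\<And>\<beta> g. of_int (?W g \<beta>) * A \<beta> = u \<beta> * of_int (?W g (beta_numbers L ka))"
    by metis
  define s where "s = (\<Sum>\<beta>\<in>{..<L} \<rightarrow>\<^sub>E {0..<B}. u \<beta>) / fact L"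
  have formula: "irr_character ka g = s * of_int (?W g (beta_numbers L ka))" if g: "g \<in> ?G" for g
  proof -
    have "fact L * irr_character ka g = (\<Sum>\<beta>\<in>{..<L} \<rightarrow>\<^sub>E {0..<B}. of_int (?W g \<beta>) * A \<beta>)"
      unfolding chi[OF g] A_def using g L by (intro fact_mult_sum_conjugates) (simp_all add: B_def sum_nonneg)
    also have "\<dots> = (\<Sum>\<beta>\<in>{..<L} \<rightarrow>\<^sub>E {0..<B}. u \<beta>) * of_int (?W g (beta_numbers L ka))"
      by (simp only: u sum_distrib_right)
    finally show ?thesis
      by (simp add: s_def field_simps)
  qed
  \<comment> \<open>The character at the identity is a dimension, hence nonzero.\<close>
  moreover have "s \<noteq> 0"
    using formula[OF id_sym_group] chi_id by auto
  ultimately show ?case by blast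
qed

section \<open>Hook lengths as gaps among beta-numbers\<close>

lemma card_hook:
  assumes cd: "(i, j) \<in> diagram la" and r: "\<And>a. a < length la \<Longrightarrow> j < la ! a \<longleftrightarrow> a < r" and "r \<le> length la"
  shows "card (hook la (i, j)) = (la ! i - j) + (r - Suc i)"
proof -
  have ir: "i < r" "i < length la" "j < la ! i" using cd r[of i] by (auto simp: diagram_def)
  have "hook la (i, j) = Pair i ` {j..<la ! i} \<union> (\<lambda>a. (a, j)) ` {Suc i..<r}"
  proof (intro equalityI subsetI)
    fix c assume "c \<in> hook la (i, j)"
    then show "c \<in> Pair i ` {j..<la ! i} \<union> (\<lambda>a. (a, j)) ` {Suc i..<r}"
      using r by (cases c) (auto simp: hook_def diagram_def image_iff Suc_le_eq order_le_less)
  next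
    fix c assume "c \<in> Pair i ` {j..<la ! i} \<union> (\<lambda>a. (a, j)) ` {Suc i..<r}"
    then show "c \<in> hook la (i, j)"
      using r ir \<open>r \<le> length la\<close> by (auto simp: hook_def diagram_def)
  qed
  moreover have "card (Pair i ` {j..<la ! i} \<union> (\<lambda>a. (a, j)) ` {Suc i..<r}) =
      card (Pair i ` {j..<la ! i}) + card ((\<lambda>a. (a, j)) ` {Suc i..<r})"
    by (rule card_Un_disjoint) auto
  ultimately show ?thesis
    by (simp add: card_image inj_on_def)
qed

lemma beta_numbers_strict_mono:
  assumes la: "sorted_wrt (\<ge>) la" and "a < b" "b < L"
  shows "beta_numbers L la b < beta_numbers L la a"
  using sorted_wrt_nth_less[OF la, of a b] assms by (auto simp: beta_numbers_def)

text \<open>The hook lengths in row \<open>i\<close> are the distances from its beta-number down to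
  the unoccupied values \<open>v \<ge> 0\<close>.\<close>

lemma hook_of_beta_number_gap:
  assumes la: "la \<in> partitions N" and i: "i < L" and len: "length la \<le> L" and m: "m > 0"
    and ge: "int m \<le> beta_numbers L la i"
    and gap: "\<And>j. j < L \<Longrightarrow> beta_numbers L la j \<noteq> beta_numbers L la i - int m"
  shows "\<exists>c\<in>diagram la. card (hook la c) = m"
proof -
  let ?\<beta> = "beta_numbers L la" and ?p = "\<lambda>a. if a < length la then la ! a else 0"
  have sorted: "sorted_wrt (\<ge>) la" and pos: "0 \<notin> set la" using la by (auto simp: partitions_def)
  define v where "v = ?\<beta> i - int m"
  define r where "r = card {a. a < L \<and> v < ?\<beta> a}"
  have dec: "?\<beta> b < ?\<beta> a" if "a < b" "b < L" for a b
    using beta_numbers_strict_mono[OF sorted that] .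
  have above: "v < ?\<beta> a \<longleftrightarrow> a < r" if a: "a < L" for a
  proof
    assume v: "v < ?\<beta> a"
    have "{..a} \<subseteq> {a. a < L \<and> v < ?\<beta> a}"
    proof
      fix b assume "b \<in> {..a}"
      then show "b \<in> {a. a < L \<and> v < ?\<beta> a}"
        using dec[of b a] v a by (cases "b = a") auto
    qed
    from card_mono[OF _ this] show "a < r" by (simp add: r_def)
  next
    assume r: "a < r"
    show "v < ?\<beta> a"
    proof (rule ccontr)
      assume nv: "\<not> v < ?\<beta> a"
      have "{a. a < L \<and> v < ?\<beta> a} \<subseteq> {..<a}"
      proof
        fix b assume "b \<in> {a. a < L \<and> v < ?\<beta> a}"
        then show "b \<in> {..<a}"
          using dec[of a b] nv by (cases "a < b"; cases "a = b") auto
      qed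
      from card_mono[OF _ this] show False using r by (simp add: r_def)
    qed
  qed
  have rL: "r \<le> L"
    using card_mono[of "{..<L}" "{a. a < L \<and> v < ?\<beta> a}"] by (auto simp: r_def)
  have step: "?\<beta> b + int (b - a) \<le> ?\<beta> a" if "a \<le> b" "b < L" for a b
    using that
  proof (induction b)
    case (Suc b)
    then show ?case using dec[of b "Suc b"] by (cases "a = Suc b") auto
  qed simp
  have \<beta>p: "?\<beta> a = int (?p a) + int (L - 1 - a)" for a
    by (simp add: beta_numbers_def)
  have v0: "0 \<le> v" using ge by (simp add: v_def)
  have ir: "i < r" using above[OF i] m by (simp add: v_def)
  \<comment> \<open>Exactly \<open>L - r\<close> of the values \<open>0..<v\<close> are occupied, so
    \<open>j\<close> counts the unoccupied ones. The \<open>r\<close> rows with beta-number above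
    \<open>v\<close> turn out to be those longer than \<open>j\<close>, which makes \<open>r\<close>
    the height of column \<open>j\<close>.\<close>
  define j where "j = v - (int L - int r)"
  have j0: "0 \<le> j"
  proof (cases "r < L")
    case True
    then have "?\<beta> r < v"
      using above[of r] gap[of r] v_def by auto
    moreover have "int (L - 1 - r) \<le> ?\<beta> r" by (simp add: \<beta>p)
    ultimately show ?thesis using True unfolding j_def by linarith
  next
    case False
    then show ?thesis using rL v0 by (simp add: j_def)
  qed
  have col: "j < int (?p a) \<longleftrightarrow> a < r" if a: "a < L" for a
  proof (cases "a < r")
    case True
    have "v < ?\<beta> (r - 1)" using above[of "r - 1"] True rL by simp
    moreover have "?\<beta> (r - 1) + int (r - 1 - a) \<le> ?\<beta> a" using True rL by (intro step) auto
    ultimately have "j < int (?p a)"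
      using True a rL unfolding \<beta>p[of a] j_def by linarith
    then show ?thesis using True by simp
  next
    case False
    then have "?\<beta> r < v" using above[of r] gap[of r] v_def a by auto
    moreover have "?\<beta> a + int (a - r) \<le> ?\<beta> r" using False a by (intro step) auto
    ultimately have "int (?p a) \<le> j"
      using False a unfolding \<beta>p[of a] j_def by linarith
    then show ?thesis using False by simp
  qed
  have "r \<le> length la"
  proof (rule ccontr)
    assume "\<not> r \<le> length la"
    then show False using col[of "length la"] rL j0 by simp
  qed
  moreover have jp: "nat j < la ! a \<longleftrightarrow> a < r" if "a < length la" for a
    using col[of a] that len j0 by auto
  moreover have "(i, nat j) \<in> diagram la"
    using ir jp[of i] \<open>r \<le> length la\<close> by (simp add: diagram_def)
  moreover have "(la ! i - nat j) + (r - Suc i) = m"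
  proof -
    have "int (la ! i) + int (L - 1 - i) - int m = v"
      using \<beta>p[of i] ir \<open>r \<le> length la\<close> by (simp add: v_def)
    moreover have "nat j < la ! i" using jp[of i] ir \<open>r \<le> length la\<close> by simp
    ultimately show ?thesis
      using ir i rL j0 unfolding j_def by linarith
  qed
  ultimately show ?thesis
    using card_hook[of i "nat j" la r] by (intro bexI[of _ "(i, nat j)"]) simp_all
qed

lemma alternant_coeff_beta_numbers_eq_0:
  assumes la: "la \<in> partitions N" and len: "length la \<le> L"
    and K: "finite K" "k \<in> K" "s k = m" "m > 0"
    and no_hook: "\<And>c. c \<in> diagram la \<Longrightarrow> card (hook la c) \<noteq> m"
  shows "alternant_coeff L s K (beta_numbers L la) = 0"
proof -
  let ?\<beta> = "beta_numbers L la"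
  have "alternant_coeff L s (K - {k}) (?\<beta>(i := ?\<beta> i - int m)) = 0" if i: "i < L" for i
  proof (rule ccontr)
    assume "alternant_coeff L s (K - {k}) (?\<beta>(i := ?\<beta> i - int m)) \<noteq> 0"
    note D = alternant_coeff_nonzeroD[OF _ this]
    have "int m \<le> ?\<beta> i" using D(2)[of i] K i by simp
    then obtain j where j: "j < L" "?\<beta> j = ?\<beta> i - int m"
      using hook_of_beta_number_gap[OF la i len \<open>m > 0\<close>] no_hook by blast
    then have "j \<noteq> i" using \<open>m > 0\<close> by auto
    then show False
      using D(1) K i j by (auto dest: inj_onD[of _ _ i j])
  qed
  then have "(\<Sum>i<L. alternant_coeff L s (K - {k}) (?\<beta>(i := ?\<beta> i - int (s k)))) = 0"
    unfolding K(3) by (intro sum.neutral) auto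
  moreover have "K = insert k (K - {k})" using K by auto
  ultimately show ?thesis
    using alternant_coeff_insert[of "K - {k}" k L s ?\<beta>] K(1) by simp
qed

section \<open>Vanishing of characters\<close>

text \<open>Ensures that \<open>chi\<close> chooses its representative from a nonempty class. Each
  part \<open>m\<close> is realised by a cycle on a fresh block of \<open>m\<close> points.\<close>

lemma exists_cycle_type:
  "0 \<notin> set mu \<Longrightarrow> \<exists>g\<in>sym_group (sum_list mu). cycle_type (sum_list mu) g = mset mu"
proof (induction mu)
  case Nil
  show ?case by (intro bexI[of _ id]) (simp_all add: cycle_type_def del: id_apply)
next
  case (Cons m ms)
  define n where "n = sum_list ms"
  obtain g where g: "g permutes {..<n}" and type: "cycle_type n g = mset ms"
    using Cons by (auto simp: n_def sym_group_def)
  have "m > 0" using Cons.prems by simp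
  define c where "c i = (if n \<le> i \<and> i < n + m then if Suc i = n + m then n else Suc i else i)" for i
  have "inj_on c {n..<n + m}"
    by (auto simp: inj_on_def c_def split: if_splits)
  moreover have "c ` {n..<n + m} \<subseteq> {n..<n + m}"
    using \<open>m > 0\<close> by (auto simp: c_def)
  ultimately have "bij_betw c {n..<n + m} {n..<n + m}"
    by (simp add: bij_betw_def endo_inj_surj)
  then have c: "c permutes {n..<n + m}"
    by (rule bij_imp_permutes) (auto simp: c_def)
  define g' where "g' = g \<circ> c"
  have g': "g' permutes {..<n + m}"
    unfolding g'_def
    by (intro permutes_compose permutes_subset[OF c] permutes_subset[OF g]) auto
  then have perm: "permutation g'" by (auto simp: permutation_permutes)
  have low: "orbit g' i = orbit g i" if "i < n" for i
  proof (rule orbit_cong0[of _ "{..<n}"])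
    show "g' \<in> {..<n} \<rightarrow> {..<n}"
      using permutes_in_image[OF g] by (auto simp: g'_def c_def)
  qed (use that in \<open>auto simp: g'_def c_def\<close>)
  have high: "g' i = c i" if "n \<le> i" "i < n + m" for i
    using that \<open>m > 0\<close> permutes_not_in[OF g, of "c i"] by (auto simp: g'_def c_def)
  have pow: "k < m \<Longrightarrow> (g' ^^ k) n = n + k" for k
  proof (induction k)
    case (Suc k)
    then show ?case using high[of "n + k"] by (simp add: c_def)
  qed simp
  have "(g' ^^ m) n = n"
    using pow[of "m - 1"] high[of "n + (m - 1)"] \<open>m > 0\<close> by (cases m) (simp_all add: c_def)
  then have "orbit g' n = {(g' ^^ k) n | k. k < m}"
    using \<open>m > 0\<close> by (rule orbit_altdef_bounded)
  also have "\<dots> = (\<lambda>k. (g' ^^ k) n) ` {0..<m}"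
    by auto
  also have "\<dots> = (+) n ` {0..<m}"
    using pow by (intro image_cong) auto
  also have "\<dots> = {n..<n + m}"
    by (simp add: add.commute)
  finally have orb: "orbit g' n = {n..<n + m}" .
  have block: "orbit g' i = {n..<n + m}" if "i \<in> {n..<n + m}" for i
    using orbit_cyclic_eq3[OF cyclic_on_orbit'[OF perm, of n], of i] that by (simp add: orb)
  have "orbit g' ` {..<n + m} = orbit g' ` {..<n} \<union> orbit g' ` {n..<n + m}"
    unfolding image_Un[symmetric] by (intro arg_cong[of _ _ "(`) (orbit g')"]) auto
  also have "orbit g' ` {..<n} = orbit g ` {..<n}"
    using low by (intro image_cong) auto
  also have "orbit g' ` {n..<n + m} = (\<lambda>_. {n..<n + m}) ` {n..<n + m}"
    using block by (intro image_cong) auto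
  also have "\<dots> = {{n..<n + m}}"
    by (rule image_constant[of n]) (use \<open>m > 0\<close> in simp)
  finally have "orbit g' ` {..<n + m} = insert {n..<n + m} (orbit g ` {..<n})"
    by simp
  \<comment> \<open>The new cycle has to be a new set, since \<open>cycle_type\<close> forms the set
    of cycles before taking their lengths.\<close>
  moreover have "{n..<n + m} \<notin> orbit g ` {..<n}"
  proof
    assume "{n..<n + m} \<in> orbit g ` {..<n}"
    then obtain i where "i < n" "orbit g i = {n..<n + m}" by auto
    then have "n \<in> {..<n}"
      using permutes_orbit_subset[OF g, of i] \<open>m > 0\<close> by auto
    then show False by simp
  qed
  ultimately have "cycle_type (n + m) g' = mset (m # ms)"
    using type by (simp add: cycle_type_def)
  then show ?case
    using g' by (auto simp: sym_group_def n_def add.commute)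
qed

lemma chi_eq_0_if_no_hook:
  assumes la: "la \<in> partitions N" and mu: "mu \<in> partitions N" and m: "m \<in> set mu"
    and no_hook: "\<And>c. c \<in> diagram la \<Longrightarrow> card (hook la c) \<noteq> m"
  shows "chi la mu = 0"
proof -
  have N: "sum_list mu = N" and "m > 0"
    using mu m by (auto simp: partitions_def intro: Suc_leI gr0I)
  define g where "g = (SOME g. g \<in> conj_class mu)"
  have "\<exists>g. g \<in> conj_class mu"
    using exists_cycle_type[of mu] mu by (auto simp: conj_class_def partitions_def)
  then have "g \<in> conj_class mu"
    unfolding g_def by (rule someI_ex)
  then have g: "g \<in> sym_group N" and "cycle_type N g = mset mu"
    by (simp_all add: conj_class_def N)
  with m have "m \<in># image_mset card (mset_set (cycles_of N g))"
    by (simp add: cycle_type_def cycles_of_def)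
  then obtain k where k: "k \<in> cycles_of N g" "card k = m" by auto
  have "length la \<le> 2 * N" using length_le_partition[OF la] by simp
  then have "alternant_coeff (2 * N) card (cycles_of N g) (beta_numbers (2 * N) la) = 0"
    using la k \<open>m > 0\<close> no_hook by (intro alternant_coeff_beta_numbers_eq_0[of la N _ _ k card m]) auto
  then have "irr_character la g = 0"
    using irr_character_alternant[OF order_refl la] g by auto
  then show ?thesis
    by (simp add: chi_def g_def)
qed

section \<open>Partitions without parts divisible by a given number\<close>

definition partition_multisets :: "nat \<Rightarrow> nat multiset set" where
  "partition_multisets N = {M. 0 \<notin># M \<and> \<Sum>\<^sub># M = N}"

lemma bij_betw_mset_partitions: "bij_betw mset (partitions N) (partition_multisets N)"
proof (rule bij_betw_byWitness[of _ "\<lambda>M. rev (sorted_list_of_multiset M)"])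
  show "\<forall>la\<in>partitions N. rev (sorted_list_of_multiset (mset la)) = la"
  proof
    fix la assume "la \<in> partitions N"
    then have "sorted (rev la)"
      by (auto simp: partitions_def sorted_wrt_rev)
    then have "sorted_list_of_multiset (mset (rev la)) = rev la"
      by (simp only: sorted_list_of_multiset_mset sorted_sort_id)
    then show "rev (sorted_list_of_multiset (mset la)) = la"
      by (simp only: mset_rev rev_rev_ident)
  qed
  show "\<forall>M\<in>partition_multisets N. mset (rev (sorted_list_of_multiset M)) = M"
    by simp
  show "mset ` partitions N \<subseteq> partition_multisets N"
    by (auto simp: partitions_def partition_multisets_def sum_mset_sum_list)
  show "(\<lambda>M. rev (sorted_list_of_multiset M)) ` partition_multisets N \<subseteq> partitions N"
  proof clarify
    fix M assume M: "M \<in> partition_multisets N"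
    have "sum_list (rev (sorted_list_of_multiset M)) = \<Sum>\<^sub># M"
      by (simp only: sum_mset_sum_list[symmetric] mset_rev mset_sorted_list_of_multiset)
    then show "rev (sorted_list_of_multiset M) \<in> partitions N"
      using M by (auto simp: partitions_def partition_multisets_def sorted_wrt_rev)
  qed
qed

lemma finite_partitions [simp]: "finite (partitions N)"
proof -
  have "0 \<notin> set xs \<Longrightarrow> length xs \<le> sum_list xs \<and> set xs \<subseteq> {..sum_list xs}" for xs :: "nat list"
    by (induction xs) auto
  then have "partitions N \<subseteq> {xs. set xs \<subseteq> {..N} \<and> length xs \<le> N}"
    by (auto simp: partitions_def)
  then show ?thesis
    by (rule finite_subset) (simp add: finite_lists_length_le)
qed

lemma finite_partition_multisets [simp]: "finite (partition_multisets N)"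
  using bij_betw_finite[OF bij_betw_mset_partitions] by simp

lemma card_partition_multisets: "card (partition_multisets N) = num_partitions N"
  using bij_betw_same_card[OF bij_betw_mset_partitions] by (simp add: num_partitions_def)

definition regular_multisets :: "nat \<Rightarrow> nat \<Rightarrow> nat multiset set" where
  "regular_multisets t N = {M \<in> partition_multisets N. \<forall>m\<in>#M. \<not> t dvd m}"

text \<open>Splitting a part \<open>s\<close> of a \<open>t\<close>-regular partition into \<open>s div t\<close> parts \<open>t\<close> and \<open>s mod t\<close> parts \<open>1\<close>
  loses no information beyond \<open>s mod t\<close>, because the parts \<open>t\<close> of the result are exactly the new ones.\<close>

lemma sum_distinct_parts_regular_le:
  assumes t: "t \<ge> 2"
  shows "(\<Sum>M\<in>regular_multisets t N. card (set_mset M)) \<le> t * num_partitions N"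
proof -
  let ?R = "regular_multisets t N"
  define \<phi> where "\<phi> = (\<lambda>(M, s). (M - {#s#} + (replicate_mset (s div t) t + replicate_mset (s mod t) 1), s mod t))"
  have finR: "finite ?R"
    by (rule finite_subset[of _ "partition_multisets N"]) (auto simp: regular_multisets_def)
  have "inj_on \<phi> (Sigma ?R set_mset)"
  proof (rule inj_onI)
    fix x y assume x: "x \<in> Sigma ?R set_mset" and y: "y \<in> Sigma ?R set_mset" and eq': "\<phi> x = \<phi> y"
    obtain M s M' s' where xy: "x = (M, s)" "y = (M', s')" by (cases x, cases y) auto
    then have M: "M \<in> ?R" "s \<in># M" and M': "M' \<in> ?R" "s' \<in># M'" and eq: "\<phi> (M, s) = \<phi> (M', s')"
      using x y eq' by auto
    \<comment> \<open>No part of \<open>M\<close> equals \<open>t\<close>, and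
      \<open>t \<ge> 2\<close> keeps the added parts 1 apart from the added parts \<open>t\<close>,
      so the quotient can be read off.\<close>
    have count: "count (fst (\<phi> (M, s))) t = s div t" if "M \<in> ?R" "s \<in># M" for M s
    proof -
      have "t \<notin># M" using that by (auto simp: regular_multisets_def)
      then have "count M t = 0" by (simp add: not_in_iff)
      then show ?thesis using t by (auto simp: \<phi>_def)
    qed
    have "s div t = s' div t"
      using count[OF M] count[OF M'] unfolding eq by simp
    moreover have "s mod t = s' mod t"
      using eq by (simp add: \<phi>_def)
    ultimately have "s div t * t + s mod t = s' div t * t + s' mod t" by simp
    then have s: "s = s'" by simp
    then have "M - {#s#} = M' - {#s'#}"
      using eq by (simp add: \<phi>_def)
    then have "M = M'"
      using s M(2) M'(2) by (metis insert_DiffM)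
    with s xy show "x = y" by simp
  qed
  moreover have "\<phi> ` Sigma ?R set_mset \<subseteq> partition_multisets N \<times> {..<t}"
  proof (rule image_subsetI)
    fix x assume "x \<in> Sigma ?R set_mset"
    then obtain M s where x: "x = (M, s)" and M: "M \<in> ?R" "s \<in># M" by auto
    then have "\<Sum>\<^sub># (M - {#s#}) + s = N" "0 \<notin># M"
      by (auto simp: regular_multisets_def partition_multisets_def sum_mset.remove)
    moreover have "s div t * t + s mod t = s" by simp
    ultimately have "\<Sum>\<^sub># (M - {#s#}) + (s div t * t + s mod t) = N" by simp
    then show "\<phi> x \<in> partition_multisets N \<times> {..<t}"
      using t \<open>0 \<notin># M\<close> unfolding x by (auto simp: \<phi>_def partition_multisets_def dest: in_diffD)
  qed
  ultimately have "card (Sigma ?R set_mset) \<le> card (partition_multisets N \<times> {..<t})"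
    by (intro card_inj_on_le) auto
  then show ?thesis
    using finR by (simp add: card_SigmaI card_partition_multisets mult.commute)
qed

text \<open>Such a multiset is coded by \<open>D\<close> pairs of a part and its multiplicity, both
  at most \<open>N\<close>.\<close>

lemma card_few_distinct_parts_le:
  "card {M \<in> partition_multisets N. card (set_mset M) \<le> D} \<le> (N + 1) ^ (2 * D)"
proof -
  let ?X = "{..N} \<times> {..N}"
  let ?\<Phi> = "\<lambda>ps. \<Sum>(s, c)\<leftarrow>ps. replicate_mset c s"
  have "{M \<in> partition_multisets N. card (set_mset M) \<le> D} \<subseteq> ?\<Phi> ` {ps. set ps \<subseteq> ?X \<and> length ps = D}"
  proof clarify
    fix M assume M: "M \<in> partition_multisets N" and D: "card (set_mset M) \<le> D"
    define qs where "qs = map (\<lambda>s. (s, count M s)) (sorted_list_of_set (set_mset M))"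
    \<comment> \<open>Padding fixes the length at \<open>D\<close>; the pair \<open>(0, 0)\<close>
      decodes to the empty multiset.\<close>
    define ps where "ps = qs @ replicate (D - length qs) (0, 0)"
    have pos: "0 \<notin># M" and sum: "\<Sum>\<^sub># M = N" using M by (auto simp: partition_multisets_def)
    have le: "s \<le> N \<and> count M s \<le> N" if "s \<in># M" for s
    proof -
      have "s > 0" using that pos by (cases s) auto
      have "replicate_mset (count M s) s \<subseteq># M"
        by (simp add: subseteq_mset_def)
      then have "\<Sum>\<^sub># (replicate_mset (count M s) s) \<le> N"
        using sum by (metis le_add1 subset_mset.add_diff_inverse sum_mset.union)
      then have "count M s * s \<le> N" by simp
      moreover have "count M s * 1 \<le> count M s * s" "1 * s \<le> count M s * s"
        using \<open>s > 0\<close> that by (auto intro!: mult_le_mono simp: Suc_le_eq count_greater_zero_iff simp del: One_nat_def)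
      ultimately show ?thesis by linarith
    qed
    have "length qs \<le> D" using D by (simp add: qs_def)
    then have "length ps = D" by (simp add: ps_def)
    moreover have "set ps \<subseteq> ?X"
      using le by (auto simp: ps_def qs_def)
    moreover have "?\<Phi> ps = M"
    proof -
      have "sum_list (replicate n ({#} :: nat multiset)) = {#}" for n
        by (induction n) auto
      then have "?\<Phi> ps = (\<Sum>s\<leftarrow>sorted_list_of_set (set_mset M). replicate_mset (count M s) s)"
        by (simp add: ps_def qs_def comp_def)
      also have "\<dots> = (\<Sum>s\<in>set_mset M. replicate_mset (count M s) s)"
        by (simp add: sum_list_distinct_conv_sum_set)
      also have "\<dots> = M"
        by (rule multiset_eqI) (simp add: count_sum not_in_iff)
      finally show ?thesis .
    qed
    ultimately show "M \<in> ?\<Phi> ` {ps. set ps \<subseteq> ?X \<and> length ps = D}" 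
      by (intro image_eqI[of _ _ ps]) auto
  qed
  then have "card {M \<in> partition_multisets N. card (set_mset M) \<le> D} \<le> card {ps. set ps \<subseteq> ?X \<and> length ps = D}"
    by (rule surj_card_le[rotated]) (simp add: finite_lists_length_eq)
  also have "\<dots> = (N + 1) ^ (2 * D)"
    by (simp add: card_lists_length_eq card_cartesian_product power_mult power2_eq_square)
  finally show ?thesis .
qed

text \<open>Any subset of \<open>{2..r}\<close> is completed to a partition of \<open>N\<close> by
  parts 1 and can be recovered from it. Growth exponential in \<open>sqrt N\<close> is enough to
  beat \<open>card_few_distinct_parts_le\<close>.\<close>

lemma num_partitions_ge:
  assumes "r * r \<le> N"
  shows "2 ^ (r - 1) \<le> num_partitions N"
proof -
  define \<psi> where "\<psi> S = mset_set S + replicate_mset (N - \<Sum>S) 1" for S :: "nat set"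
  have fin: "finite S" if "S \<in> Pow {2..r}" for S
    using that finite_subset by auto
  have "inj_on \<psi> (Pow {2..r})"
  proof (rule inj_onI)
    fix S S' assume S: "S \<in> Pow {2..r}" "S' \<in> Pow {2..r}" and eq: "\<psi> S = \<psi> S'"
    have "set_mset (\<psi> S) - {1} = S" if "S \<in> Pow {2..r}" for S
      using that fin[OF that] by (auto simp: \<psi>_def split: if_splits)
    then show "S = S'" using S eq by metis
  qed
  moreover have "\<psi> ` Pow {2..r} \<subseteq> partition_multisets N"
  proof clarify
    fix S assume S: "S \<subseteq> {2..r}"
    then have "finite S" using finite_subset by blast
    have "\<Sum>S \<le> \<Sum>{2..r}" using S by (intro sum_mono2) auto
    also have "\<dots> \<le> card {2..r} * r" using sum_bounded_above[of "{2..r}" "\<lambda>x. x" r] by simp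
    also have "\<dots> \<le> r * r" by simp
    finally have "\<Sum>S \<le> N" using assms by simp
    then show "\<psi> S \<in> partition_multisets N"
      using S \<open>finite S\<close> sum_unfold_sum_mset[of "\<lambda>x. x" S] by (auto simp: \<psi>_def partition_multisets_def)
  qed
  ultimately have "card (Pow {2..r}) \<le> card (partition_multisets N)"
    by (intro card_inj_on_le) auto
  then show ?thesis
    by (simp add: card_Pow card_partition_multisets)
qed

text \<open>A Markov estimate: members with more than \<open>D\<close> distinct parts are bounded
  through the total in \<open>sum_distinct_parts_regular_le\<close>, the rest by the crude
  count.\<close>

lemma card_regular_multisets_le:
  assumes t: "t \<ge> 2"
  shows "D * card (regular_multisets t N) \<le> t * num_partitions N + D * (N + 1) ^ (2 * D)"
proof -
  let ?R = "regular_multisets t N"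
  let ?few = "{M \<in> ?R. card (set_mset M) \<le> D}" and ?many = "{M \<in> ?R. D < card (set_mset M)}"
  have finR: "finite ?R"
    by (rule finite_subset[of _ "partition_multisets N"]) (auto simp: regular_multisets_def)
  have "card ?R = card (?few \<union> ?many)"
    by (intro arg_cong[of _ _ card]) auto
  also have "\<dots> = card ?few + card ?many"
    using finR by (intro card_Un_disjoint) auto
  finally have split: "card ?R = card ?few + card ?many" .
  have "card ?few \<le> card {M \<in> partition_multisets N. card (set_mset M) \<le> D}"
    by (rule card_mono) (auto simp: regular_multisets_def)
  then have few: "card ?few \<le> (N + 1) ^ (2 * D)"
    using card_few_distinct_parts_le by (rule order_trans)
  have "D * card ?many = (\<Sum>M\<in>?many. D)" by simp
  also have "\<dots> \<le> (\<Sum>M\<in>?many. card (set_mset M))"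
    by (rule sum_mono) simp
  also have "\<dots> \<le> (\<Sum>M\<in>?R. card (set_mset M))"
    using finR by (intro sum_mono2) auto
  also have "\<dots> \<le> t * num_partitions N"
    by (rule sum_distinct_parts_regular_le[OF t])
  finally have "D * card ?many \<le> t * num_partitions N" .
  moreover have "D * card ?few \<le> D * (N + 1) ^ (2 * D)"
    using few by (rule mult_le_mono2)
  ultimately show ?thesis
    unfolding split distrib_left by linarith
qed

text \<open>Take \<open>D\<close> near \<open>N powr (1 / 2 - \<epsilon>)\<close>. Then
  \<open>\<epsilon> < \<delta>\<close> sends \<open>t N / D\<close> to 0, and
  \<open>\<epsilon> > 0\<close> keeps \<open>D * ln N\<close> below the order of
  \<open>sqrt N\<close>. The value 0 for \<open>t N < 2\<close> leaves that case to
  \<open>num_cores_1\<close>.\<close>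

lemma regular_fraction_tendsto_0:
  fixes \<delta> C :: real and t :: "nat \<Rightarrow> nat"
  assumes \<delta>: "\<delta> > 0" and t: "\<And>N. N \<ge> 1 \<Longrightarrow> real (t N) \<le> C * real N powr (1 / 2 - \<delta>)"
  shows "(\<lambda>N. if t N \<ge> 2 then real (card (regular_multisets (t N) N)) / real (num_partitions N) else 0) \<longlonglongrightarrow> 0"
proof -
  define \<epsilon> where "\<epsilon> = min \<delta> (1 / 2) / 2"
  have \<epsilon>: "0 < \<epsilon>" "\<epsilon> < \<delta>" "\<epsilon> < 1 / 2" using \<delta> by (auto simp: \<epsilon>_def min_def)
  \<comment> \<open>Logarithm of the bound for \<open>(N + 1) ^ (2 * D) / num_partitions N\<close>.
    Rounding \<open>D\<close> up costs the 1; rounding \<open>sqrt N\<close> down and the exponent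
    \<open>r - 1\<close> cost the 2.\<close>
  let ?E = "\<lambda>N. 2 * (real N powr (1 / 2 - \<epsilon>) + 1) * ln (real N + 1) - (sqrt (real N) - 2) * ln 2"
  have "filterlim ?E at_bot sequentially"
    using \<epsilon> by real_asymp
  then have lim2: "(\<lambda>N. exp (?E N)) \<longlonglongrightarrow> 0"
    by (rule filterlim_compose[OF exp_at_bot])
  have "(\<lambda>N. real N powr (\<epsilon> - \<delta>)) \<longlonglongrightarrow> 0"
    using \<epsilon> by real_asymp
  then have "(\<lambda>N. C * real N powr (\<epsilon> - \<delta>) + exp (?E N)) \<longlonglongrightarrow> C * 0 + 0"
    by (intro tendsto_intros lim2)
  then have lim: "(\<lambda>N. C * real N powr (\<epsilon> - \<delta>) + exp (?E N)) \<longlonglongrightarrow> 0" by simp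
  show ?thesis
  proof (rule tendsto_sandwich[OF _ _ tendsto_const lim])
    show "\<forall>\<^sub>F N in sequentially.
        (if t N \<ge> 2 then real (card (regular_multisets (t N) N)) / real (num_partitions N) else 0)
          \<le> C * real N powr (\<epsilon> - \<delta>) + exp (?E N)"
      using eventually_ge_at_top[of 1]
    proof eventually_elim
      case (elim N)
      have C: "0 \<le> C * real N powr (\<epsilon> - \<delta>)"
      proof -
        have "0 \<le> C * real N powr (1 / 2 - \<delta>)" using t[OF elim] by (meson of_nat_0_le_iff order_trans)
        then have "0 \<le> C" using elim by (simp add: zero_le_mult_iff)
        then show ?thesis by simp
      qed
      show ?case
      proof (cases "t N \<ge> 2")
        case True
        define D where "D = nat \<lceil>real N powr (1 / 2 - \<epsilon>)\<rceil>"
        define r where "r = nat \<lfloor>sqrt (real N)\<rfloor>"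
        let ?p = "real (num_partitions N)"
        have pow1: "1 \<le> real N powr (1 / 2 - \<epsilon>)" using elim \<epsilon> by (intro ge_one_powr_ge_zero) auto
        then have D: "real N powr (1 / 2 - \<epsilon>) \<le> real D" "real D \<le> real N powr (1 / 2 - \<epsilon>) + 1" "D > 0"
          unfolding D_def by linarith+
        have r: "real r \<le> sqrt (real N)" "sqrt (real N) - 1 \<le> real r"
          unfolding r_def using real_sqrt_ge_zero[of "real N"] by linarith+
        have "real r * real r \<le> sqrt (real N) * sqrt (real N)"
          using r(1) by (intro mult_mono) auto
        then have "real (r * r) \<le> real N" by simp
        then have "r * r \<le> N" by (simp only: of_nat_le_iff)
        then have "real (2 ^ (r - 1)) \<le> ?p"
          unfolding of_nat_le_iff by (rule num_partitions_ge)
        moreover have "exp ((sqrt (real N) - 2) * ln 2) \<le> real (2 ^ (r - 1))"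
        proof -
          have "exp ((sqrt (real N) - 2) * ln 2) \<le> exp (real (r - 1) * ln 2)"
            using r(2) by simp
          also have "\<dots> = real (2 ^ (r - 1))"
            by (simp add: exp_of_nat_mult)
          finally show ?thesis .
        qed
        ultimately have p: "exp ((sqrt (real N) - 2) * ln 2) \<le> ?p"
          by (meson order_trans)
        then have p0: "0 < ?p" using exp_gt_zero less_le_trans by blast
        have "real D * real (card (regular_multisets (t N) N)) \<le>
            real (t N) * ?p + real D * real ((N + 1) ^ (2 * D))"
          using card_regular_multisets_le[OF True, of D N] by (metis of_nat_add of_nat_le_iff of_nat_mult)
        then have "real (card (regular_multisets (t N) N)) / ?p \<le>
            real (t N) / real D + real ((N + 1) ^ (2 * D)) / ?p"
          using p0 D(3) by (simp add: field_simps)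
        also have "real (t N) / real D \<le> C * real N powr (1 / 2 - \<delta>) / real N powr (1 / 2 - \<epsilon>)"
          using t[OF elim] D(1) pow1 elim by (intro frac_le) auto
        also have "\<dots> = C * real N powr (\<epsilon> - \<delta>)"
          using elim by (simp add: powr_diff field_simps flip: powr_add)
        also have "real ((N + 1) ^ (2 * D)) / ?p \<le>
            exp (2 * (real N powr (1 / 2 - \<epsilon>) + 1) * ln (real N + 1)) / exp ((sqrt (real N) - 2) * ln 2)"
        proof (intro frac_le p)
          have "real ((N + 1) ^ (2 * D)) = exp (real (2 * D) * ln (real N + 1))"
            by (subst exp_of_nat_mult) (simp add: add.commute)
          also have "\<dots> \<le> exp (2 * (real N powr (1 / 2 - \<epsilon>) + 1) * ln (real N + 1))"
            using D(2) by (simp add: mult_right_mono)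
          finally show "real ((N + 1) ^ (2 * D)) \<le>
              exp (2 * (real N powr (1 / 2 - \<epsilon>) + 1) * ln (real N + 1))" .
        qed auto
        also have "\<dots> = exp (?E N)"
          by (simp add: exp_diff)
        finally show ?thesis using True by simp
      qed (use C in simp)
    qed
  qed simp_all
qed

section \<open>The theorem\<close>

lemma chi_t_core_eq_0:
  assumes "la \<in> partitions N" "t_core t la" "mu \<in> partitions N" "m \<in> set mu" "t dvd m"
  shows "chi la mu = 0"
  using assms by (intro chi_eq_0_if_no_hook[of la N mu m]) (auto simp: t_core_def)

lemma card_regular_partitions:
  "card {mu \<in> partitions N. \<forall>m\<in>set mu. \<not> t dvd m} = card (regular_multisets t N)"
proof -
  have "mset ` {mu \<in> partitions N. \<forall>m\<in>set mu. \<not> t dvd m} = {M \<in> mset ` partitions N. \<forall>m\<in>#M. \<not> t dvd m}"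
    by auto
  also have "\<dots> = regular_multisets t N"
    using bij_betw_imp_surj_on[OF bij_betw_mset_partitions] by (simp add: regular_multisets_def)
  finally have "mset ` {mu \<in> partitions N. \<forall>m\<in>set mu. \<not> t dvd m} = regular_multisets t N" .
  moreover have "inj_on mset {mu \<in> partitions N. \<forall>m\<in>set mu. \<not> t dvd m}"
    using bij_betw_imp_inj_on[OF bij_betw_mset_partitions] by (rule inj_on_subset) auto
  ultimately show ?thesis
    using card_image[of mset "{mu \<in> partitions N. \<forall>m\<in>set mu. \<not> t dvd m}"] by simp
qed

lemma num_zeros_bounds:
  "num_zeros t N \<le> num_cores t N * num_partitions N"
  "num_cores t N * num_partitions N \<le> num_zeros t N + num_cores t N * card (regular_multisets t N)"
proof -
  let ?C = "{la \<in> partitions N. t_core t la}" and ?P = "partitions N"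
  let ?R = "{mu \<in> partitions N. \<forall>m\<in>set mu. \<not> t dvd m}"
  let ?Z = "{(la, mu). la \<in> partitions N \<and> mu \<in> partitions N \<and> t_core t la \<and> chi la mu = 0}"
  have Z: "?Z \<subseteq> ?C \<times> ?P" by auto
  have "card ?Z \<le> card (?C \<times> ?P)"
    using Z by (intro card_mono) auto
  then show "num_zeros t N \<le> num_cores t N * num_partitions N"
    by (simp add: num_zeros_def num_cores_def num_partitions_def card_cartesian_product)
  have "?C \<times> ?P \<subseteq> ?Z \<union> ?C \<times> ?R"
    using chi_t_core_eq_0 by blast
  then have "card (?C \<times> ?P) \<le> card (?Z \<union> ?C \<times> ?R)"
    using finite_subset[OF Z] by (intro card_mono) auto
  also have "\<dots> \<le> card ?Z + card (?C \<times> ?R)"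
    by (rule card_Un_le)
  finally show "num_cores t N * num_partitions N \<le> num_zeros t N + num_cores t N * card (regular_multisets t N)"
    by (simp only: num_zeros_def num_cores_def num_partitions_def card_cartesian_product card_regular_partitions)
qed

text \<open>Covers \<open>t = 1\<close>, outside the range of the estimate above: both sides of the
  asymptotics are then 0.\<close>

lemma num_cores_1:
  assumes "N \<ge> 1"
  shows "num_cores 1 N = 0"
proof -
  have "\<not> t_core 1 la" if la: "la \<in> partitions N" for la
  proof -
    from la assms obtain x xs where "la = x # xs" "x > 0"
      by (cases la) (auto simp: partitions_def intro: gr0I)
    then have "(0, 0) \<in> diagram la" by (simp add: diagram_def)
    then show ?thesis by (auto simp: t_core_def)
  qed
  then show ?thesis by (simp add: num_cores_def)
qed

theorem corollary1p6:
  fixes \<delta> C :: real and t :: "nat \<Rightarrow> nat"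
  assumes "\<delta> > 0"
    and "\<And>N. t N > 0"
    and "\<And>N. N \<ge> 1 \<Longrightarrow> real (t N) \<le> C * real N powr (1 / 2 - \<delta>)"
  shows "(\<lambda>N. real (num_zeros (t N) N)) \<sim>[at_top]
           (\<lambda>N. real (num_cores (t N) N) * real (num_partitions N))"
proof (rule smallo_imp_asymp_equiv, rule landau_o.smallI)
  fix c :: real assume "c > 0"
  let ?q = "\<lambda>N. if t N \<ge> 2 then real (card (regular_multisets (t N) N)) / real (num_partitions N) else 0"
  have "\<forall>\<^sub>F N in at_top. ?q N < c"
    using regular_fraction_tendsto_0[OF assms(1,3)] \<open>c > 0\<close> by (rule order_tendstoD(2))
  then show "\<forall>\<^sub>F N in at_top.
      norm (real (num_zeros (t N) N) - real (num_cores (t N) N) * real (num_partitions N))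
        \<le> c * norm (real (num_cores (t N) N) * real (num_partitions N))"
    using eventually_ge_at_top[of 1]
  proof eventually_elim
    case (elim N)
    let ?c = "real (num_cores (t N) N)" and ?p = "real (num_partitions N)"
    let ?r = "real (card (regular_multisets (t N) N))"
    have upper: "real (num_zeros (t N) N) \<le> ?c * ?p"
      using num_zeros_bounds(1)[of "t N" N] by (metis of_nat_le_iff of_nat_mult)
    have lower: "?c * ?p \<le> real (num_zeros (t N) N) + ?c * ?r"
      using num_zeros_bounds(2)[of "t N" N] by (metis of_nat_add of_nat_le_iff of_nat_mult)
    \<comment> \<open>Kept as a product because the number of cores may be 0 for some
      \<open>N\<close>, where a quotient would be meaningless.\<close>
    have "?c * ?r \<le> c * (?c * ?p)"
    proof (cases "t N \<ge> 2")
      case True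
      have "0 < num_partitions N"
        using num_partitions_ge[of 0 N] by simp
      then have "?r \<le> c * ?p"
        using elim(1) True by (simp add: field_simps)
      then have "?c * ?r \<le> ?c * (c * ?p)"
        by (rule mult_left_mono) simp
      then show ?thesis by (simp add: mult_ac)
    next
      case False
      then have "t N = 1" using assms(2)[of N] by simp
      then show ?thesis using num_cores_1[OF elim(2)] by simp
    qed
    then show ?case
      using upper lower \<open>c > 0\<close> by simp
  qed
qed

end
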